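(* Suppose $\tau=w_0W_Q$. Then the following are equivalent: (0) $\mathcal I$ is $\tau$-standard; (i) for every $I\in\mathcal I$, the element $(\mathrm{id}W_{P_I},I)\in\underline W(\underline\lambda,\tau)$ has exactly one preimage under $\rho$; (ii) for every $I\in\mathcal I$ and every chain $I=I_r\subsetneq\dots\subsetneq I_m=[m]$ of covering relations in $\mathcal I$, with $Q^r=\bigcap_{j=r}^mP_{I_j}$: $\min_Q(\max_{Q_I}(\mathrm{id}W_{P_I}))=\max_Q(\min_{Q^r}(\mathrm{id}W_{P_I}))$; (iii) for every such $I$ and chain: $W_{P_I}\cap W^{Q_I}\subseteq W_{Q^r}\cap W^Q$; (iv) for every such $I$ and chain: $Q_I$ and $Q^r$ generate $P_I$, and every path in the Dynkin diagram of $G$ (visiting no vertex twice) connecting a vertex of $\Delta_{Q_I}\setminus\Delta_{Q^r}$ with a vertex of $\Delta_{Q^r}\setminus\Delta_{Q_I}$ contains a vertex not in $\Delta_{P_I}$.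
   Context: Let $\mathbb K$ be algebraically closed of characteristic zero, $G$ a connected, simply-connected, simple algebraic group over $\mathbb K$, $T\subseteq B$ maximal torus and Borel, $W$ the Weyl group with longest element $w_0$, $\Delta$ the simple roots, $W_\nu$ the stabilizer of a weight $\nu$. Parabolic subgroups contain $B$; for a parabolic $Q'$, $W_{Q'}$ is its Weyl group, $W^{Q'}\subseteq W$ the set of minimal-length representatives of $W/W_{Q'}$, and $\Delta_{Q'}=\{\alpha\in\Delta:s_\alpha\in W_{Q'}\}$; $W/W_{Q'}$ carries the Bruhat order; for $Q_1\subseteq Q_2$, $\pi_{Q_2}:W/W_{Q_1}\to W/W_{Q_2}$ is the projection and $\min_{Q_1},\max_{Q_1}$ give the minimal/maximal preimages. Standing data: dominant $\lambda_1,\dots,\lambda_m$, $\underline\lambda=(\lambda_1,\dots,\lambda_m)$, $\lambda=\sum\lambda_i$, $Q=BW_\lambda B$, $\tau\in W/W_Q$. $\mathcal I$ is a set of nonempty subsets of $[m]$ ordered by inclusion, graded of length $m-1$ (so $[m]\in\mathcal I$), satisfying ( * ): $\underline J\subseteq I\Rightarrow J\subseteq I$, where $\underline J=J$ if $J$ is minimal in $\mathcal I$ and otherwise $\underline J=\bigcup\{J\setminus K:K\in\mathcal I\text{ covered by }J\}$; $\lambda_I=\sum_{i\in\underline I}\lambda_i$, $P_I=BW_{\lambda_I}B$, $Q_I=\bigcap_{J\in\mathcal I,J\subseteq I}P_J$. $W(\underline\lambda,\tau)$: pairs $(\theta,I)$, $\theta\in W/W_Q$, $\theta\le\tau$, $I\in\mathcal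 I$, product order. $\underline W(\underline\lambda,\tau)=\bigsqcup_{I}\{\theta\in W/W_{P_I}:\theta\le\pi_{P_I}(\tau)\}\times\{I\}$, ordered by the transitive closure of: $(\theta,I)\ge(\phi,J)$ iff $I\supseteq J$ and $\max_Q(\theta)\ge\min_Q(\phi)$. A chain in $\underline W(\underline\lambda,\tau)$ is $\tau$-standard if it has a defining chain: a chain in $W(\underline\lambda,\tau)$ with the same index sets mapping elementwise onto it under $(\theta,I)\mapsto(\pi_{P_I}(\theta),I)$. $D(\underline\lambda,\tau)$ is the set of elements of $W(\underline\lambda,\tau)$ lying in a defining chain of some maximal $\tau$-standard chain, ordered by: $x\succeq y$ iff $x\ge y$ and both lie in the defining chain of a common maximal $\tau$-standard chain. $\rho:D(\underline\lambda,\tau)\to\underline W(\underline\lambda,\tau)$, $(\theta,I)\mapsto(\pi_{P_I}(\theta),I)$. $\mathcal I$ is $\tau$-standard if $\rho$ is an isomorphism of posets. *)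

theory Defs
  imports "HOL-Analysis.Analysis"
begin

text \<open>The group G (connected, simply connected, simple over an algebraically closed
field of characteristic 0) enters the statement only through its root datum.  Since G is
simply connected the weight lattice is the full lattice of integral weights, so G is
encoded by an irreducible reduced crystallographic root system R spanning a Euclidean
space, the Borel B by a base S of simple roots, T by the ambient space.\<close>

definition sref :: "'a::euclidean_space \<Rightarrow> 'a \<Rightarrow> 'a" where
  "sref \<alpha> v = v - (2 * (v \<bullet> \<alpha>) / (\<alpha> \<bullet> \<alpha>)) *\<^sub>R \<alpha>"

definition root_system :: "'a::euclidean_space set \<Rightarrow> bool" where
  "root_system R \<longleftrightarrow> finite R \<and> 0 \<notin> R \<and> span R = UNIV \<and>
     (\<forall>\<alpha>\<in>R. \<forall>\<beta>\<in>R. sref \<alpha> \<beta> \<in> R \<and> 2 * (\<beta> \<bullet> \<alpha>) / (\<alpha> \<bullet> \<alpha>) \<in> \<int>) \<and>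
     (\<forall>\<alpha>\<in>R. \<forall>c. c *\<^sub>R \<alpha> \<in> R \<longrightarrow> c = 1 \<or> c = -1)"

definition irreducible_rs :: "'a::euclidean_space set \<Rightarrow> bool" where
  "irreducible_rs R \<longleftrightarrow> R \<noteq> {} \<and>
     \<not> (\<exists>R1 R2. R1 \<noteq> {} \<and> R2 \<noteq> {} \<and> R = R1 \<union> R2 \<and> (\<forall>\<alpha>\<in>R1. \<forall>\<beta>\<in>R2. \<alpha> \<bullet> \<beta> = 0))"

definition is_base :: "'a::euclidean_space set \<Rightarrow> 'a set \<Rightarrow> bool" where
  "is_base R S \<longleftrightarrow> S \<subseteq> R \<and> independent S \<and>
     (\<forall>\<beta>\<in>R. (\<exists>c::'a \<Rightarrow> nat. \<beta> = (\<Sum>\<alpha>\<in>S. real (c \<alpha>) *\<^sub>R \<alpha>)) \<or>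
             (\<exists>c::'a \<Rightarrow> nat. \<beta> = - (\<Sum>\<alpha>\<in>S. real (c \<alpha>) *\<^sub>R \<alpha>)))"

definition pos_roots :: "'a::euclidean_space set \<Rightarrow> 'a set \<Rightarrow> 'a set" where
  "pos_roots R S = {\<beta>\<in>R. \<exists>c::'a \<Rightarrow> nat. \<beta> = (\<Sum>\<alpha>\<in>S. real (c \<alpha>) *\<^sub>R \<alpha>)}"

definition dominant :: "'a::euclidean_space set \<Rightarrow> 'a \<Rightarrow> bool" where
  "dominant S \<nu> \<longleftrightarrow> (\<forall>\<alpha>\<in>S. 2 * (\<nu> \<bullet> \<alpha>) / (\<alpha> \<bullet> \<alpha>) \<in> \<nat>)"

inductive_set weyl :: "'a::euclidean_space set \<Rightarrow> ('a \<Rightarrow> 'a) set" for R where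
  weyl_id: "id \<in> weyl R"
| weyl_step: "w \<in> weyl R \<Longrightarrow> \<alpha> \<in> R \<Longrightarrow> sref \<alpha> \<circ> w \<in> weyl R"

definition wlen :: "'a::euclidean_space set \<Rightarrow> 'a set \<Rightarrow> ('a \<Rightarrow> 'a) \<Rightarrow> nat" where
  "wlen R S w = card {\<beta> \<in> pos_roots R S. w \<beta> \<notin> pos_roots R S}"

definition longest :: "'a::euclidean_space set \<Rightarrow> 'a set \<Rightarrow> ('a \<Rightarrow> 'a)" where
  "longest R S = (THE w. w \<in> weyl R \<and> (\<forall>v\<in>weyl R. wlen R S v \<le> wlen R S w))"

definition bruhat_step :: "'a::euclidean_space set \<Rightarrow> 'a set \<Rightarrow> ('a \<Rightarrow> 'a) \<Rightarrow> ('a \<Rightarrow> 'a) \<Rightarrow> bool" where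
  "bruhat_step R S u v \<longleftrightarrow> u \<in> weyl R \<and> (\<exists>\<beta>\<in>R. v = u \<circ> sref \<beta>) \<and> wlen R S u < wlen R S v"

text \<open>Bruhat order on W (used only on elements of W).\<close>
definition bruhat_le :: "'a::euclidean_space set \<Rightarrow> 'a set \<Rightarrow> ('a \<Rightarrow> 'a) \<Rightarrow> ('a \<Rightarrow> 'a) \<Rightarrow> bool" where
  "bruhat_le R S = (bruhat_step R S)\<^sup>*\<^sup>*"

text \<open>A parabolic subgroup Q' containing B is represented by its Weyl group W_Q' \<subseteq> W.
Intersections of such parabolics correspond to intersections of the Weyl groups, and the
subgroup generated by two of them corresponds to the subgroup of W generated by their
Weyl groups.\<close>

text \<open>Stabiliser W_\<nu> of a weight \<nu>; the parabolic B W_\<nu> B has Weyl group W_\<nu>.\<close>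
definition stab :: "'a::euclidean_space set \<Rightarrow> 'a \<Rightarrow> ('a \<Rightarrow> 'a) set" where
  "stab R \<nu> = {w \<in> weyl R. w \<nu> = \<nu>}"

definition simple_of :: "'a::euclidean_space set \<Rightarrow> ('a \<Rightarrow> 'a) set \<Rightarrow> 'a set" where
  "simple_of S WQ = {\<alpha>\<in>S. sref \<alpha> \<in> WQ}"

definition coset :: "('a \<Rightarrow> 'a) \<Rightarrow> ('a \<Rightarrow> 'a) set \<Rightarrow> ('a \<Rightarrow> 'a) set" where
  "coset w WQ = (\<lambda>u. w \<circ> u) ` WQ"

definition cosets :: "'a::euclidean_space set \<Rightarrow> ('a \<Rightarrow> 'a) set \<Rightarrow> ('a \<Rightarrow> 'a) set set" where
  "cosets R WQ = (\<lambda>w. coset w WQ) ` weyl R"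

definition minreps :: "'a::euclidean_space set \<Rightarrow> 'a set \<Rightarrow> ('a \<Rightarrow> 'a) set \<Rightarrow> ('a \<Rightarrow> 'a) set" where
  "minreps R S WQ = {w \<in> weyl R. \<forall>u\<in>WQ. wlen R S w \<le> wlen R S (w \<circ> u)}"

definition cle :: "'a::euclidean_space set \<Rightarrow> 'a set \<Rightarrow> ('a \<Rightarrow> 'a) set \<Rightarrow> ('a \<Rightarrow> 'a) set \<Rightarrow> ('a \<Rightarrow> 'a) set \<Rightarrow> bool" where
  "cle R S WQ C1 C2 \<longleftrightarrow> (\<exists>x\<in>C1. \<exists>y\<in>C2. x \<in> minreps R S WQ \<and> y \<in> minreps R S WQ \<and> bruhat_le R S x y)"

text \<open>Projection W/W_Q1 \<rightarrow> W/W_Q2 for W_Q1 \<subseteq> W_Q2.\<close>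
definition proj :: "('a \<Rightarrow> 'a) set \<Rightarrow> ('a \<Rightarrow> 'a) set \<Rightarrow> ('a \<Rightarrow> 'a) set" where
  "proj WQ2 C = {w \<circ> u | w u. w \<in> C \<and> u \<in> WQ2}"

definition minpre :: "'a::euclidean_space set \<Rightarrow> 'a set \<Rightarrow> ('a \<Rightarrow> 'a) set \<Rightarrow> ('a \<Rightarrow> 'a) set \<Rightarrow> ('a \<Rightarrow> 'a) set \<Rightarrow> ('a \<Rightarrow> 'a) set" where
  "minpre R S WQ1 WQ2 \<theta> = (THE C. C \<in> cosets R WQ1 \<and> proj WQ2 C = \<theta> \<and>
      (\<forall>C'\<in>cosets R WQ1. proj WQ2 C' = \<theta> \<longrightarrow> cle R S WQ1 C C'))"

definition maxpre :: "'a::euclidean_space set \<Rightarrow> 'a set \<Rightarrow> ('a \<Rightarrow> 'a) set \<Rightarrow> ('a \<Rightarrow> 'a) set \<Rightarrow> ('a \<Rightarrow> 'a) set \<Rightarrow> ('a \<Rightarrow> 'a) set" where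
  "maxpre R S WQ1 WQ2 \<theta> = (THE C. C \<in> cosets R WQ1 \<and> proj WQ2 C = \<theta> \<and>
      (\<forall>C'\<in>cosets R WQ1. proj WQ2 C' = \<theta> \<longrightarrow> cle R S WQ1 C' C))"

definition gen_by :: "('a \<Rightarrow> 'a) set \<Rightarrow> ('a \<Rightarrow> 'a) set" where
  "gen_by X = {foldr (\<circ>) ws id | ws. set ws \<subseteq> X}"

definition dynkin_path :: "'a::euclidean_space set \<Rightarrow> 'a list \<Rightarrow> bool" where
  "dynkin_path S p \<longleftrightarrow> p \<noteq> [] \<and> distinct p \<and> set p \<subseteq> S \<and>
     (\<forall>k. Suc k < length p \<longrightarrow> p ! k \<bullet> p ! Suc k \<noteq> 0)"

definition covers :: "nat set set \<Rightarrow> nat set \<Rightarrow> nat set \<Rightarrow> bool" where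
  "covers II K J \<longleftrightarrow> K \<in> II \<and> J \<in> II \<and> K \<subset> J \<and> \<not> (\<exists>L\<in>II. K \<subset> L \<and> L \<subset> J)"

definition is_chain_sets :: "nat set set \<Rightarrow> nat set set \<Rightarrow> bool" where
  "is_chain_sets II C \<longleftrightarrow> C \<subseteq> II \<and> (\<forall>A\<in>C. \<forall>B\<in>C. A \<subseteq> B \<or> B \<subseteq> A)"

text \<open>Graded of length m-1: every maximal chain has m elements.\<close>
definition graded_len :: "nat set set \<Rightarrow> nat \<Rightarrow> bool" where
  "graded_len II m \<longleftrightarrow> (\<forall>C. is_chain_sets II C \<and> \<not> (\<exists>C'. is_chain_sets II C' \<and> C \<subset> C')
      \<longrightarrow> card C = m)"

definition ul :: "nat set set \<Rightarrow> nat set \<Rightarrow> nat set" where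
  "ul II J = (if \<not> (\<exists>K\<in>II. K \<subset> J) then J else \<Union>{J - K | K. covers II K J})"

definition index_sys :: "nat set set \<Rightarrow> nat \<Rightarrow> bool" where
  "index_sys II m \<longleftrightarrow> (\<forall>I\<in>II. I \<noteq> {} \<and> I \<subseteq> {1..m}) \<and> graded_len II m \<and> {1..m} \<in> II \<and>
     (\<forall>I\<in>II. \<forall>J\<in>II. ul II J \<subseteq> I \<longrightarrow> J \<subseteq> I)"

definition WQ :: "'a::euclidean_space set \<Rightarrow> (nat \<Rightarrow> 'a) \<Rightarrow> nat \<Rightarrow> ('a \<Rightarrow> 'a) set" where
  "WQ R lam m = stab R (\<Sum>i\<in>{1..m}. lam i)"

definition WP :: "'a::euclidean_space set \<Rightarrow> (nat \<Rightarrow> 'a) \<Rightarrow> nat set set \<Rightarrow> nat set \<Rightarrow> ('a \<Rightarrow> 'a) set" where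
  "WP R lam II I = stab R (\<Sum>i\<in>ul II I. lam i)"

definition WQI :: "'a::euclidean_space set \<Rightarrow> (nat \<Rightarrow> 'a) \<Rightarrow> nat set set \<Rightarrow> nat set \<Rightarrow> ('a \<Rightarrow> 'a) set" where
  "WQI R lam II I = \<Inter>{WP R lam II J | J. J \<in> II \<and> J \<subseteq> I}"

definition cover_chain :: "nat set set \<Rightarrow> nat \<Rightarrow> nat set \<Rightarrow> nat set list \<Rightarrow> bool" where
  "cover_chain II m I Is \<longleftrightarrow> Is \<noteq> [] \<and> hd Is = I \<and> last Is = {1..m} \<and>
     (\<forall>k. Suc k < length Is \<longrightarrow> covers II (Is ! k) (Is ! Suc k))"

definition WQr :: "'a::euclidean_space set \<Rightarrow> (nat \<Rightarrow> 'a) \<Rightarrow> nat set set \<Rightarrow> nat set list \<Rightarrow> ('a \<Rightarrow> 'a) set" where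
  "WQr R lam II Is = \<Inter>(WP R lam II ` set Is)"

type_synonym 'a elt = "('a \<Rightarrow> 'a) set \<times> nat set"

definition Wbig :: "'a::euclidean_space set \<Rightarrow> 'a set \<Rightarrow> (nat \<Rightarrow> 'a) \<Rightarrow> nat \<Rightarrow> nat set set
    \<Rightarrow> ('a \<Rightarrow> 'a) set \<Rightarrow> 'a elt set" where
  "Wbig R S lam m II \<tau> = {(\<theta>, I). \<theta> \<in> cosets R (WQ R lam m) \<and> cle R S (WQ R lam m) \<theta> \<tau> \<and> I \<in> II}"

definition bigle :: "'a::euclidean_space set \<Rightarrow> 'a set \<Rightarrow> (nat \<Rightarrow> 'a) \<Rightarrow> nat \<Rightarrow> 'a elt \<Rightarrow> 'a elt \<Rightarrow> bool" where
  "bigle R S lam m x y \<longleftrightarrow> cle R S (WQ R lam m) (fst x) (fst y) \<and> snd x \<subseteq> snd y"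

definition Wund :: "'a::euclidean_space set \<Rightarrow> 'a set \<Rightarrow> (nat \<Rightarrow> 'a) \<Rightarrow> nat set set
    \<Rightarrow> ('a \<Rightarrow> 'a) set \<Rightarrow> 'a elt set" where
  "Wund R S lam II \<tau> = {(\<theta>, I). I \<in> II \<and> \<theta> \<in> cosets R (WP R lam II I) \<and>
      cle R S (WP R lam II I) \<theta> (proj (WP R lam II I) \<tau>)}"

definition und_base_ge :: "'a::euclidean_space set \<Rightarrow> 'a set \<Rightarrow> (nat \<Rightarrow> 'a) \<Rightarrow> nat \<Rightarrow> nat set set
    \<Rightarrow> 'a elt \<Rightarrow> 'a elt \<Rightarrow> bool" where
  "und_base_ge R S lam m II x y \<longleftrightarrow> snd y \<subseteq> snd x \<and>
     cle R S (WQ R lam m) (minpre R S (WQ R lam m) (WP R lam II (snd y)) (fst y))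
                          (maxpre R S (WQ R lam m) (WP R lam II (snd x)) (fst x))"

definition undle :: "'a::euclidean_space set \<Rightarrow> 'a set \<Rightarrow> (nat \<Rightarrow> 'a) \<Rightarrow> nat \<Rightarrow> nat set set
    \<Rightarrow> ('a \<Rightarrow> 'a) set \<Rightarrow> 'a elt \<Rightarrow> 'a elt \<Rightarrow> bool" where
  "undle R S lam m II \<tau> = (\<lambda>y x. x \<in> Wund R S lam II \<tau> \<and> y \<in> Wund R S lam II \<tau> \<and>
      und_base_ge R S lam m II x y)\<^sup>+\<^sup>+"

definition rho :: "'a::euclidean_space set \<Rightarrow> (nat \<Rightarrow> 'a) \<Rightarrow> nat set set \<Rightarrow> 'a elt \<Rightarrow> 'a elt" where
  "rho R lam II x = (proj (WP R lam II (snd x)) (fst x), snd x)"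

definition und_chain :: "'a::euclidean_space set \<Rightarrow> 'a set \<Rightarrow> (nat \<Rightarrow> 'a) \<Rightarrow> nat \<Rightarrow> nat set set
    \<Rightarrow> ('a \<Rightarrow> 'a) set \<Rightarrow> 'a elt set \<Rightarrow> bool" where
  "und_chain R S lam m II \<tau> Cu \<longleftrightarrow> Cu \<subseteq> Wund R S lam II \<tau> \<and>
     (\<forall>x\<in>Cu. \<forall>y\<in>Cu. undle R S lam m II \<tau> x y \<or> undle R S lam m II \<tau> y x)"

definition defining :: "'a::euclidean_space set \<Rightarrow> 'a set \<Rightarrow> (nat \<Rightarrow> 'a) \<Rightarrow> nat \<Rightarrow> nat set set
    \<Rightarrow> ('a \<Rightarrow> 'a) set \<Rightarrow> 'a elt set \<Rightarrow> 'a elt set \<Rightarrow> bool" where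
  "defining R S lam m II \<tau> C Cu \<longleftrightarrow> C \<subseteq> Wbig R S lam m II \<tau> \<and>
     (\<forall>x\<in>C. \<forall>y\<in>C. bigle R S lam m x y \<or> bigle R S lam m y x) \<and>
     bij_betw (rho R lam II) C Cu"

definition tau_std_chain :: "'a::euclidean_space set \<Rightarrow> 'a set \<Rightarrow> (nat \<Rightarrow> 'a) \<Rightarrow> nat \<Rightarrow> nat set set
    \<Rightarrow> ('a \<Rightarrow> 'a) set \<Rightarrow> 'a elt set \<Rightarrow> bool" where
  "tau_std_chain R S lam m II \<tau> Cu \<longleftrightarrow> und_chain R S lam m II \<tau> Cu \<and>
     (\<exists>C. defining R S lam m II \<tau> C Cu)"

definition max_tau_std_chain :: "'a::euclidean_space set \<Rightarrow> 'a set \<Rightarrow> (nat \<Rightarrow> 'a) \<Rightarrow> nat \<Rightarrow> nat set set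
    \<Rightarrow> ('a \<Rightarrow> 'a) set \<Rightarrow> 'a elt set \<Rightarrow> bool" where
  "max_tau_std_chain R S lam m II \<tau> Cu \<longleftrightarrow> tau_std_chain R S lam m II \<tau> Cu \<and>
     \<not> (\<exists>Cu'. tau_std_chain R S lam m II \<tau> Cu' \<and> Cu \<subset> Cu')"

definition Dset :: "'a::euclidean_space set \<Rightarrow> 'a set \<Rightarrow> (nat \<Rightarrow> 'a) \<Rightarrow> nat \<Rightarrow> nat set set
    \<Rightarrow> ('a \<Rightarrow> 'a) set \<Rightarrow> 'a elt set" where
  "Dset R S lam m II \<tau> = {x. \<exists>Cu C. max_tau_std_chain R S lam m II \<tau> Cu \<and>
      defining R S lam m II \<tau> C Cu \<and> x \<in> C}"

definition Dle :: "'a::euclidean_space set \<Rightarrow> 'a set \<Rightarrow> (nat \<Rightarrow> 'a) \<Rightarrow> nat \<Rightarrow> nat set set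
    \<Rightarrow> ('a \<Rightarrow> 'a) set \<Rightarrow> 'a elt \<Rightarrow> 'a elt \<Rightarrow> bool" where
  "Dle R S lam m II \<tau> x y \<longleftrightarrow> bigle R S lam m x y \<and>
     (\<exists>Cu C. max_tau_std_chain R S lam m II \<tau> Cu \<and> defining R S lam m II \<tau> C Cu \<and> x \<in> C \<and> y \<in> C)"

definition tau_standard :: "'a::euclidean_space set \<Rightarrow> 'a set \<Rightarrow> (nat \<Rightarrow> 'a) \<Rightarrow> nat \<Rightarrow> nat set set
    \<Rightarrow> ('a \<Rightarrow> 'a) set \<Rightarrow> bool" where
  "tau_standard R S lam m II \<tau> \<longleftrightarrow>
     bij_betw (rho R lam II) (Dset R S lam m II \<tau>) (Wund R S lam II \<tau>) \<and>
     (\<forall>x\<in>Dset R S lam m II \<tau>. \<forall>y\<in>Dset R S lam m II \<tau>.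
        Dle R S lam m II \<tau> x y \<longleftrightarrow> undle R S lam m II \<tau> (rho R lam II x) (rho R lam II y))"

end

theory Submission
  imports Defs
begin

text \<open>
  All parabolics involved fix sets of dominant weights: \<open>W_{Q_I}\<close> fixes \<open>\<lambda>_i\<close> for \<open>i \<in> I\<close>, and
  the index sets attached to \<open>Q_I\<close> and \<open>Q^r\<close> together exhaust \<open>[m]\<close>, so \<open>Q_I \<inter> Q^r = Q\<close>. Let \<open>x\<close> be the
  minimal representative of the maximal \<open>Q_I\<close>-coset in \<open>P_I\<close>. Both (ii) and (iii) amount to \<open>x\<close> lying
  in \<open>W_{Q^r}\<close>. A standard chain through \<open>(x, J)\<close> for \<open>J \<subseteq> I\<close> forces the \<open>Q_I\<close>-coset of a lift of
  \<open>(id, I)\<close> to be that of \<open>x\<close>, while a chain through \<open>(id, J)\<close> for \<open>J \<supseteq> I\<close> forces the lift into \<open>Q^r\<close>;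
  if the lift is unique, (iii) follows. Conversely, under (ii) the map \<open>(v W_{P_I}, I) \<mapsto> (v x W_Q, I)\<close>,
  \<open>v\<close> minimal in its coset, is an order embedding, so every chain is standard. Along a maximal chain
  consecutive elements either have equal lifts or form a Bruhat cover within one index \<open>I\<close>, where the
  length grows by one; induction from the bottom and from the top shows that every
  defining chain is at least, respectively at most, the canonical one.
  Finally (iv) says that the connected components of the Dynkin diagram of \<open>P_I\<close> split into
  those inside \<open>Q_I\<close> and those inside \<open>Q^r\<close>.
\<close>

subsection \<open>Weyl group and length\<close>

text \<open>Existence of standard lifts is cheap; the difficulty is that a maximal standard chain
  may have several defining chains. Two descriptions of \<open>star I w\<close> settle this. It is
  minimal modulo \<open>QI I\<close>, which yields lower bounds for lifts, starting at the bottom of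
  a chain, where \<open>QI I = P I\<close>. Under (ii) it also lies in the top
  \<open>Q\<close>-coset of its \<open>QR Is\<close>-coset, which yields upper bounds, starting at
  the top of a chain, where \<open>QR [I] = P I\<close>. Each inductive step inside one index is a
  squeeze: the chain property of Bruhat quotients makes the two lengths differ by one, and passing
  from minimal representatives to \<open>star\<close> shifts all lengths for \<open>I\<close> by the
  same constant. A second obstacle is that the order on \<open>Wund\<close> is a transitive closure,
  so even its antisymmetry is unclear at first. It is pulled back from \<open>Wbig\<close> along the
  canonical lift and hence available only under (ii). For (iv), a path is turned into the product of
  its simple reflections, whose descents on the right and on the left are governed by the last and
  the first vertex.\<close>

lemma sref_linear: "linear (sref \<alpha>)"
  by (rule linearI) (auto simp: sref_def inner_add_left algebra_simps add_divide_distrib)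

lemma sref_inner_self: "sref \<alpha> v \<bullet> \<alpha> = - (v \<bullet> \<alpha>)"
  by (cases "\<alpha> = 0") (auto simp: sref_def inner_diff_left)

lemma sref_sref [simp]: "sref \<alpha> (sref \<alpha> v) = v"
  using sref_inner_self[of \<alpha> v] by (simp add: sref_def[of \<alpha> "sref \<alpha> v"]) (simp add: sref_def)

lemma sref_comp_sref [simp]: "sref \<alpha> \<circ> sref \<alpha> = id"
  by (auto simp: fun_eq_iff)

lemma sref_isometry: "sref \<alpha> u \<bullet> sref \<alpha> v = u \<bullet> v"
  by (cases "\<alpha> = 0")
    (auto simp: sref_def inner_diff_left inner_diff_right inner_commute algebra_simps)

lemma sref_self [simp]: "sref \<alpha> \<alpha> = - \<alpha>"
  by (cases "\<alpha> = 0") (auto simp: sref_def algebra_simps scaleR_2)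

lemma sref_uminus [simp]: "sref (- \<alpha>) = sref \<alpha>"
  by (auto simp: fun_eq_iff sref_def)

lemma sref_fixes_iff: "\<alpha> \<noteq> 0 \<Longrightarrow> sref \<alpha> v = v \<longleftrightarrow> v \<bullet> \<alpha> = 0"
  by (auto simp: sref_def)

lemma weyl_linear: "w \<in> weyl R \<Longrightarrow> linear w"
proof (induction rule: weyl.induct)
  case (weyl_step w \<alpha>)
  then show ?case using linear_compose[OF _ sref_linear] by blast
qed (rule linear_id)

lemma weyl_isometry: "w \<in> weyl R \<Longrightarrow> w u \<bullet> w v = u \<bullet> v"
  by (induction arbitrary: u v rule: weyl.induct) (auto simp: sref_isometry)

lemma weyl_comp: "u \<in> weyl R \<Longrightarrow> w \<in> weyl R \<Longrightarrow> u \<circ> w \<in> weyl R"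
  by (induction rule: weyl.induct) (auto simp: comp_assoc intro: weyl.intros)

lemma weyl_sref: "\<alpha> \<in> R \<Longrightarrow> sref \<alpha> \<in> weyl R"
  using weyl_step[OF weyl_id, of \<alpha> R] by simp

lemma weyl_ex_inv: "w \<in> weyl R \<Longrightarrow> \<exists>w'\<in>weyl R. w \<circ> w' = id \<and> w' \<circ> w = id"
proof (induction rule: weyl.induct)
  case weyl_id
  then show ?case by (intro bexI[of _ id]) (auto intro: weyl.intros)
next
  case (weyl_step w \<alpha>)
  then obtain w' where w': "w' \<in> weyl R" "w \<circ> w' = id" "w' \<circ> w = id" by blast
  show ?case
  proof (intro bexI conjI)
    show "w' \<circ> sref \<alpha> \<in> weyl R" using w' weyl_step by (intro weyl_comp weyl_sref)
    show "sref \<alpha> \<circ> w \<circ> (w' \<circ> sref \<alpha>) = id" "w' \<circ> sref \<alpha> \<circ> (sref \<alpha> \<circ> w) = id"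
      using w' by (auto simp: fun_eq_iff)
  qed
qed

lemma weyl_bij: "w \<in> weyl R \<Longrightarrow> bij w"
  using weyl_ex_inv o_bij by metis

lemma weyl_inv: "w \<in> weyl R \<Longrightarrow> inv w \<in> weyl R"
  by (metis weyl_ex_inv inv_unique_comp)

lemma weyl_inv_apply [simp]:
  assumes "w \<in> weyl R"
  shows "inv w (w x) = x" "w (inv w x) = x"
  using weyl_bij[OF assms] by (simp_all add: bij_is_inj bij_is_surj surj_f_inv_f)

lemma weyl_sref_conj: "w \<in> weyl R \<Longrightarrow> w (sref \<alpha> v) = sref (w \<alpha>) (w v)"
  using weyl_linear[of w R] weyl_isometry[of w R]
  by (simp add: sref_def linear_diff linear_scale)

lemma weyl_uminus: "w \<in> weyl R \<Longrightarrow> w (- v) = - w v"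
  using weyl_linear linear_neg by blast

lemma weyl_eqI:
  assumes "span R = UNIV" "u \<in> weyl R" "w \<in> weyl R" "\<And>\<beta>. \<beta> \<in> R \<Longrightarrow> u \<beta> = w \<beta>"
  shows "u = w"
  using assms linear_eq_on_span[of u w R] weyl_linear by (metis UNIV_I ext)

section \<open>Based root systems: coefficients over the base and positive roots\<close>

locale based_root_system =
  fixes R S :: "'a::euclidean_space set"
  assumes root_system: "root_system R" and is_base: "is_base R S"
begin

abbreviation "W \<equiv> weyl R"
abbreviation "Pos \<equiv> pos_roots R S"
abbreviation "len \<equiv> wlen R S"
abbreviation ble (infix "\<preceq>" 50) where "u \<preceq> w \<equiv> bruhat_le R S u w"

lemma finite_R: "finite R" and zero_notin_R: "0 \<notin> R" and span_R: "span R = UNIV"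
  and sref_R: "\<alpha> \<in> R \<Longrightarrow> \<beta> \<in> R \<Longrightarrow> sref \<alpha> \<beta> \<in> R"
  and multiple_R: "\<alpha> \<in> R \<Longrightarrow> c *\<^sub>R \<alpha> \<in> R \<Longrightarrow> c = 1 \<or> c = -1"
  using root_system by (auto simp: root_system_def)

lemma S_subset: "S \<subseteq> R" and indep_S: "independent S"
  and base_cases: "\<beta> \<in> R \<Longrightarrow> (\<exists>c::'a \<Rightarrow> nat. \<beta> = (\<Sum>\<alpha>\<in>S. real (c \<alpha>) *\<^sub>R \<alpha>)) \<or>
             (\<exists>c::'a \<Rightarrow> nat. \<beta> = - (\<Sum>\<alpha>\<in>S. real (c \<alpha>) *\<^sub>R \<alpha>))"
  using is_base by (auto simp: is_base_def)

lemma S_R: "\<alpha> \<in> S \<Longrightarrow> \<alpha> \<in> R" using S_subset by auto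

lemma finite_S: "finite S" using S_subset finite_R finite_subset by blast

lemma S_nonzero: "\<alpha> \<in> S \<Longrightarrow> \<alpha> \<noteq> 0" using S_R zero_notin_R by blast

lemma span_S: "span S = UNIV"
proof -
  have "\<beta> \<in> span S" if "\<beta> \<in> R" for \<beta>
    using base_cases[OF that] by (auto intro: span_neg span_sum span_scale span_base)
  then have "R \<subseteq> span S" by blast
  then have "span R \<subseteq> span S" by (simp add: span_minimal subspace_span)
  then show ?thesis using span_R by auto
qed

abbreviation "cf x \<equiv> representation S x"

lemma cf_simps:
  "cf (x + y) = (\<lambda>b. cf x b + cf y b)" "cf (x - y) = (\<lambda>b. cf x b - cf y b)"
  "cf (- x) = (\<lambda>b. - cf x b)" "cf (c *\<^sub>R x) = (\<lambda>b. c * cf x b)"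
  by (simp_all add: representation_add representation_diff representation_neg
      representation_scale indep_S span_S)

lemma cf_S: "\<alpha> \<in> S \<Longrightarrow> cf \<alpha> b = (if b = \<alpha> then 1 else 0)"
  using representation_basis[OF indep_S, of \<alpha>] by (auto split: if_splits)

lemma cf_sum: "finite A \<Longrightarrow> A \<subseteq> S \<Longrightarrow> cf (\<Sum>\<alpha>\<in>A. c \<alpha> *\<^sub>R \<alpha>) b = (if b \<in> A then c b else 0)"
proof (induction A rule: finite_induct)
  case empty
  then show ?case by (simp add: representation_zero)
qed (auto simp: cf_simps cf_S)

lemma cf_sum_eq: "(\<Sum>\<alpha>\<in>S. cf x \<alpha> *\<^sub>R \<alpha>) = x"
  by (rule sum_representation_eq[OF indep_S _ finite_S]) (auto simp: span_S)

lemma cf_eqI: "(\<And>\<alpha>. \<alpha> \<in> S \<Longrightarrow> cf x \<alpha> = cf y \<alpha>) \<Longrightarrow> x = y"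
  using cf_sum_eq[of x] cf_sum_eq[of y] by (metis (mono_tags, lifting) sum.cong)

lemma root_cf_cases: "\<beta> \<in> R \<Longrightarrow> (\<forall>\<alpha>\<in>S. cf \<beta> \<alpha> \<ge> 0) \<or> (\<forall>\<alpha>\<in>S. cf \<beta> \<alpha> \<le> 0)"
  using base_cases[of \<beta>] by (auto simp: cf_sum finite_S cf_simps)

lemma Pos_iff: "\<beta> \<in> Pos \<longleftrightarrow> \<beta> \<in> R \<and> (\<forall>\<alpha>\<in>S. cf \<beta> \<alpha> \<ge> 0)"
proof
  assume "\<beta> \<in> Pos"
  then show "\<beta> \<in> R \<and> (\<forall>\<alpha>\<in>S. cf \<beta> \<alpha> \<ge> 0)"
    by (auto simp: pos_roots_def cf_sum finite_S)
next
  assume A: "\<beta> \<in> R \<and> (\<forall>\<alpha>\<in>S. cf \<beta> \<alpha> \<ge> 0)"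
  show "\<beta> \<in> Pos"
  proof (rule ccontr)
    assume "\<beta> \<notin> Pos"
    with A obtain c :: "'a \<Rightarrow> nat" where "\<beta> = - (\<Sum>\<alpha>\<in>S. real (c \<alpha>) *\<^sub>R \<alpha>)"
      using base_cases[of \<beta>] by (auto simp: pos_roots_def)
    then have "\<forall>\<alpha>\<in>S. cf \<beta> \<alpha> \<le> 0" by (simp add: cf_simps cf_sum finite_S)
    with A have "\<beta> = 0" by (intro cf_eqI) (force simp: representation_zero)
    with A zero_notin_R show False by simp
  qed
qed

lemma Pos_R: "\<beta> \<in> Pos \<Longrightarrow> \<beta> \<in> R" by (simp add: Pos_iff)

lemma uminus_R: "\<beta> \<in> R \<Longrightarrow> - \<beta> \<in> R"
  using sref_R[of \<beta> \<beta>] by simp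

lemma Pos_uminus: "\<beta> \<in> R \<Longrightarrow> - \<beta> \<in> Pos \<longleftrightarrow> \<beta> \<notin> Pos"
proof
  assume b: "\<beta> \<in> R" and "- \<beta> \<in> Pos"
  show "\<beta> \<notin> Pos"
  proof
    assume "\<beta> \<in> Pos"
    with \<open>- \<beta> \<in> Pos\<close> have "\<beta> = 0" by (intro cf_eqI) (force simp: representation_zero cf_simps Pos_iff)
    with b zero_notin_R show False by simp
  qed
qed (use root_cf_cases[of \<beta>] in \<open>auto simp: Pos_iff uminus_R cf_simps\<close>)

lemma S_Pos: "\<alpha> \<in> S \<Longrightarrow> \<alpha> \<in> Pos" by (simp add: Pos_iff S_R cf_S)

lemma finite_Pos: "finite Pos" using finite_R by (simp add: pos_roots_def)

text \<open>The coefficients of a root share one sign, so a single positive coefficient decides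
  it.\<close>

lemma Pos_cf_pos: "\<beta> \<in> Pos \<Longrightarrow> \<gamma> \<in> S \<Longrightarrow> cf \<beta> \<gamma> > 0 \<Longrightarrow> \<beta>' \<in> R \<Longrightarrow> cf \<beta>' \<gamma> = cf \<beta> \<gamma> \<Longrightarrow> \<beta>' \<in> Pos"
  using root_cf_cases[of \<beta>'] by (force simp: Pos_iff)

lemma cf_sref: "\<gamma> \<noteq> \<alpha> \<Longrightarrow> \<alpha> \<in> S \<Longrightarrow> cf (sref \<alpha> x) \<gamma> = cf x \<gamma>"
  by (simp add: sref_def cf_simps cf_S)

text \<open>As the system is reduced, a positive root other than \<open>\<alpha>\<close> has a
  positive coefficient at another simple root. The reflection leaves that coefficient alone, and it
  decides the sign.\<close>

lemma simple_sref_Pos: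
  assumes "\<alpha> \<in> S" "\<beta> \<in> Pos" "\<beta> \<noteq> \<alpha>"
  shows "sref \<alpha> \<beta> \<in> Pos"
proof -
  have "\<exists>\<gamma>\<in>S. \<gamma> \<noteq> \<alpha> \<and> cf \<beta> \<gamma> > 0"
  proof (rule ccontr)
    assume "\<not> ?thesis"
    then have z: "\<gamma> \<in> S \<Longrightarrow> \<gamma> \<noteq> \<alpha> \<Longrightarrow> cf \<beta> \<gamma> = 0" for \<gamma>
      using assms(2) by (force simp: Pos_iff)
    have eq: "\<beta> = cf \<beta> \<alpha> *\<^sub>R \<alpha>"
      by (rule cf_eqI) (use z assms(1) in \<open>auto simp: cf_simps cf_S\<close>)
    then have "cf \<beta> \<alpha> = 1 \<or> cf \<beta> \<alpha> = -1"
      using multiple_R[of \<alpha> "cf \<beta> \<alpha>"] assms Pos_R S_R by metis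
    moreover have "cf \<beta> \<alpha> \<ge> 0" using assms by (simp add: Pos_iff)
    ultimately show False using eq assms(3) by auto
  qed
  then obtain \<gamma> where "\<gamma> \<in> S" "\<gamma> \<noteq> \<alpha>" "cf \<beta> \<gamma> > 0" by blast
  then show ?thesis
    using assms Pos_cf_pos[of \<beta> \<gamma> "sref \<alpha> \<beta>"] by (simp add: cf_sref Pos_R S_R sref_R)
qed

lemma simple_sref_neg: "\<alpha> \<in> S \<Longrightarrow> \<beta> \<in> Pos \<Longrightarrow> sref \<alpha> \<beta> \<notin> Pos \<Longrightarrow> \<beta> = \<alpha>"
  using simple_sref_Pos by blast

lemma weyl_R: "w \<in> W \<Longrightarrow> \<beta> \<in> R \<Longrightarrow> w \<beta> \<in> R"
  by (induction rule: weyl.induct) (auto simp: sref_R)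

lemma weyl_neg: "w \<in> W \<Longrightarrow> \<beta> \<in> R \<Longrightarrow> w (- \<beta>) \<in> Pos \<longleftrightarrow> w \<beta> \<notin> Pos"
  using Pos_uminus weyl_R weyl_uminus by metis

text \<open>An element is determined by its action on the finite spanning set
  \<open>R\<close>.\<close>

lemma finite_weyl: "finite W"
proof (rule finite_imageD)
  show "inj_on (\<lambda>w. restrict w R) W"
    by (rule inj_onI) (metis restrict_apply' span_R weyl_eqI)
  have "(\<lambda>w. restrict w R) ` W \<subseteq> R \<rightarrow>\<^sub>E R" using weyl_R by auto
  then show "finite ((\<lambda>w. restrict w R) ` W)"
    by (rule finite_subset) (simp add: finite_PiE finite_R)
qed

section \<open>Words in simple reflections, exchange and length\<close>

definition word :: "'a list \<Rightarrow> 'a \<Rightarrow> 'a" where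
  "word as = foldr (\<circ>) (map sref as) id"

lemma word_simps [simp]: "word [] = id" "word (a # as) = sref a \<circ> word as"
  by (simp_all add: word_def)

lemma word_append: "word (as @ bs) = word as \<circ> word bs"
  by (induction as) (auto simp: comp_assoc)

lemma word_weyl: "set as \<subseteq> S \<Longrightarrow> word as \<in> W"
  by (induction as) (auto intro: weyl.intros S_R)

lemma word_rev: "word (rev as) \<circ> word as = id" "word as \<circ> word (rev as) = id"
  by (induction as) (auto simp: word_append fun_eq_iff)

lemma cf_word: "set as \<subseteq> S \<Longrightarrow> \<gamma> \<notin> set as \<Longrightarrow> cf (word as x) \<gamma> = cf x \<gamma>"
  by (induction as) (auto simp: cf_sref)

text \<open>Reading the word from the right, the image of \<open>\<beta>\<close> turns negative at
  some letter \<open>a\<close>. Just before that the image equals \<open>a\<close>, so composing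
  with \<open>sref \<beta>\<close> amounts to deleting this letter.\<close>

lemma strong_exchange:
  assumes "set as \<subseteq> S" "\<beta> \<in> Pos" "word as \<beta> \<notin> Pos"
  shows "\<exists>bs. set bs \<subseteq> set as \<and> length as = Suc (length bs) \<and> word as \<circ> sref \<beta> = word bs"
  using assms
proof (induction as)
  case (Cons a as)
  show ?case
  proof (cases "word as \<beta> \<in> Pos")
    case True
    with Cons.prems have "word as \<beta> = a" by (intro simple_sref_neg) auto
    then have "word as (sref \<beta> x) = sref a (word as x)" for x
      using weyl_sref_conj[OF word_weyl[of as]] Cons.prems by simp
    then show ?thesis by (intro exI[of _ as]) (auto simp: fun_eq_iff)
  next
    case False
    have "set as \<subseteq> S" using Cons.prems by simp
    then obtain bs where "set bs \<subseteq> set as" "length as = Suc (length bs)"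
      "word as \<circ> sref \<beta> = word bs" using Cons.IH Cons.prems(2) False by blast
    then show ?thesis by (intro exI[of _ "a # bs"]) (auto simp only: word_simps comp_assoc list.set length_Cons)
  qed
qed simp

text \<open>A positive root of minimal height in its orbit is simple.\<close>

lemma root_conj_simple:
  assumes "\<beta> \<in> Pos"
  shows "\<exists>as \<alpha>. set as \<subseteq> S \<and> \<alpha> \<in> S \<and> word as \<beta> = \<alpha>"
proof -
  define X where "X = {\<gamma> \<in> Pos. \<exists>as. set as \<subseteq> S \<and> word as \<beta> = \<gamma>}"
  define ht where "ht x = (\<Sum>\<alpha>\<in>S. cf x \<alpha>)" for x
  have "\<beta> \<in> X" unfolding X_def using assms by (auto intro: exI[of _ "[]"])
  moreover have "finite X" unfolding X_def using finite_Pos by auto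
  ultimately obtain \<gamma> where \<gamma>: "\<gamma> \<in> X" "\<And>\<delta>. \<delta> \<in> X \<Longrightarrow> ht \<gamma> \<le> ht \<delta>"
    using arg_min_if_finite(1,2)[of X ht] by (metis empty_iff not_le)
  then obtain as where as: "set as \<subseteq> S" "word as \<beta> = \<gamma>" and pos: "\<gamma> \<in> Pos" unfolding X_def by blast
  \<comment> \<open>The squared norm of \<open>\<gamma>\<close> is a nonnegative combination of its
    pairings with simple roots, so some pairing is positive, and the reflection in that simple root
    lowers the height.\<close>
  have "\<gamma> \<bullet> \<gamma> > 0" using pos Pos_R zero_notin_R by auto
  moreover have "\<gamma> \<bullet> \<gamma> = (\<Sum>\<alpha>\<in>S. cf \<gamma> \<alpha> * (\<gamma> \<bullet> \<alpha>))"
    by (subst (2) cf_sum_eq[symmetric, of \<gamma>]) (simp add: inner_sum_right)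
  ultimately have "\<exists>\<alpha>\<in>S. cf \<gamma> \<alpha> * (\<gamma> \<bullet> \<alpha>) > 0"
    using sum_nonpos[of S "\<lambda>\<alpha>. cf \<gamma> \<alpha> * (\<gamma> \<bullet> \<alpha>)"] by force
  then obtain \<alpha> where \<alpha>: "\<alpha> \<in> S" "cf \<gamma> \<alpha> * (\<gamma> \<bullet> \<alpha>) > 0" by blast
  then have "\<gamma> \<bullet> \<alpha> > 0" using pos by (auto simp: Pos_iff zero_less_mult_iff dest: leD)
  have "\<gamma> = \<alpha>"
  proof (rule ccontr)
    assume "\<gamma> \<noteq> \<alpha>"
    then have "sref \<alpha> \<gamma> \<in> X"
      unfolding X_def using as \<alpha>(1) simple_sref_Pos pos
      by (auto intro!: exI[of _ "\<alpha> # as"])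
    moreover have "ht (sref \<alpha> \<gamma>) = ht \<gamma> - 2 * (\<gamma> \<bullet> \<alpha>) / (\<alpha> \<bullet> \<alpha>)"
      using \<alpha>(1) finite_S by (simp add: ht_def sref_def cf_simps cf_S sum_subtractf if_distrib[where f="\<lambda>x. _ * x / _"] cong: if_cong)
    moreover have "2 * (\<gamma> \<bullet> \<alpha>) / (\<alpha> \<bullet> \<alpha>) > 0"
      using \<open>\<gamma> \<bullet> \<alpha> > 0\<close> S_nonzero[OF \<alpha>(1)] by (simp add: inner_gt_zero_iff)
    ultimately show False using \<gamma>(2)[of "sref \<alpha> \<gamma>"] by linarith
  qed
  then show ?thesis using as \<alpha> by blast
qed

lemma sref_Pos_word: "\<beta> \<in> Pos \<Longrightarrow> \<exists>as. set as \<subseteq> S \<and> sref \<beta> = word as"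
proof -
  assume "\<beta> \<in> Pos"
  then obtain as \<alpha> where as: "set as \<subseteq> S" "\<alpha> \<in> S" "word as \<beta> = \<alpha>" using root_conj_simple by blast
  have "sref \<beta> x = word (rev as @ [\<alpha>] @ as) x" for x
  proof -
    have "word as (sref \<beta> x) = sref \<alpha> (word as x)"
      using weyl_sref_conj[OF word_weyl[OF as(1)]] as(3) by metis
    then have "word (rev as) (word as (sref \<beta> x)) = word (rev as @ [\<alpha>] @ as) x"
      by (simp add: word_append)
    then show ?thesis using word_rev(1)[of as] by (metis comp_apply id_apply)
  qed
  then show ?thesis using as by (intro exI[of _ "rev as @ [\<alpha>] @ as"]) auto
qed

lemma weyl_word: "w \<in> W \<Longrightarrow> \<exists>as. set as \<subseteq> S \<and> w = word as"
proof (induction rule: weyl.induct)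
  case weyl_id
  show ?case by (rule exI[of _ "[]"]) simp
next
  case (weyl_step w \<alpha>)
  then obtain as where as: "set as \<subseteq> S" "w = word as" by blast
  have "\<alpha> \<in> Pos \<or> - \<alpha> \<in> Pos" using weyl_step Pos_uminus by blast
  then obtain bs where "set bs \<subseteq> S" "sref \<alpha> = word bs" using sref_Pos_word sref_uminus by metis
  with as show ?case by (intro exI[of _ "bs @ as"]) (auto simp: word_append)
qed

text \<open>The inversion set of the product is the \<open>sref \<alpha>\<close>-image of the old
  one together with the new inversion \<open>\<alpha>\<close>.\<close>

lemma len_simple:
  assumes "w \<in> W" "\<alpha> \<in> S" "w \<alpha> \<in> Pos"
  shows "len (w \<circ> sref \<alpha>) = Suc (len w)"
proof -
  define N where "N = {\<beta> \<in> Pos. w \<beta> \<notin> Pos}"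
  have "{\<beta> \<in> Pos. (w \<circ> sref \<alpha>) \<beta> \<notin> Pos} = insert \<alpha> (sref \<alpha> ` N)"
  proof (intro set_eqI iffI)
    fix \<beta> assume b: "\<beta> \<in> {\<beta> \<in> Pos. (w \<circ> sref \<alpha>) \<beta> \<notin> Pos}"
    show "\<beta> \<in> insert \<alpha> (sref \<alpha> ` N)"
    proof (cases "\<beta> = \<alpha>")
      case False
      with b assms have "sref \<alpha> \<beta> \<in> N" unfolding N_def by (auto intro: simple_sref_Pos)
      then show ?thesis by (metis image_eqI insertI2 sref_sref)
    qed simp
  next
    fix \<beta> assume b: "\<beta> \<in> insert \<alpha> (sref \<alpha> ` N)"
    then show "\<beta> \<in> {\<beta> \<in> Pos. (w \<circ> sref \<alpha>) \<beta> \<notin> Pos}"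
      using assms weyl_neg[of w \<alpha>] S_Pos S_R simple_sref_Pos unfolding N_def by auto
  qed
  moreover have "\<alpha> \<notin> sref \<alpha> ` N"
  proof
    assume "\<alpha> \<in> sref \<alpha> ` N"
    then obtain \<beta> where b: "\<beta> \<in> N" "\<alpha> = sref \<alpha> \<beta>" by blast
    then have "- \<alpha> = \<beta>" by (metis sref_self sref_sref)
    then show False using b(1) S_Pos[OF assms(2)] Pos_uminus S_R[OF assms(2)] unfolding N_def by auto
  qed
  moreover have "finite N" unfolding N_def using finite_Pos by auto
  moreover have "inj_on (sref \<alpha>) N" by (metis inj_on_inverseI sref_sref)
  ultimately show ?thesis by (simp add: wlen_def N_def card_image)
qed

lemma len_simple_neg:
  assumes "w \<in> W" "\<alpha> \<in> S" "w \<alpha> \<notin> Pos"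
  shows "len w = Suc (len (w \<circ> sref \<alpha>))"
  using len_simple[of "w \<circ> sref \<alpha>" \<alpha>] assms S_R
  by (simp add: comp_assoc weyl_comp weyl_sref weyl_neg)

lemma len_id [simp]: "len id = 0" by (simp add: wlen_def)

text \<open>Since \<open>wlen\<close> counts inversions, a shortest word has to be chosen
  separately. Its last letter is a descent; otherwise exchange would produce a shorter word.\<close>

lemma ex_descent:
  assumes "w \<in> W" "w \<noteq> id"
  shows "\<exists>\<alpha>\<in>S. w \<alpha> \<notin> Pos"
proof -
  define n where "n = (LEAST n. \<exists>as. set as \<subseteq> S \<and> w = word as \<and> length as = n)"
  have ex: "\<exists>n as. set as \<subseteq> S \<and> w = word as \<and> length as = n" using weyl_word assms by blast
  from LeastI_ex[OF this] obtain as where as: "set as \<subseteq> S" "w = word as" "length as = n"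
    unfolding n_def by blast
  have min: "n \<le> length bs" if "set bs \<subseteq> S" "w = word bs" for bs
    unfolding n_def by (rule Least_le) (use that in blast)
  from as assms obtain cs a where cs: "as = cs @ [a]" by (metis rev_exhaust word_simps(1))
  have w: "w = word cs \<circ> sref a" using as cs by (simp add: word_append)
  have "w a \<notin> Pos"
  proof
    assume "w a \<in> Pos"
    then have "word cs a \<notin> Pos"
      using w as cs weyl_neg[of "word cs" a] word_weyl[of cs] S_R by auto
    then obtain bs where "set bs \<subseteq> set cs" "length cs = Suc (length bs)" "word cs \<circ> sref a = word bs"
      using strong_exchange[of cs a] as cs S_Pos by auto
    then show False using min[of bs] w as cs by auto
  qed
  then show ?thesis using as cs by auto
qed

lemma reduced_word: "w \<in> W \<Longrightarrow> \<exists>as. set as \<subseteq> S \<and> w = word as \<and> length as = len w"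
proof (induction "len w" arbitrary: w rule: less_induct)
  case less
  show ?case
  proof (cases "w = id")
    case True
    then show ?thesis by (intro exI[of _ "[]"]) simp
  next
    case False
    then obtain \<alpha> where a: "\<alpha> \<in> S" "w \<alpha> \<notin> Pos" using ex_descent less by blast
    have l: "len w = Suc (len (w \<circ> sref \<alpha>))" using len_simple_neg less a by blast
    have "w \<circ> sref \<alpha> \<in> W" using less.prems a(1) by (intro weyl_comp weyl_sref S_R)
    with less.hyps[of "w \<circ> sref \<alpha>"] l obtain as where
      as: "set as \<subseteq> S" "w \<circ> sref \<alpha> = word as" "length as = len (w \<circ> sref \<alpha>)" by auto
    have "w = word as \<circ> sref \<alpha>" unfolding as(2)[symmetric] by (simp add: comp_assoc)
    then show ?thesis using as a l by (intro exI[of _ "as @ [\<alpha>]"]) (auto simp: word_append)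
  qed
qed

lemma len_word_le: "set as \<subseteq> S \<Longrightarrow> len (word as) \<le> length as"
proof (induction as rule: rev_induct)
  case (snoc a as)
  then have "len (word as \<circ> sref a) \<le> Suc (len (word as))"
    using len_simple[of "word as" a] len_simple_neg[of "word as" a] word_weyl[of as]
    by (cases "word as a \<in> Pos") auto
  with snoc show ?case by (simp add: word_append del: comp_apply)
qed simp

lemma len_reflection_neg:
  assumes "w \<in> W" "\<beta> \<in> Pos" "w \<beta> \<notin> Pos"
  shows "len (w \<circ> sref \<beta>) < len w"
proof -
  obtain as where as: "set as \<subseteq> S" "w = word as" "length as = len w" using reduced_word assms by blast
  then obtain bs where "set bs \<subseteq> set as" "length as = Suc (length bs)" "word as \<circ> sref \<beta> = word bs"
    using strong_exchange[of as \<beta>] assms by auto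
  moreover from this have "len (word bs) \<le> length bs" using as by (intro len_word_le) auto
  ultimately show ?thesis using as by simp
qed

lemma len_reflection_pos:
  assumes "w \<in> W" "\<beta> \<in> Pos" "w \<beta> \<in> Pos"
  shows "len w < len (w \<circ> sref \<beta>)"
  using len_reflection_neg[of "w \<circ> sref \<beta>" \<beta>] assms Pos_R
  by (simp add: comp_assoc weyl_comp weyl_sref weyl_neg)

subsection \<open>Bruhat order\<close>

text \<open>Replaces the comparison of lengths by the sign of one root, after choosing the
  reflecting root positive.\<close>

lemma bruhat_step_iff:
  "bruhat_step R S u v \<longleftrightarrow> u \<in> W \<and> (\<exists>\<beta>\<in>Pos. u \<beta> \<in> Pos \<and> v = u \<circ> sref \<beta>)"
proof
  assume st: "bruhat_step R S u v"
  then obtain \<beta> where b: "u \<in> W" "\<beta> \<in> R" "v = u \<circ> sref \<beta>" "len u < len v"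
    by (auto simp: bruhat_step_def)
  have "\<exists>\<gamma>\<in>Pos. v = u \<circ> sref \<gamma>"
    using b Pos_uminus[of \<beta>] sref_uminus[of \<beta>] by metis
  then obtain \<gamma> where g: "\<gamma> \<in> Pos" "v = u \<circ> sref \<gamma>" by blast
  with b len_reflection_neg[of u \<gamma>] have "u \<gamma> \<in> Pos" by force
  with b g show "u \<in> W \<and> (\<exists>\<beta>\<in>Pos. u \<beta> \<in> Pos \<and> v = u \<circ> sref \<beta>)" by blast
qed (auto simp: bruhat_step_def dest: Pos_R len_reflection_pos)

lemma ble_refl [simp]: "u \<preceq> u" by (simp add: bruhat_le_def)

lemma ble_trans: "u \<preceq> v \<Longrightarrow> v \<preceq> w \<Longrightarrow> u \<preceq> w" by (simp add: bruhat_le_def)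

lemma ble_len: "u \<preceq> w \<Longrightarrow> u = w \<or> len u < len w"
  unfolding bruhat_le_def
  by (induction rule: rtranclp_induct) (auto simp: bruhat_step_def)

lemma ble_antisym: "u \<preceq> w \<Longrightarrow> w \<preceq> u \<Longrightarrow> u = w"
  using ble_len[of u w] ble_len[of w u] by auto

lemma ble_W: "u \<preceq> w \<Longrightarrow> u \<in> W \<longleftrightarrow> w \<in> W"
  unfolding bruhat_le_def
proof (induction rule: rtranclp_induct)
  case (step y z)
  then show ?case using Pos_R by (metis bruhat_step_iff weyl_comp weyl_sref)
qed simp

lemma ble_reflection: "w \<in> W \<Longrightarrow> \<beta> \<in> Pos \<Longrightarrow> w \<beta> \<in> Pos \<Longrightarrow> w \<preceq> w \<circ> sref \<beta>"
  unfolding bruhat_le_def by (rule r_into_rtranclp) (auto simp: bruhat_step_iff)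

lemma ble_reflection_neg:
  assumes "w \<in> W" "\<beta> \<in> Pos" "w \<beta> \<notin> Pos" shows "w \<circ> sref \<beta> \<preceq> w"
  using ble_reflection[of "w \<circ> sref \<beta>" \<beta>] assms Pos_R
  by (simp add: comp_assoc weyl_comp weyl_sref weyl_neg)

text \<open>Conjugating \<open>sref \<beta>\<close> by \<open>sref \<alpha>\<close> gives the
  reflection in \<open>sref \<alpha> \<beta>\<close>, which is again positive unless
  \<open>\<beta> = \<alpha>\<close>; that case is the first alternative.\<close>

lemma bruhat_step_simple:
  assumes "bruhat_step R S u w" "\<alpha> \<in> S"
  shows "w = u \<circ> sref \<alpha> \<or> u \<circ> sref \<alpha> \<preceq> w \<circ> sref \<alpha>"
proof -
  obtain \<beta> where b: "u \<in> W" "\<beta> \<in> Pos" "u \<beta> \<in> Pos" "w = u \<circ> sref \<beta>"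
    using assms by (auto simp: bruhat_step_iff)
  show ?thesis
  proof (cases "\<beta> = \<alpha>")
    case False
    have eq: "w \<circ> sref \<alpha> = u \<circ> sref \<alpha> \<circ> sref (sref \<alpha> \<beta>)"
    proof
      fix x
      have "sref \<alpha> (sref \<beta> (sref \<alpha> y)) = sref (sref \<alpha> \<beta>) y" for y
        using weyl_sref_conj[OF weyl_sref[OF S_R[OF assms(2)]], of \<beta> "sref \<alpha> y"] by simp
      from this[of x] have "sref \<beta> (sref \<alpha> x) = sref \<alpha> (sref (sref \<alpha> \<beta>) x)" by (metis sref_sref)
      then show "(w \<circ> sref \<alpha>) x = (u \<circ> sref \<alpha> \<circ> sref (sref \<alpha> \<beta>)) x" using b by simp
    qed
    have "u \<circ> sref \<alpha> \<preceq> u \<circ> sref \<alpha> \<circ> sref (sref \<alpha> \<beta>)"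
      using b assms(2) False by (intro ble_reflection) (auto simp: weyl_comp weyl_sref S_R simple_sref_Pos)
    then show ?thesis using eq by simp
  qed (use b in simp)
qed

text \<open>A dichotomy free of descent hypotheses propagates along a chain of Bruhat steps; the
  usual lifting properties \<open>ble_simple_down\<close> and \<open>ble_simple_up\<close> follow
  once a sign is known.\<close>

lemma lifting_right:
  assumes "u \<preceq> w" "\<alpha> \<in> S"
  shows "u \<circ> sref \<alpha> \<preceq> w \<or> u \<circ> sref \<alpha> \<preceq> w \<circ> sref \<alpha>"
  using assms(1) unfolding bruhat_le_def
proof (induction rule: rtranclp_induct)
  case (step y z)
  then show ?case using bruhat_step_simple[OF step(2) assms(2)]
    by (metis bruhat_le_def r_into_rtranclp rtranclp_trans)
qed simp

lemma lifting_right':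
  assumes "u \<preceq> w" "\<alpha> \<in> S"
  shows "u \<preceq> w \<circ> sref \<alpha> \<or> u \<circ> sref \<alpha> \<preceq> w \<circ> sref \<alpha>"
  using assms(1) unfolding bruhat_le_def
proof (induction rule: rtranclp_induct)
  case (step y z)
  have "z \<circ> sref \<alpha> = y" if "z = y \<circ> sref \<alpha>" using that by (simp add: comp_assoc)
  then show ?case using step bruhat_step_simple[OF step(2) assms(2)]
    by (metis bruhat_le_def rtranclp_trans)
qed simp

lemma ble_simple_down:
  assumes "u \<preceq> w" "\<alpha> \<in> S" "w \<in> W" "w \<alpha> \<notin> Pos" shows "u \<circ> sref \<alpha> \<preceq> w"
  using lifting_right[OF assms(1,2)] ble_reflection_neg[OF assms(3) S_Pos[OF assms(2)] assms(4)] ble_trans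
  by blast

lemma ble_simple_up:
  assumes "u \<preceq> w" "\<alpha> \<in> S" "w \<in> W" "u \<alpha> \<in> Pos" shows "u \<preceq> w \<circ> sref \<alpha>"
proof -
  have "u \<in> W" using assms ble_W by blast
  then show ?thesis
    using lifting_right'[OF assms(1,2)] ble_reflection[of u, OF _ S_Pos[OF assms(2)] assms(4)] ble_trans by blast
qed

lemma inv_comp_sref: "w \<in> W \<Longrightarrow> inv (w \<circ> sref \<beta>) = sref \<beta> \<circ> inv w"
  by (rule inv_unique_comp) (auto simp: fun_eq_iff)

lemma sref_comp_inv: "w \<in> W \<Longrightarrow> sref \<beta> \<circ> inv w = inv w \<circ> sref (w \<beta>)"
  using weyl_sref_conj[OF weyl_inv, of w R "w \<beta>"] by (auto simp: fun_eq_iff)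

lemma inv_inv: "w \<in> W \<Longrightarrow> inv (inv w) = w"
  using weyl_bij inv_inv_eq by blast

text \<open>A step by the reflection in \<open>\<beta>\<close> on the right of \<open>y\<close>
  becomes a step by the reflection in \<open>y \<beta>\<close> on the right of \<open>inv y\<close>.
  This transports right-handed facts to the left.\<close>

lemma ble_inv: "u \<preceq> w \<Longrightarrow> inv u \<preceq> inv w"
  unfolding bruhat_le_def
proof (induction rule: rtranclp_induct)
  case (step y z)
  obtain \<beta> where b: "y \<in> W" "\<beta> \<in> Pos" "y \<beta> \<in> Pos" "z = y \<circ> sref \<beta>"
    using step by (auto simp: bruhat_step_iff)
  then have "inv z = inv y \<circ> sref (y \<beta>)" by (simp add: inv_comp_sref sref_comp_inv)
  with b have "bruhat_step R S (inv y) (inv z)"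
    by (auto simp: bruhat_step_iff weyl_inv intro!: bexI[of _ "y \<beta>"])
  with step show ?case by simp
qed simp

lemma inv_sref_comp: "w \<in> W \<Longrightarrow> inv (sref \<beta> \<circ> w) = inv w \<circ> sref \<beta>"
  by (rule inv_unique_comp) (auto simp: fun_eq_iff)

lemma lifting_left:
  assumes "u \<preceq> w" "\<alpha> \<in> S" "w \<in> W"
  shows "sref \<alpha> \<circ> u \<preceq> w \<or> sref \<alpha> \<circ> u \<preceq> sref \<alpha> \<circ> w"
proof -
  have W: "u \<in> W" "sref \<alpha> \<circ> u \<in> W" "sref \<alpha> \<circ> w \<in> W"
    using assms ble_W by (auto simp: weyl_step S_R)
  have "inv u \<circ> sref \<alpha> \<preceq> inv w \<or> inv u \<circ> sref \<alpha> \<preceq> inv w \<circ> sref \<alpha>"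
    using lifting_right[OF ble_inv[OF assms(1)] assms(2)] .
  then have "inv (sref \<alpha> \<circ> u) \<preceq> inv w \<or> inv (sref \<alpha> \<circ> u) \<preceq> inv (sref \<alpha> \<circ> w)"
    using W assms by (simp add: inv_sref_comp)
  then show ?thesis using ble_inv inv_inv W assms by metis
qed

lemma lifting_left':
  assumes "u \<preceq> w" "\<alpha> \<in> S" "w \<in> W"
  shows "u \<preceq> sref \<alpha> \<circ> w \<or> sref \<alpha> \<circ> u \<preceq> sref \<alpha> \<circ> w"
proof -
  have W: "u \<in> W" "sref \<alpha> \<circ> u \<in> W" "sref \<alpha> \<circ> w \<in> W"
    using assms ble_W by (auto simp: weyl_step S_R)
  have "inv u \<preceq> inv w \<circ> sref \<alpha> \<or> inv u \<circ> sref \<alpha> \<preceq> inv w \<circ> sref \<alpha>"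
    using lifting_right'[OF ble_inv[OF assms(1)] assms(2)] .
  then have "inv u \<preceq> inv (sref \<alpha> \<circ> w) \<or> inv (sref \<alpha> \<circ> u) \<preceq> inv (sref \<alpha> \<circ> w)"
    using W assms by (simp add: inv_sref_comp)
  then show ?thesis using ble_inv inv_inv W assms by metis
qed

subsection \<open>Standard parabolic subgroups and their cosets\<close>

text \<open>Phrased through descents instead of generators, so that stabilizers of dominant weights
  satisfy it directly.\<close>

definition std_parabolic :: "('a \<Rightarrow> 'a) set \<Rightarrow> bool" where
  "std_parabolic H \<longleftrightarrow> H \<subseteq> W \<and> id \<in> H \<and> (\<forall>u\<in>H. \<forall>v\<in>H. u \<circ> v \<in> H) \<and> (\<forall>u\<in>H. inv u \<in> H) \<and>
     (\<forall>u\<in>H. \<forall>\<alpha>\<in>S. u \<alpha> \<notin> Pos \<longrightarrow> sref \<alpha> \<in> H)"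

lemma par_W: "std_parabolic H \<Longrightarrow> u \<in> H \<Longrightarrow> u \<in> W" and
  par_id: "std_parabolic H \<Longrightarrow> id \<in> H" and
  par_comp: "std_parabolic H \<Longrightarrow> u \<in> H \<Longrightarrow> v \<in> H \<Longrightarrow> u \<circ> v \<in> H" and
  par_inv: "std_parabolic H \<Longrightarrow> u \<in> H \<Longrightarrow> inv u \<in> H" and
  par_descent: "std_parabolic H \<Longrightarrow> u \<in> H \<Longrightarrow> \<alpha> \<in> S \<Longrightarrow> u \<alpha> \<notin> Pos \<Longrightarrow> sref \<alpha> \<in> H"
  unfolding std_parabolic_def by auto

lemma simple_of_S: "\<alpha> \<in> simple_of S H \<Longrightarrow> \<alpha> \<in> S" by (simp add: simple_of_def)

text \<open>Stripping descents never leaves \<open>H\<close>, because every simple descent of an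
  element of \<open>H\<close> has its reflection in \<open>H\<close>.\<close>

lemma par_induct [consumes 2, case_names id step]:
  assumes H: "std_parabolic H" and u: "u \<in> H" and "P id"
    and step: "\<And>u \<alpha>. u \<in> H \<Longrightarrow> \<alpha> \<in> S \<Longrightarrow> sref \<alpha> \<in> H \<Longrightarrow> u \<alpha> \<in> Pos \<Longrightarrow> P u \<Longrightarrow> P (u \<circ> sref \<alpha>)"
  shows "P u"
  using u
proof (induction "len u" arbitrary: u rule: less_induct)
  case less
  show ?case
  proof (cases "u = id")
    case False
    have W: "u \<in> W" using par_W H less by blast
    then obtain \<alpha> where a: "\<alpha> \<in> S" "u \<alpha> \<notin> Pos" using ex_descent False by blast
    then have s: "sref \<alpha> \<in> H" "u \<circ> sref \<alpha> \<in> H" using par_descent par_comp H less by blast+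
    moreover have "len (u \<circ> sref \<alpha>) < len u" using len_simple_neg[OF W a] by simp
    ultimately have "P (u \<circ> sref \<alpha>)" using less by blast
    moreover have "(u \<circ> sref \<alpha>) \<alpha> \<in> Pos" using W a S_R by (simp add: weyl_neg)
    ultimately have "P (u \<circ> sref \<alpha> \<circ> sref \<alpha>)" using step s a by blast
    then show ?thesis by (simp add: comp_assoc)
  qed (use assms in simp)
qed

lemma simple_of_mono: "H \<subseteq> K \<Longrightarrow> simple_of S H \<subseteq> simple_of S K" by (auto simp: simple_of_def)

section \<open>Minimal and maximal coset representatives, recognized by simple roots\<close>

definition is_min :: "('a \<Rightarrow> 'a) set \<Rightarrow> ('a \<Rightarrow> 'a) \<Rightarrow> bool" where
  "is_min H v \<longleftrightarrow> v \<in> W \<and> (\<forall>\<alpha>\<in>simple_of S H. v \<alpha> \<in> Pos)"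

definition is_max :: "('a \<Rightarrow> 'a) set \<Rightarrow> ('a \<Rightarrow> 'a) \<Rightarrow> bool" where
  "is_max H v \<longleftrightarrow> v \<in> W \<and> (\<forall>\<alpha>\<in>simple_of S H. v \<alpha> \<notin> Pos)"

lemma is_min_mono: "H \<subseteq> K \<Longrightarrow> is_min K v \<Longrightarrow> is_min H v"
  using simple_of_mono[of H K] by (auto simp: is_min_def)

lemma is_min_id: "is_min H id" by (simp add: is_min_def weyl_id S_Pos simple_of_S)

text \<open>Once \<open>v\<close> lies below one member of an \<open>H\<close>-coset it lies below
  all: the reflections used to move within the coset are ascents of \<open>v\<close>, so the lifting
  property keeps \<open>v\<close> below.\<close>

lemma is_min_ble:
  assumes "std_parabolic H" "u \<in> H" "is_min H v" "v \<preceq> y" "y \<in> W"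
  shows "v \<preceq> y \<circ> u"
  using assms(1,2)
proof (induction rule: par_induct)
  case (step u \<alpha>)
  have "v \<preceq> y \<circ> u \<circ> sref \<alpha>"
  proof (rule ble_simple_up)
    show "v \<alpha> \<in> Pos" using step assms by (auto simp: is_min_def simple_of_def)
    show "y \<circ> u \<in> W" using assms step par_W weyl_comp by blast
  qed (use step in \<open>auto simp del: comp_apply\<close>)
  then show ?case by (simp only: comp_assoc)
qed (use assms in simp)

lemma is_max_ble:
  assumes "std_parabolic H" "u \<in> H" "is_max H z" "y \<preceq> z"
  shows "y \<circ> u \<preceq> z"
  using assms(1,2)
proof (induction rule: par_induct)
  case (step u \<alpha>)
  have "y \<circ> u \<circ> sref \<alpha> \<preceq> z"
    using step assms by (intro ble_simple_down) (auto simp: is_max_def simple_of_def simp del: comp_apply)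
  then show ?case by (simp only: comp_assoc)
qed (use assms in simp)

lemma ex_is_min:
  assumes "std_parabolic H" "w \<in> W"
  shows "\<exists>u\<in>H. is_min H (w \<circ> u)"
proof -
  obtain u where u: "u \<in> H" "\<And>v. v \<in> H \<Longrightarrow> len (w \<circ> u) \<le> len (w \<circ> v)"
    using ex_has_least_nat[of "\<lambda>u. u \<in> H" id "\<lambda>u. len (w \<circ> u)"] par_id[OF assms(1)] by auto
  have W: "w \<circ> u \<in> W" using assms(2) par_W[OF assms(1) u(1)] by (rule weyl_comp)
  have "(w \<circ> u) \<alpha> \<in> Pos" if a: "\<alpha> \<in> S" "sref \<alpha> \<in> H" for \<alpha>
  proof (rule ccontr)
    assume "(w \<circ> u) \<alpha> \<notin> Pos"
    then show False using len_simple_neg[OF W a(1)] u(2)[OF par_comp[OF assms(1) u(1) a(2)]]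
      by (simp add: comp_assoc)
  qed
  with W u show ?thesis by (auto simp: is_min_def simple_of_def)
qed

lemma ex_is_max:
  assumes "std_parabolic H" "w \<in> W"
  shows "\<exists>u\<in>H. is_max H (w \<circ> u)"
proof -
  have "H \<subseteq> W" using par_W[OF assms(1)] by blast
  then have "finite H" using finite_weyl by (rule finite_subset)
  moreover have "H \<noteq> {}" using par_id[OF assms(1)] by blast
  ultimately have "Max ((\<lambda>u. len (w \<circ> u)) ` H) \<in> (\<lambda>u. len (w \<circ> u)) ` H"
    and "\<And>v. v \<in> H \<Longrightarrow> len (w \<circ> v) \<le> Max ((\<lambda>u. len (w \<circ> u)) ` H)" by auto
  then obtain u where u: "u \<in> H" "\<And>v. v \<in> H \<Longrightarrow> len (w \<circ> v) \<le> len (w \<circ> u)" by auto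
  have W: "w \<circ> u \<in> W" using assms(2) par_W[OF assms(1) u(1)] by (rule weyl_comp)
  have "(w \<circ> u) \<alpha> \<notin> Pos" if a: "\<alpha> \<in> S" "sref \<alpha> \<in> H" for \<alpha>
  proof
    assume "(w \<circ> u) \<alpha> \<in> Pos"
    then show False using len_simple[OF W a(1)] u(2)[OF par_comp[OF assms(1) u(1) a(2)]]
      by (simp add: comp_assoc)
  qed
  with W u show ?thesis by (auto simp: is_max_def simple_of_def)
qed

text \<open>The choices below are unique, see \<open>is_min_mn\<close> and \<open>is_max_mx\<close>.\<close>

definition mn :: "('a \<Rightarrow> 'a) set \<Rightarrow> ('a \<Rightarrow> 'a) \<Rightarrow> 'a \<Rightarrow> 'a" where
  "mn H w = w \<circ> (SOME u. u \<in> H \<and> is_min H (w \<circ> u))"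

definition mx :: "('a \<Rightarrow> 'a) set \<Rightarrow> ('a \<Rightarrow> 'a) \<Rightarrow> 'a \<Rightarrow> 'a" where
  "mx H w = w \<circ> (SOME u. u \<in> H \<and> is_max H (w \<circ> u))"

lemma mn_cases:
  assumes "std_parabolic H" "w \<in> W"
  obtains u where "u \<in> H" "mn H w = w \<circ> u" "is_min H (mn H w)"
  using someI_ex[of "\<lambda>u. u \<in> H \<and> is_min H (w \<circ> u)"] ex_is_min[OF assms] unfolding mn_def by blast

lemma mx_cases:
  assumes "std_parabolic H" "w \<in> W"
  obtains u where "u \<in> H" "mx H w = w \<circ> u" "is_max H (mx H w)"
  using someI_ex[of "\<lambda>u. u \<in> H \<and> is_max H (w \<circ> u)"] ex_is_max[OF assms] unfolding mx_def by blast

text \<open>Equality of left cosets, see \<open>coset_eq_iff\<close>, with membership in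
  \<open>W\<close> built in so that it need not be carried separately.\<close>

definition ceq :: "('a \<Rightarrow> 'a) set \<Rightarrow> ('a \<Rightarrow> 'a) \<Rightarrow> ('a \<Rightarrow> 'a) \<Rightarrow> bool" where
  "ceq H u w \<longleftrightarrow> u \<in> W \<and> w \<in> W \<and> inv u \<circ> w \<in> H"

lemma ceq_iff: "std_parabolic H \<Longrightarrow> u \<in> W \<Longrightarrow> ceq H u w \<longleftrightarrow> (\<exists>h\<in>H. w = u \<circ> h)"
proof
  assume "std_parabolic H" "u \<in> W" "ceq H u w"
  then show "\<exists>h\<in>H. w = u \<circ> h" by (intro bexI[of _ "inv u \<circ> w"]) (auto simp: ceq_def fun_eq_iff)
next
  assume H: "std_parabolic H" "u \<in> W" and "\<exists>h\<in>H. w = u \<circ> h"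
  then obtain h where h: "h \<in> H" "w = u \<circ> h" by blast
  then have "inv u \<circ> w = h" using H by (auto simp: fun_eq_iff)
  then show "ceq H u w" using H h par_W[of H h] by (simp add: ceq_def weyl_comp)
qed

lemma ceq_W: "ceq H u w \<Longrightarrow> u \<in> W" "ceq H u w \<Longrightarrow> w \<in> W" by (auto simp: ceq_def)

lemma ceq_refl: "std_parabolic H \<Longrightarrow> u \<in> W \<Longrightarrow> ceq H u u"
  using ceq_iff par_id by fastforce

lemma ceq_sym: "std_parabolic H \<Longrightarrow> ceq H u w \<Longrightarrow> ceq H w u"
proof -
  assume H: "std_parabolic H" "ceq H u w"
  then obtain h where h: "h \<in> H" "w = u \<circ> h" using ceq_iff ceq_W by metis
  then have "u = w \<circ> inv h" using par_W[OF H(1) h(1)] by (auto simp: fun_eq_iff)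
  then show ?thesis using H h ceq_iff[of H w u] ceq_W par_inv by blast
qed

lemma ceq_trans: "std_parabolic H \<Longrightarrow> ceq H u v \<Longrightarrow> ceq H v w \<Longrightarrow> ceq H u w"
proof -
  assume H: "std_parabolic H" "ceq H u v" "ceq H v w"
  then obtain h k where h: "h \<in> H" "v = u \<circ> h" and k: "k \<in> H" "w = v \<circ> k" using ceq_iff ceq_W by metis
  then have "w = u \<circ> (h \<circ> k)" by (simp add: comp_assoc)
  then show ?thesis using H h k ceq_iff ceq_W par_comp by blast
qed

lemma ceq_mono: "H \<subseteq> K \<Longrightarrow> ceq H u w \<Longrightarrow> ceq K u w" by (auto simp: ceq_def)

lemma ceq_par: "std_parabolic H \<Longrightarrow> ceq H u w \<Longrightarrow> u \<in> H \<longleftrightarrow> w \<in> H"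
  by (metis ceq_W(1) ceq_iff ceq_sym ceq_W(2) par_comp)

lemma coset_eq_iff: "std_parabolic H \<Longrightarrow> u \<in> W \<Longrightarrow> w \<in> W \<Longrightarrow> coset u H = coset w H \<longleftrightarrow> ceq H u w"
proof
  assume H: "std_parabolic H" "u \<in> W" "w \<in> W" and "coset u H = coset w H"
  moreover have "w \<in> coset w H" using par_id[OF H(1)] unfolding coset_def by (rule rev_image_eqI) simp
  ultimately show "ceq H u w" using ceq_iff[of H u w] by (auto simp: coset_def)
next
  have sub: "coset w H \<subseteq> coset u H" if "std_parabolic H" "ceq H u w" for u w
    using that ceq_iff[of H u w] ceq_W[of H u w] par_comp[of H]
    by (auto simp: coset_def comp_assoc intro!: imageI)
  assume H: "std_parabolic H" "u \<in> W" "w \<in> W" "ceq H u w"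
  then show "coset u H = coset w H" using sub ceq_sym by blast
qed

lemma coset_mem_iff: "std_parabolic H \<Longrightarrow> u \<in> W \<Longrightarrow> w \<in> coset u H \<longleftrightarrow> ceq H u w"
  using ceq_iff[of H u w] by (auto simp: coset_def)

context
  fixes H assumes H: "std_parabolic H"
begin

lemma ceq_mn: "w \<in> W \<Longrightarrow> ceq H w (mn H w)"
  using mn_cases[OF H] ceq_iff[OF H] by metis

lemma ceq_mx: "w \<in> W \<Longrightarrow> ceq H w (mx H w)"
  using mx_cases[OF H] ceq_iff[OF H] by metis

lemma mn_W: "w \<in> W \<Longrightarrow> mn H w \<in> W" using ceq_mn ceq_W by blast
lemma mx_W: "w \<in> W \<Longrightarrow> mx H w \<in> W" using ceq_mx ceq_W by blast
lemma mn_is_min: "w \<in> W \<Longrightarrow> is_min H (mn H w)" using mn_cases[OF H] by metis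
lemma mx_is_max: "w \<in> W \<Longrightarrow> is_max H (mx H w)" using mx_cases[OF H] by metis

lemma is_min_ceq_ble: "is_min H v \<Longrightarrow> v \<preceq> y \<Longrightarrow> ceq H y z \<Longrightarrow> v \<preceq> z"
  using is_min_ble[OF H] ceq_iff[OF H] ceq_W by metis

lemma is_max_ceq_ble: "is_max H v \<Longrightarrow> y \<preceq> v \<Longrightarrow> ceq H y z \<Longrightarrow> z \<preceq> v"
  using is_max_ble[OF H] ceq_iff[OF H] ceq_W by metis

lemma mn_ble: "ceq H w z \<Longrightarrow> mn H w \<preceq> z"
  using is_min_ceq_ble[of "mn H w" "mn H w"] mn_is_min ceq_mn ceq_sym[OF H] ceq_trans[OF H] ceq_W ble_refl
  by metis

lemma ble_mx: "ceq H w z \<Longrightarrow> z \<preceq> mx H w"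
  using is_max_ceq_ble[of "mx H w" "mx H w"] mx_is_max ceq_mx ceq_sym[OF H] ceq_trans[OF H] ceq_W ble_refl
  by metis

lemma is_min_mn: "is_min H v \<Longrightarrow> mn H v = v"
  using is_min_ceq_ble[of v v "mn H v"] mn_ble[of v v] ceq_mn ceq_refl[OF H] ble_antisym ble_refl
  by (metis is_min_def)

lemma is_max_mx: "is_max H v \<Longrightarrow> mx H v = v"
  using is_max_ceq_ble[of v v "mx H v"] ble_mx[of v v] ceq_mx ceq_refl[OF H] ble_antisym ble_refl
  by (metis is_max_def)

lemma mn_cong: "ceq H u w \<Longrightarrow> mn H u = mn H w"
  by (metis H ble_antisym ceq_W(1,2) ceq_mn ceq_sym ceq_trans mn_ble)

lemma mx_cong: "ceq H u w \<Longrightarrow> mx H u = mx H w"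
  by (metis H ble_antisym ceq_W(1,2) ceq_mx ceq_sym ceq_trans ble_mx)

lemma mn_eq_iff: "u \<in> W \<Longrightarrow> w \<in> W \<Longrightarrow> mn H u = mn H w \<longleftrightarrow> ceq H u w"
  by (metis H ceq_mn ceq_sym ceq_trans mn_cong)

lemma mn_mono: "u \<preceq> w \<Longrightarrow> w \<in> W \<Longrightarrow> mn H u \<preceq> mn H w"
  by (metis H ble_W ble_trans ceq_mn ceq_refl is_min_ceq_ble mn_ble mn_is_min)

lemma mx_mono: "u \<preceq> w \<Longrightarrow> w \<in> W \<Longrightarrow> mx H u \<preceq> mx H w"
  by (metis H ble_W ble_trans ceq_mx ceq_refl is_max_ceq_ble ble_mx mx_is_max)

lemma mn_le: "w \<in> W \<Longrightarrow> mn H w \<preceq> w" using mn_ble ceq_refl[OF H] by blast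
lemma le_mx: "w \<in> W \<Longrightarrow> w \<preceq> mx H w" using ble_mx ceq_refl[OF H] by blast

lemma mn_mx: "w \<in> W \<Longrightarrow> mn H (mx H w) = mn H w" using ceq_mx mn_cong by metis

lemma is_min_reflection_Pos:
  assumes "is_min H v" "\<beta> \<in> Pos" "sref \<beta> \<in> H"
  shows "v \<beta> \<in> Pos"
proof (rule ccontr)
  assume n: "v \<beta> \<notin> Pos"
  have v: "v \<in> W" using assms by (simp add: is_min_def)
  have "v \<preceq> v \<circ> sref \<beta>" using is_min_ble[OF H assms(3,1) ble_refl v] .
  then show False using len_reflection_neg[OF v assms(2) n] ble_len by fastforce
qed

text \<open>A minimal \<open>v\<close> keeps positive the positive roots whose reflections lie in
  \<open>H\<close>, so each ascent used to build \<open>u\<close> inside \<open>H\<close> remains an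
  ascent after multiplying by \<open>v\<close>.\<close>

lemma len_min_comp:
  assumes "is_min H v" "u \<in> H"
  shows "len (v \<circ> u) = len v + len u"
  using H assms(2)
proof (induction rule: par_induct)
  case (step u \<alpha>)
  have W: "u \<in> W" "v \<in> W" using step par_W[OF H] assms by (auto simp: is_min_def)
  have "sref (u \<alpha>) = u \<circ> sref \<alpha> \<circ> inv u"
    using W weyl_sref_conj[of u R \<alpha>] by (auto simp: fun_eq_iff)
  then have "sref (u \<alpha>) \<in> H" using step par_comp[OF H] par_inv[OF H] by simp
  then have "(v \<circ> u) \<alpha> \<in> Pos" using is_min_reflection_Pos[OF assms(1)] step by simp
  then show ?case
    using len_simple[of "v \<circ> u" \<alpha>] len_simple[of u \<alpha>] step W
    by (simp add: comp_assoc weyl_comp del: comp_apply)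
qed (simp only: comp_id len_id add_0_right)

text \<open>Inversions of \<open>u \<circ> sref \<alpha>\<close> other than \<open>\<alpha>\<close>
  are \<open>sref \<alpha>\<close>-images of inversions of \<open>u\<close>, so the claim passes
  along by conjugation.\<close>

lemma par_reflection:
  assumes "w \<in> H" "\<beta> \<in> Pos" "w \<beta> \<notin> Pos"
  shows "sref \<beta> \<in> H"
  using H assms
proof (induction arbitrary: \<beta> rule: par_induct)
  case (step u \<alpha>)
  show ?case
  proof (cases "\<beta> = \<alpha>")
    case False
    then have p: "sref \<alpha> \<beta> \<in> Pos" using simple_sref_Pos step by blast
    then have "sref (sref \<alpha> \<beta>) \<in> H" using step by simp
    moreover have "sref \<beta> = sref \<alpha> \<circ> sref (sref \<alpha> \<beta>) \<circ> sref \<alpha>"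
      using weyl_sref_conj[OF weyl_sref[OF S_R[OF step(2)]], of "sref \<alpha> \<beta>"] by (simp add: fun_eq_iff)
    ultimately show ?thesis using step par_comp[OF H] by metis
  qed (use step in simp)
qed simp

text \<open>A Bruhat step down from an element of \<open>H\<close> uses one of its inversions, whose
  reflection lies in \<open>H\<close>.\<close>

lemma par_ble: "u \<preceq> w \<Longrightarrow> w \<in> H \<Longrightarrow> u \<in> H"
  unfolding bruhat_le_def
proof (induction rule: converse_rtranclp_induct)
  case (step y z)
  then obtain \<beta> where b: "y \<in> W" "\<beta> \<in> Pos" "y \<beta> \<in> Pos" "z = y \<circ> sref \<beta>"
    by (auto simp: bruhat_step_iff)
  then have "z \<beta> \<notin> Pos" by (simp add: weyl_neg Pos_R)
  then have "sref \<beta> \<in> H" using par_reflection b step by blast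
  moreover have "y = z \<circ> sref \<beta>" using b by (simp add: comp_assoc)
  ultimately show ?case using step par_comp[OF H] by metis
qed

lemma minreps_iff: "w \<in> minreps R S H \<longleftrightarrow> is_min H w"
proof
  assume m: "w \<in> minreps R S H"
  then have W: "w \<in> W" by (simp add: minreps_def)
  obtain u where u: "u \<in> H" "mn H w = w \<circ> u" using mn_cases[OF H W] by metis
  have "mn H w = w"
    using ble_len[OF mn_le[OF W]] m u by (force simp: minreps_def)
  then show "is_min H w" using mn_is_min[OF W] by simp
next
  assume "is_min H w"
  then show "w \<in> minreps R S H"
    using len_min_comp by (auto simp: minreps_def is_min_def)
qed

lemma cle_iff:
  assumes "u \<in> W" "w \<in> W"
  shows "cle R S H (coset u H) (coset w H) \<longleftrightarrow> mn H u \<preceq> mn H w"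
proof
  assume "cle R S H (coset u H) (coset w H)"
  then show "mn H u \<preceq> mn H w"
    using assms coset_mem_iff[OF H] mn_cong is_min_mn unfolding cle_def minreps_iff by metis
next
  assume "mn H u \<preceq> mn H w"
  then show "cle R S H (coset u H) (coset w H)"
    unfolding cle_def minreps_iff using assms mn_is_min ceq_mn coset_mem_iff[OF H] by blast
qed

lemma cosets_cases:
  assumes "C \<in> cosets R H" obtains w where "w \<in> W" "C = coset w H"
  using assms by (auto simp: cosets_def)

lemma coset_in_cosets: "w \<in> W \<Longrightarrow> coset w H \<in> cosets R H" by (simp add: cosets_def)

end

section \<open>Extremal preimages under projections of coset spaces\<close>

lemma proj_coset:
  assumes "std_parabolic H" "std_parabolic K" "H \<subseteq> K"
  shows "proj K (coset w H) = coset w K"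
proof -
  have "proj K (coset w H) = {w \<circ> h \<circ> k |h k. h \<in> H \<and> k \<in> K}"
    unfolding proj_def coset_def by blast
  also have "\<dots> = coset w K"
  proof (intro set_eqI iffI)
    fix x assume "x \<in> coset w K"
    then obtain k where "k \<in> K" "x = w \<circ> id \<circ> k" by (auto simp: coset_def)
    then show "x \<in> {w \<circ> h \<circ> k |h k. h \<in> H \<and> k \<in> K}" using par_id[OF assms(1)] by blast
  qed (use assms par_comp in \<open>auto simp: coset_def comp_assoc\<close>)
  finally show ?thesis .
qed

context
  fixes H K assumes H: "std_parabolic H" and K: "std_parabolic K" and HK: "H \<subseteq> K"
begin

lemma minpre_coset:
  assumes w: "w \<in> W"
  shows "minpre R S H K (coset w K) = coset (mn K w) H"
  unfolding minpre_def
proof (rule the_equality, intro conjI ballI impI)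
  show "coset (mn K w) H \<in> cosets R H" using coset_in_cosets[OF H] mn_W[OF K w] by blast
  show "proj K (coset (mn K w) H) = coset w K"
    using proj_coset[OF H K HK] coset_eq_iff[OF K mn_W[OF K w] w] ceq_mn[OF K w] ceq_sym[OF K] by simp
next
  fix C' assume "C' \<in> cosets R H" "proj K C' = coset w K"
  then obtain z where z: "z \<in> W" "C' = coset z H" "ceq K w z"
    using cosets_cases[OF H] proj_coset[OF H K HK] coset_eq_iff[OF K] w ceq_sym[OF K] by metis
  have "mn K w \<preceq> z" using mn_ble[OF K z(3)] .
  then show "cle R S H (coset (mn K w) H) C'"
    using z w mn_W[OF K] by (simp add: cle_iff[OF H] mn_mono[OF H])
next
  fix C assume C: "C \<in> cosets R H \<and> proj K C = coset w K \<and>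
    (\<forall>C'\<in>cosets R H. proj K C' = coset w K \<longrightarrow> cle R S H C C')"
  then obtain z where z: "z \<in> W" "C = coset z H" "ceq K w z"
    using cosets_cases[OF H] proj_coset[OF H K HK] coset_eq_iff[OF K] w ceq_sym[OF K] by metis
  have m: "mn K w \<in> W" using mn_W[OF K w] .
  have "proj K (coset (mn K w) H) = coset w K"
    using proj_coset[OF H K HK] coset_eq_iff[OF K m w] ceq_mn[OF K w] ceq_sym[OF K] by simp
  then have "cle R S H (coset z H) (coset (mn K w) H)" using C z coset_in_cosets[OF H m] by blast
  then have "mn H z \<preceq> mn H (mn K w)" using cle_iff[OF H z(1) m] by simp
  moreover have "mn H (mn K w) \<preceq> mn H z" using mn_ble[OF K z(3)] z mn_mono[OF H] by blast
  ultimately show "C = coset (mn K w) H"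
    using ble_antisym mn_eq_iff[OF H z(1) m] coset_eq_iff[OF H z(1) m] z by metis
qed

lemma maxpre_coset:
  assumes w: "w \<in> W"
  shows "maxpre R S H K (coset w K) = coset (mx K w) H"
  unfolding maxpre_def
proof (rule the_equality, intro conjI ballI impI)
  show "coset (mx K w) H \<in> cosets R H" using coset_in_cosets[OF H] mx_W[OF K w] by blast
  show "proj K (coset (mx K w) H) = coset w K"
    using proj_coset[OF H K HK] coset_eq_iff[OF K mx_W[OF K w] w] ceq_mx[OF K w] ceq_sym[OF K] by simp
next
  fix C' assume "C' \<in> cosets R H" "proj K C' = coset w K"
  then obtain z where z: "z \<in> W" "C' = coset z H" "ceq K w z"
    using cosets_cases[OF H] proj_coset[OF H K HK] coset_eq_iff[OF K] w ceq_sym[OF K] by metis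
  have "z \<preceq> mx K w" using ble_mx[OF K z(3)] .
  then show "cle R S H C' (coset (mx K w) H)"
    using z w mx_W[OF K] by (simp add: cle_iff[OF H] mn_mono[OF H])
next
  fix C assume C: "C \<in> cosets R H \<and> proj K C = coset w K \<and>
    (\<forall>C'\<in>cosets R H. proj K C' = coset w K \<longrightarrow> cle R S H C' C)"
  then obtain z where z: "z \<in> W" "C = coset z H" "ceq K w z"
    using cosets_cases[OF H] proj_coset[OF H K HK] coset_eq_iff[OF K] w ceq_sym[OF K] by metis
  have m: "mx K w \<in> W" using mx_W[OF K w] .
  have "proj K (coset (mx K w) H) = coset w K"
    using proj_coset[OF H K HK] coset_eq_iff[OF K m w] ceq_mx[OF K w] ceq_sym[OF K] by simp
  then have "cle R S H (coset (mx K w) H) (coset z H)" using C z coset_in_cosets[OF H m] by blast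
  then have "mn H (mx K w) \<preceq> mn H z" using cle_iff[OF H m z(1)] by simp
  moreover have "mn H z \<preceq> mn H (mx K w)" using ble_mx[OF K z(3)] m mn_mono[OF H] by blast
  ultimately show "C = coset (mx K w) H"
    using ble_antisym mn_eq_iff[OF H z(1) m] coset_eq_iff[OF H z(1) m] z by metis
qed

end

text \<open>Minimality could fail only at a \<open>\<gamma>\<close> with
  \<open>w \<gamma> = \<alpha>\<close>. Then the left reflection equals the right reflection in
  \<open>\<gamma>\<close>, which lengthens \<open>w\<close>.\<close>

lemma left_descent_is_min:
  assumes "is_min H w" "\<alpha> \<in> S" "len (sref \<alpha> \<circ> w) < len w"
  shows "is_min H (sref \<alpha> \<circ> w)"
  unfolding is_min_def
proof (intro conjI ballI)
  have w: "w \<in> W" using assms by (simp add: is_min_def)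
  then show "sref \<alpha> \<circ> w \<in> W" using assms S_R weyl_step by blast
  fix \<gamma> assume g: "\<gamma> \<in> simple_of S H"
  then have "w \<gamma> \<in> Pos" using assms by (simp add: is_min_def)
  moreover have "w \<gamma> \<noteq> \<alpha>"
  proof
    assume "w \<gamma> = \<alpha>"
    then have "sref \<alpha> \<circ> w = w \<circ> sref \<gamma>" using weyl_sref_conj[OF w, of \<gamma>] by (auto simp: fun_eq_iff)
    then show False
      using len_simple[OF w simple_of_S[OF g] \<open>w \<gamma> \<in> Pos\<close>] assms(3) by simp
  qed
  ultimately show "(sref \<alpha> \<circ> w) \<gamma> \<in> Pos" using simple_sref_Pos assms(2) by simp
qed

lemma len_inv: "w \<in> W \<Longrightarrow> len (inv w) = len w"
proof -
  have le: "len (inv w) \<le> len w" if w: "w \<in> W" for w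
  proof -
    obtain as where as: "set as \<subseteq> S" "w = word as" "length as = len w" using reduced_word w by blast
    have "inv w = word (rev as)" using word_rev[of as] as by (intro inv_unique_comp) auto
    then show ?thesis using len_word_le[of "rev as"] as by simp
  qed
  assume "w \<in> W"
  then show ?thesis using le[of w] le[of "inv w"] weyl_inv inv_inv by fastforce
qed

lemma len_left_neg:
  assumes "w \<in> W" "\<alpha> \<in> S" "inv w \<alpha> \<notin> Pos"
  shows "len w = Suc (len (sref \<alpha> \<circ> w))"
  using len_simple_neg[OF weyl_inv[OF assms(1)] assms(2,3)] assms
    len_inv[of w] len_inv[of "sref \<alpha> \<circ> w"] by (simp add: inv_sref_comp weyl_step S_R)

lemma len_left_pos:
  assumes "w \<in> W" "\<alpha> \<in> S" "inv w \<alpha> \<in> Pos"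
  shows "len (sref \<alpha> \<circ> w) = Suc (len w)"
  using len_simple[OF weyl_inv[OF assms(1)] assms(2,3)] assms
    len_inv[of w] len_inv[of "sref \<alpha> \<circ> w"] by (simp add: inv_sref_comp weyl_step S_R)

lemma ex_left_descent:
  assumes "w \<in> W" "w \<noteq> id"
  shows "\<exists>\<alpha>\<in>S. inv w \<alpha> \<notin> Pos"
  using ex_descent[OF weyl_inv[OF assms(1)]] inv_inv[OF assms(1)] assms(2) by (metis inv_id)

lemma sref_comp_cancel [simp]: "sref \<alpha> \<circ> (sref \<alpha> \<circ> w) = w"
  by (simp add: fun_eq_iff)

text \<open>Deodhar's argument: strip a left descent of \<open>w\<close> and use the lifting property.\<close>

lemma chain_property:
  assumes H: "std_parabolic H" and "is_min H u" "is_min H w" "u \<preceq> w" "u \<noteq> w"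
  shows "\<exists>z. is_min H z \<and> u \<preceq> z \<and> z \<preceq> w \<and> Suc (len z) = len w"
  using assms(2-)
proof (induction "len w" arbitrary: u w rule: less_induct)
  case less
  have W: "u \<in> W" "w \<in> W" using less.prems by (auto simp: is_min_def)
  have "w \<noteq> id" using ble_len[OF less.prems(3)] less.prems(4) by auto
  then obtain \<alpha> where a: "\<alpha> \<in> S" "inv w \<alpha> \<notin> Pos" using ex_left_descent W by blast
  define w' where "w' = sref \<alpha> \<circ> w"
  have lw: "len w = Suc (len w')" unfolding w'_def using len_left_neg[OF W(2) a] .
  have w': "is_min H w'" "w' \<in> W"
    using left_descent_is_min[OF less.prems(2) a(1)] lw unfolding w'_def by (auto simp: is_min_def)
  have w_w': "w = sref \<alpha> \<circ> w'" unfolding w'_def by simp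
  have w'_le: "w' \<preceq> w" using ble_inv[OF ble_reflection_neg[OF weyl_inv[OF W(2)] S_Pos[OF a(1)] a(2)]]
      W w' inv_inv inv_sref_comp[OF W(2), of \<alpha>] unfolding w'_def by metis
  show ?case
  proof (cases "u \<preceq> w'")
    case True
    then show ?thesis using w' w'_le lw by auto
  next
    case False
    \<comment> \<open>The lifting property now places \<open>u'\<close> below \<open>w'\<close>. The
      induction hypothesis applies to this pair, and the element it yields is reflected back by
      \<open>\<alpha>\<close>.\<close>
    define u' where "u' = sref \<alpha> \<circ> u"
    have u_u': "u = sref \<alpha> \<circ> u'" unfolding u'_def by simp
    have u'W: "u' \<in> W" unfolding u'_def using W a S_R weyl_step by blast
    have "u' \<preceq> w'" using lifting_left'[OF less.prems(3) a(1) W(2)] False unfolding u'_def w'_def by blast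
    moreover have "inv u \<alpha> \<notin> Pos"
    proof
      assume p: "inv u \<alpha> \<in> Pos"
      have "inv u \<preceq> inv u \<circ> sref \<alpha>" using ble_reflection[OF weyl_inv[OF W(1)] S_Pos[OF a(1)] p] .
      then have "inv (inv u) \<preceq> inv (inv u \<circ> sref \<alpha>)" by (rule ble_inv)
      then have "u \<preceq> u'" using inv_comp_sref[OF weyl_inv[OF W(1)]] inv_inv[OF W(1)] unfolding u'_def by simp
      then show False using \<open>u' \<preceq> w'\<close> False ble_trans by blast
    qed
    then have lu: "len u = Suc (len u')" unfolding u'_def using len_left_neg[OF W(1) a(1)] by blast
    then have u': "is_min H u'" using left_descent_is_min[OF less.prems(1) a(1)] unfolding u'_def by simp
    moreover have "u' \<noteq> w'" using less.prems(4) u_u' w_w' by blast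
    ultimately obtain z where z: "is_min H z" "u' \<preceq> z" "z \<preceq> w'" "Suc (len z) = len w'"
      using less.hyps[of w' u'] lw w' by auto
    have zW: "z \<in> W" using z by (simp add: is_min_def)
    have nuz: "\<not> u \<preceq> z" using z(3) False ble_trans by blast
    then have up: "u \<preceq> sref \<alpha> \<circ> z" using lifting_left[OF z(2) a(1) zW] u_u' by auto
    have le: "sref \<alpha> \<circ> z \<preceq> w"
      using lifting_left[OF z(3) a(1) w'(2)] w_w' w'_le ble_trans by metis
    have zp: "inv z \<alpha> \<in> Pos"
    proof (rule ccontr)
      assume n: "inv z \<alpha> \<notin> Pos"
      have "inv z \<circ> sref \<alpha> \<preceq> inv z" using ble_reflection_neg[OF weyl_inv[OF zW] S_Pos[OF a(1)] n] .
      then have "inv (inv z \<circ> sref \<alpha>) \<preceq> inv (inv z)" by (rule ble_inv)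
      then have "sref \<alpha> \<circ> z \<preceq> z" using inv_comp_sref[OF weyl_inv[OF zW]] inv_inv[OF zW] by simp
      then show False using up nuz ble_trans by blast
    qed
    have len: "len (sref \<alpha> \<circ> z) = Suc (len z)" using len_left_pos[OF zW a(1) zp] .
    have "is_min H (sref \<alpha> \<circ> z)"
      unfolding is_min_def
    proof (intro conjI ballI)
      show "sref \<alpha> \<circ> z \<in> W" using zW a S_R weyl_step by blast
      fix \<gamma> assume g: "\<gamma> \<in> simple_of S H"
      then have "z \<gamma> \<in> Pos" using z by (simp add: is_min_def)
      \<comment> \<open>Otherwise \<open>z\<close> and its reflection would share an
        \<open>H\<close>-coset, and the minimal \<open>u\<close>, being below the reflection, would
        lie below \<open>z\<close> too.\<close>
      moreover have "z \<gamma> \<noteq> \<alpha>"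
      proof
        assume "z \<gamma> = \<alpha>"
        then have "sref \<alpha> \<circ> z = z \<circ> sref \<gamma>" using weyl_sref_conj[OF zW, of \<gamma>] by (auto simp: fun_eq_iff)
        then have "ceq H (sref \<alpha> \<circ> z) z"
          using ceq_sym[OF H] ceq_iff[OF H zW] g by (auto simp: simple_of_def)
        then show False using is_min_ceq_ble[OF H less.prems(1) up] nuz by blast
      qed
      ultimately show "(sref \<alpha> \<circ> z) \<gamma> \<in> Pos" using simple_sref_Pos a(1) by simp
    qed
    then show ?thesis using up le len z(4) lw by (intro exI[of _ "sref \<alpha> \<circ> z"]) simp
  qed
qed

lemma std_parabolic_weyl: "std_parabolic W"
  by (auto simp: std_parabolic_def weyl_id weyl_comp weyl_inv weyl_sref S_R)

lemma longest_eq: "longest R S = mx W id"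
  unfolding longest_def
proof (rule the_equality)
  have le: "v \<preceq> mx W id" if "v \<in> W" for v
    using ble_mx[OF std_parabolic_weyl, of id v] that by (simp add: ceq_def weyl_id)
  have m: "mx W id \<in> W" using mx_W[OF std_parabolic_weyl weyl_id] .
  then show "mx W id \<in> W \<and> (\<forall>v\<in>W. len v \<le> len (mx W id))" using ble_len le by force
  fix w assume "w \<in> W \<and> (\<forall>v\<in>W. len v \<le> len w)"
  then show "w = mx W id" using ble_len[OF le[of w]] m by force
qed

lemma longest_W: "longest R S \<in> W"
  using longest_eq mx_W[OF std_parabolic_weyl weyl_id] by simp

lemma ble_longest: "v \<in> W \<Longrightarrow> v \<preceq> longest R S"
  using ble_mx[OF std_parabolic_weyl, of id v] by (simp add: longest_eq ceq_def weyl_id)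

lemma is_min_Pos_iff:
  assumes "std_parabolic H" "is_min H v" "\<beta> \<in> R" "sref \<beta> \<in> H"
  shows "v \<beta> \<in> Pos \<longleftrightarrow> \<beta> \<in> Pos"
proof (cases "\<beta> \<in> Pos")
  case True
  then show ?thesis using is_min_reflection_Pos assms by blast
next
  case False
  then have "- \<beta> \<in> Pos" using assms Pos_uminus by blast
  then have "v (- \<beta>) \<in> Pos" using is_min_reflection_Pos[OF assms(1,2)] assms(4) by simp
  then show ?thesis using False assms weyl_neg by (auto simp: is_min_def)
qed

lemma par_conj_simple:
  assumes "std_parabolic H" "u \<in> H" "sref \<alpha> \<in> H" shows "sref (u \<alpha>) \<in> H"
proof -
  have "sref (u \<alpha>) = u \<circ> sref \<alpha> \<circ> inv u"
    using par_W[OF assms(1,2)] weyl_sref_conj[of u R \<alpha>] by (auto simp: fun_eq_iff)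
  then show ?thesis using assms par_comp par_inv by metis
qed

context
  fixes H K v u
  assumes H: "std_parabolic H" and K: "std_parabolic K" and KH: "K \<subseteq> H"
    and v: "is_min H v" and u: "u \<in> H"
begin

lemma comp_Pos_iff: "\<alpha> \<in> simple_of S K \<Longrightarrow> (v \<circ> u) \<alpha> \<in> Pos \<longleftrightarrow> u \<alpha> \<in> Pos"
  using is_min_Pos_iff[OF H v, of "u \<alpha>"] par_conj_simple[OF H u, of \<alpha>] KH weyl_R[OF par_W[OF H u]]
  by (auto simp: simple_of_def S_R)

lemma v_W: "v \<in> W" and u_W: "u \<in> W"
  using v par_W[OF H u] by (auto simp: is_min_def)

lemma ceq_comp_left: "ceq K u z \<Longrightarrow> ceq K (v \<circ> u) (v \<circ> z)"
  using ceq_iff[OF K u_W, of z] ceq_iff[OF K weyl_comp[OF v_W u_W], of "v \<circ> z"] comp_assoc by metis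

lemma is_min_ceq_unique: "is_min K y \<Longrightarrow> ceq K x y \<Longrightarrow> mn K x = y"
  using is_min_mn[OF K] mn_cong[OF K] by metis

lemma is_max_ceq_unique: "is_max K y \<Longrightarrow> ceq K x y \<Longrightarrow> mx K x = y"
  using is_max_mx[OF K] mx_cong[OF K] by metis

end

text \<open>Left multiplication by \<open>v\<close> preserves the sign of every root whose
  reflection lies in \<open>H\<close>. Extremal representatives inside \<open>H\<close> are
  therefore carried to extremal ones in the coset of \<open>v\<close>.\<close>

lemma mn_comp:
  assumes "std_parabolic H" "std_parabolic K" "K \<subseteq> H" "is_min H v" "u \<in> H"
  shows "mn K (v \<circ> u) = v \<circ> mn K u"
proof (rule is_min_ceq_unique[OF assms])
  have uW: "u \<in> W" "v \<in> W" using assms par_W by (auto simp: is_min_def)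
  obtain h where h: "h \<in> K" "mn K u = u \<circ> h" using mn_cases[OF assms(2) uW(1)] by metis
  then have "mn K u \<in> H" using assms par_comp by auto
  then show "is_min K (v \<circ> mn K u)"
    using mn_is_min[OF assms(2) uW(1)] comp_Pos_iff[OF assms(1-4)] uW mn_W[OF assms(2)]
    by (auto simp: is_min_def weyl_comp simp del: comp_apply)
  show "ceq K (v \<circ> u) (v \<circ> mn K u)" using ceq_comp_left[OF assms] ceq_mn[OF assms(2) uW(1)] by blast
qed

lemma mx_comp:
  assumes "std_parabolic H" "std_parabolic K" "K \<subseteq> H" "is_min H v" "u \<in> H"
  shows "mx K (v \<circ> u) = v \<circ> mx K u"
proof (rule is_max_ceq_unique[OF assms])
  have uW: "u \<in> W" "v \<in> W" using assms par_W by (auto simp: is_min_def)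
  obtain h where h: "h \<in> K" "mx K u = u \<circ> h" using mx_cases[OF assms(2) uW(1)] by metis
  then have "mx K u \<in> H" using assms par_comp by auto
  then show "is_max K (v \<circ> mx K u)"
    using mx_is_max[OF assms(2) uW(1)] comp_Pos_iff[OF assms(1-4)] uW mx_W[OF assms(2)]
    by (auto simp: is_max_def weyl_comp simp del: comp_apply)
  show "ceq K (v \<circ> u) (v \<circ> mx K u)" using ceq_comp_left[OF assms] ceq_mx[OF assms(2) uW(1)] by blast
qed

lemma mx_in: "std_parabolic H \<Longrightarrow> mx H id \<in> H"
  using ceq_par[of H id "mx H id"] ceq_mx[of H id] weyl_id par_id by blast

section \<open>Stabilizers of dominant weights\<close>

lemma dominant_Pos:
  assumes "dominant S \<nu>" "\<beta> \<in> Pos" shows "\<nu> \<bullet> \<beta> \<ge> 0"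
proof -
  have "\<nu> \<bullet> \<alpha> \<ge> 0" if "\<alpha> \<in> S" for \<alpha>
  proof -
    have "2 * (\<nu> \<bullet> \<alpha>) / (\<alpha> \<bullet> \<alpha>) \<in> \<nat>" using assms that by (simp add: dominant_def)
    then have "2 * (\<nu> \<bullet> \<alpha>) / (\<alpha> \<bullet> \<alpha>) \<ge> 0" by (auto simp: Nats_def)
    moreover have "\<alpha> \<bullet> \<alpha> > 0" using S_nonzero[OF that] by simp
    ultimately show ?thesis by (simp add: zero_le_divide_iff)
  qed
  then have "(\<Sum>\<alpha>\<in>S. cf \<beta> \<alpha> * (\<nu> \<bullet> \<alpha>)) \<ge> 0"
    using assms(2) by (intro sum_nonneg) (auto simp: Pos_iff)
  also have "(\<Sum>\<alpha>\<in>S. cf \<beta> \<alpha> * (\<nu> \<bullet> \<alpha>)) = \<nu> \<bullet> \<beta>"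
    by (subst (2) cf_sum_eq[symmetric, of \<beta>]) (simp add: inner_sum_right)
  finally show ?thesis .
qed

text \<open>By invariance the pairing of \<open>\<nu>\<close> with \<open>\<alpha>\<close> equals
  that with the negative root \<open>w \<alpha>\<close>, so it is both nonnegative and
  nonpositive.\<close>

lemma fixed_descent_orthogonal:
  assumes "\<And>\<beta>. \<beta> \<in> Pos \<Longrightarrow> \<nu> \<bullet> \<beta> \<ge> 0" "w \<in> W" "w \<nu> = \<nu>" "\<alpha> \<in> S" "w \<alpha> \<notin> Pos"
  shows "\<nu> \<bullet> \<alpha> = 0"
proof -
  have "- w \<alpha> \<in> Pos" using assms Pos_uminus weyl_R S_R by blast
  then have "\<nu> \<bullet> w \<alpha> \<le> 0" using assms(1)[of "- w \<alpha>"] by simp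
  moreover have "\<nu> \<bullet> w \<alpha> = \<nu> \<bullet> \<alpha>" using weyl_isometry[OF assms(2), of \<nu> \<alpha>] assms(3) by simp
  ultimately show ?thesis using assms(1)[OF S_Pos[OF assms(4)]] by simp
qed

text \<open>Joint stabilizers turn intersections of parabolics into unions of index sets
  (\<open>fixer_UN\<close>), so all later inclusions are read off from indices.\<close>

definition fixer :: "(nat \<Rightarrow> 'a) \<Rightarrow> nat set \<Rightarrow> ('a \<Rightarrow> 'a) set" where
  "fixer lam A = {w \<in> W. \<forall>i\<in>A. w (lam i) = lam i}"

lemma std_parabolic_fixer:
  assumes "\<forall>i\<in>A. dominant S (lam i)"
  shows "std_parabolic (fixer lam A)"
  unfolding std_parabolic_def
proof (intro conjI ballI impI)
  fix u \<alpha> assume u: "u \<in> fixer lam A" and a: "\<alpha> \<in> S" "u \<alpha> \<notin> Pos"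
  have "lam i \<bullet> \<alpha> = 0" if "i \<in> A" for i
    using fixed_descent_orthogonal[of "lam i" u \<alpha>] dominant_Pos assms that u a by (auto simp: fixer_def)
  then show "sref \<alpha> \<in> fixer lam A" using a by (auto simp: fixer_def weyl_sref S_R sref_fixes_iff S_nonzero)
next
  fix u assume u: "u \<in> fixer lam A"
  then have "inv u (lam i) = lam i" if "i \<in> A" for i
    using that weyl_inv_apply(1)[of u R "lam i"] by (simp add: fixer_def)
  then show "inv u \<in> fixer lam A" using u by (simp add: fixer_def weyl_inv)
qed (auto simp: fixer_def weyl_id weyl_comp)

text \<open>A descent of an element fixing the sum is orthogonal to the sum, hence, all pairings
  being nonnegative, to every summand. Its reflection fixes all of them and can be stripped
  off.\<close>

lemma stab_sum_eq_fixer: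
  assumes "finite A" "\<forall>i\<in>A. dominant S (lam i)"
  shows "stab R (\<Sum>i\<in>A. lam i) = fixer lam A"
proof
  show "fixer lam A \<subseteq> stab R (\<Sum>i\<in>A. lam i)"
  proof
    fix w assume "w \<in> fixer lam A"
    then show "w \<in> stab R (\<Sum>i\<in>A. lam i)"
      using linear_sum[OF weyl_linear[of w R], of lam A] by (simp add: fixer_def stab_def)
  qed
  define \<nu> where "\<nu> = (\<Sum>i\<in>A. lam i)"
  have nn: "\<nu> \<bullet> \<beta> \<ge> 0" if "\<beta> \<in> Pos" for \<beta>
    unfolding \<nu>_def inner_sum_left using dominant_Pos assms that by (intro sum_nonneg) auto
  have "w \<in> fixer lam A" if "w \<in> W" "w \<nu> = \<nu>" for w
    using that
  proof (induction "len w" arbitrary: w rule: less_induct)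
    case less
    show ?case
    proof (cases "w = id")
      case False
      then obtain \<alpha> where a: "\<alpha> \<in> S" "w \<alpha> \<notin> Pos" using ex_descent less by blast
      have "\<nu> \<bullet> \<alpha> = 0" using fixed_descent_orthogonal[OF nn less.prems a] .
      moreover have "\<And>i. i \<in> A \<Longrightarrow> lam i \<bullet> \<alpha> \<ge> 0" using dominant_Pos assms(2) S_Pos[OF a(1)] by blast
      ultimately have "\<forall>i\<in>A. lam i \<bullet> \<alpha> = 0"
        using sum_nonneg_eq_0_iff[OF assms(1), of "\<lambda>i. lam i \<bullet> \<alpha>"] by (simp add: \<nu>_def inner_sum_left)
      then have fx: "\<forall>i\<in>A. sref \<alpha> (lam i) = lam i" "sref \<alpha> \<nu> = \<nu>"
        using \<open>\<nu> \<bullet> \<alpha> = 0\<close> sref_fixes_iff[OF S_nonzero[OF a(1)]] by auto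
      have "w \<circ> sref \<alpha> \<in> fixer lam A"
        using less.hyps[of "w \<circ> sref \<alpha>"] len_simple_neg[OF less.prems(1) a] less.prems fx
        by (simp add: weyl_comp weyl_sref S_R a)
      then show ?thesis using fx less.prems by (simp add: fixer_def)
    qed (simp add: fixer_def weyl_id)
  qed
  then show "stab R (\<Sum>i\<in>A. lam i) \<subseteq> fixer lam A" by (auto simp: stab_def \<nu>_def)
qed

end

subsection \<open>Index systems\<close>

lemma ul_subset: "ul II I \<subseteq> I" by (auto simp: ul_def)

lemma covers_diff_ul: "covers II K I \<Longrightarrow> I - K \<subseteq> ul II I"
proof -
  assume c: "covers II K I"
  then have "\<exists>K\<in>II. K \<subset> I" unfolding covers_def by blast
  then have "ul II I = \<Union>{I - K | K. covers II K I}" by (simp add: ul_def)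
  then show ?thesis using c by blast
qed

lemma ex_covers_above:
  assumes "finite I" "J \<in> II" "I \<in> II" "J \<subset> I"
  shows "\<exists>K. covers II J K \<and> K \<subseteq> I"
proof -
  define V where "V K \<longleftrightarrow> K \<in> II \<and> J \<subset> K \<and> K \<subseteq> I" for K
  have "V I" using assms unfolding V_def by blast
  then obtain K where "V K" and least: "\<forall>L. V L \<longrightarrow> card K \<le> card L"
    using ex_has_least_nat[of V I card] by metis
  then have K: "K \<in> II \<and> J \<subset> K \<and> K \<subseteq> I"
    and min: "\<forall>L. L \<in> II \<and> J \<subset> L \<and> L \<subseteq> I \<longrightarrow> card K \<le> card L" by (simp_all add: V_def)
  have "covers II J K"
    unfolding covers_def
  proof (intro conjI notI)
    assume "\<exists>L\<in>II. J \<subset> L \<and> L \<subset> K"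
    then obtain L where L: "L \<in> II" "J \<subset> L" "L \<subset> K" by blast
    then have "card K \<le> card L" using min K by blast
    moreover have "card L < card K" using L K assms(1) finite_subset psubset_card_mono by metis
    ultimately show False by simp
  qed (use K assms in auto)
  with K show ?thesis by blast
qed

lemma ex_covers_below:
  assumes "finite I" "J \<in> II" "I \<in> II" "J \<subset> I"
  shows "\<exists>K. covers II K I \<and> J \<subseteq> K"
proof -
  define V where "V K \<longleftrightarrow> K \<in> II \<and> J \<subseteq> K \<and> K \<subset> I" for K
  have "V J" using assms unfolding V_def by blast
  then obtain K where "V K" and least: "\<forall>L. V L \<longrightarrow> card (I - K) \<le> card (I - L)"
    using ex_has_least_nat[of V J "\<lambda>K. card (I - K)"] by metis
  then have K: "K \<in> II \<and> J \<subseteq> K \<and> K \<subset> I"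
    and min: "\<forall>L. L \<in> II \<and> J \<subseteq> L \<and> L \<subset> I \<longrightarrow> card (I - K) \<le> card (I - L)"
    by (simp_all add: V_def)
  have "covers II K I"
    unfolding covers_def
  proof (intro conjI notI)
    assume "\<exists>L\<in>II. K \<subset> L \<and> L \<subset> I"
    then obtain L where L: "L \<in> II" "K \<subset> L" "L \<subset> I" by blast
    then have "card (I - K) \<le> card (I - L)" using min K by blast
    moreover have "card (I - L) < card (I - K)"
      using L assms(1) by (intro psubset_card_mono) auto
    ultimately show False by simp
  qed (use K assms in auto)
  with K show ?thesis by blast
qed

lemma ex_cover_list:
  assumes "finite I" "J \<in> II" "I \<in> II" "J \<subseteq> I"
  shows "\<exists>Is. Is \<noteq> [] \<and> hd Is = J \<and> last Is = I \<and> successively (covers II) Is"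
  using assms
proof (induction "card (I - J)" arbitrary: J rule: less_induct)
  case less
  show ?case
  proof (cases "J = I")
    case True
    then show ?thesis by (intro exI[of _ "[I]"]) simp
  next
    case False
    then obtain K where K: "covers II J K" "K \<subseteq> I"
      using ex_covers_above[OF less.prems(1-3)] less.prems(4) by blast
    have "card (I - K) < card (I - J)"
      using K less.prems(1) by (intro psubset_card_mono) (auto simp: covers_def)
    then obtain Is where "Is \<noteq> []" "hd Is = K" "last Is = I" "successively (covers II) Is"
      using less.hyps[of K] K less.prems by (auto simp: covers_def)
    then show ?thesis using K by (intro exI[of _ "J # Is"]) (auto simp: successively_Cons)
  qed
qed

text \<open>For the last conjunct: passing up a cover adds only indices in \<open>ul\<close> of the
  upper member, so the chain accounts for every index beyond its head.\<close>

lemma successively_covers: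
  assumes "successively (covers II) Is" "Is \<noteq> []" "hd Is \<in> II"
  shows "set Is \<subseteq> II \<and> (\<forall>J\<in>set Is. hd Is \<subseteq> J) \<and> (\<forall>J\<in>set Is. \<forall>K\<in>set Is. J \<subseteq> K \<or> K \<subseteq> J) \<and>
    last Is \<subseteq> hd Is \<union> \<Union>(ul II ` set Is)"
  using assms
proof (induction Is)
  case (Cons I Is)
  show ?case
  proof (cases "Is = []")
    case False
    with Cons.prems have c: "covers II I (hd Is)" "successively (covers II) Is"
      by (auto simp: successively_Cons)
    then have "hd Is \<in> II" "I \<subseteq> hd Is" by (auto simp: covers_def)
    with Cons.IH c False have IH: "set Is \<subseteq> II" "\<forall>J\<in>set Is. hd Is \<subseteq> J"
      "\<forall>J\<in>set Is. \<forall>K\<in>set Is. J \<subseteq> K \<or> K \<subseteq> J" "last Is \<subseteq> hd Is \<union> \<Union>(ul II ` set Is)" by auto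
    have "hd Is - I \<subseteq> ul II (hd Is)" "hd Is \<in> set Is" using covers_diff_ul[OF c(1)] False by auto
    then have "hd Is \<subseteq> I \<union> \<Union>(ul II ` set (I # Is))" by auto
    moreover have "\<forall>J\<in>set Is. I \<subseteq> J" using IH(2) \<open>I \<subseteq> hd Is\<close> by blast
    ultimately show ?thesis using IH Cons.prems(3) False by auto
  qed (use Cons.prems in auto)
qed simp

lemma cover_chain_iff:
  "cover_chain II m I Is \<longleftrightarrow> Is \<noteq> [] \<and> hd Is = I \<and> last Is = {1..m} \<and> successively (covers II) Is"
  by (simp add: cover_chain_def successively_conv_nth)

text \<open>In \<open>step\<close>, the element \<open>y\<close> is the immediate successor of \<open>x\<close>.\<close>

lemma finite_chain_induct:
  assumes "finite A" "z \<in> A"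
    and refl: "\<And>x. x \<in> A \<Longrightarrow> r x x"
    and trans: "\<And>x y z. x \<in> A \<Longrightarrow> y \<in> A \<Longrightarrow> z \<in> A \<Longrightarrow> r x y \<Longrightarrow> r y z \<Longrightarrow> r x z"
    and antisym: "\<And>x y. x \<in> A \<Longrightarrow> y \<in> A \<Longrightarrow> r x y \<Longrightarrow> r y x \<Longrightarrow> x = y"
    and total: "\<And>x y. x \<in> A \<Longrightarrow> y \<in> A \<Longrightarrow> r x y \<or> r y x"
    and first: "\<And>x. x \<in> A \<Longrightarrow> (\<And>y. y \<in> A \<Longrightarrow> r x y) \<Longrightarrow> P x"
    and step: "\<And>x y. x \<in> A \<Longrightarrow> y \<in> A \<Longrightarrow> x \<noteq> y \<Longrightarrow> r x y \<Longrightarrow>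
       (\<And>t. t \<in> A \<Longrightarrow> r t x \<or> r y t) \<Longrightarrow> P x \<Longrightarrow> P y"
  shows "P z"
  using assms(2)
proof (induction "card {x \<in> A. r x z}" arbitrary: z rule: less_induct)
  case less
  define B where "B = {x \<in> A. r x z \<and> x \<noteq> z}"
  show ?case
  proof (cases "B = {}")
    case True
    then have "r z y" if "y \<in> A" for y using total[OF that less.prems] that refl unfolding B_def by blast
    then show ?thesis using first less.prems by blast
  next
    case False
    have "finite B" using assms(1) unfolding B_def by simp
    \<comment> \<open>An immediate predecessor of \<open>z\<close> is an element strictly below
      \<open>z\<close> with the largest number of elements of \<open>A\<close> below it.\<close>
    define M where "M = Max ((\<lambda>x. card {y \<in> A. r y x}) ` B)"
    have "M \<in> (\<lambda>x. card {y \<in> A. r y x}) ` B" unfolding M_def using \<open>finite B\<close> False by (intro Max_in) auto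
    then obtain x where x: "x \<in> B" "M = card {y \<in> A. r y x}" by blast
    have max: "card {y \<in> A. r y t} \<le> card {y \<in> A. r y x}" if "t \<in> B" for t
      unfolding x(2)[symmetric] M_def using \<open>finite B\<close> that by auto
    have xA: "x \<in> A" "r x z" "x \<noteq> z" using x unfolding B_def by auto
    have lt: "card {y \<in> A. r y s} < card {y \<in> A. r y t}" if "s \<in> A" "t \<in> A" "r s t" "s \<noteq> t" for s t
    proof (rule psubset_card_mono)
      show "finite {y \<in> A. r y t}" using assms(1) by simp
      have "t \<notin> {y \<in> A. r y s}" using antisym that by blast
      moreover have "t \<in> {y \<in> A. r y t}" using refl that by blast
      moreover have "{y \<in> A. r y s} \<subseteq> {y \<in> A. r y t}" using trans that by blast
      ultimately show "{y \<in> A. r y s} \<subset> {y \<in> A. r y t}" by blast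
    qed
    have "P x" using less.hyps[of x] lt[OF xA(1) less.prems xA(2,3)] xA(1) by blast
    moreover have "r t x \<or> r z t" if t: "t \<in> A" for t
    proof (rule ccontr)
      assume n: "\<not> (r t x \<or> r z t)"
      then have "r x t" "x \<noteq> t" "r t z" "t \<noteq> z"
        using total[OF t xA(1)] total[OF t less.prems] refl[OF t] by auto
      then have "t \<in> B" using t unfolding B_def by blast
      then show False using max[of t] lt[OF xA(1) t \<open>r x t\<close> \<open>x \<noteq> t\<close>] by simp
    qed
    ultimately show ?thesis using step[OF xA(1) less.prems xA(3,2)] by blast
  qed
qed

section \<open>Parabolics attached to an index system\<close>

locale standard_data = based_root_system R S for R S :: "'a::euclidean_space set" +
  fixes lam :: "nat \<Rightarrow> 'a" and m :: nat and II :: "nat set set"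
  assumes dominant: "\<forall>i\<in>{1..m}. dominant S (lam i)"
    and index_sys: "index_sys II m"
begin

abbreviation "Q \<equiv> WQ R lam m"
abbreviation "P \<equiv> WP R lam II"
abbreviation "QI \<equiv> WQI R lam II"
abbreviation "QR \<equiv> WQr R lam II"

lemma II_subset: "I \<in> II \<Longrightarrow> I \<subseteq> {1..m}" and top_II: "{1..m} \<in> II"
  using index_sys by (auto simp: index_sys_def)

lemma finite_II: "finite II" 
proof -
  have "II \<subseteq> Pow {1..m}" using II_subset by blast
  then show ?thesis by (rule finite_subset) simp
qed

lemma finite_I: "I \<in> II \<Longrightarrow> finite I" using II_subset finite_subset by blast

lemma dominant_on: "A \<subseteq> {1..m} \<Longrightarrow> \<forall>i\<in>A. dominant S (lam i)" using dominant by blast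

lemma fixer_stab: "A \<subseteq> {1..m} \<Longrightarrow> stab R (\<Sum>i\<in>A. lam i) = fixer lam A"
  by (rule stab_sum_eq_fixer[OF finite_subset[OF _ finite_atLeastAtMost] dominant_on])

lemma fixer_par: "A \<subseteq> {1..m} \<Longrightarrow> std_parabolic (fixer lam A)"
  using dominant_on by (intro std_parabolic_fixer)

lemma fixer_mono: "A \<subseteq> B \<Longrightarrow> fixer lam B \<subseteq> fixer lam A" by (auto simp: fixer_def)

lemma ul_m: "I \<in> II \<Longrightarrow> ul II I \<subseteq> {1..m}" using ul_subset II_subset by blast

lemma Q_fixer: "Q = fixer lam {1..m}" unfolding WQ_def by (rule fixer_stab) simp

lemma P_fixer: "I \<in> II \<Longrightarrow> P I = fixer lam (ul II I)"
  unfolding WP_def using ul_m by (rule fixer_stab)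

text \<open>Descend by covers to a minimal member of \<open>II\<close>, where \<open>ul\<close> is
  the whole set; every cover on the way contributes the indices it removes. One chain thus suffices
  to cut out \<open>QI I\<close>.\<close>

lemma saturated_chain_below:
  assumes "I \<in> II"
  shows "\<exists>L. L \<subseteq> II \<and> I \<in> L \<and> (\<forall>J\<in>L. J \<subseteq> I) \<and> (\<forall>J\<in>L. \<forall>K\<in>L. J \<subseteq> K \<or> K \<subseteq> J) \<and> I \<subseteq> \<Union>(ul II ` L)"
  using assms
proof (induction "card I" arbitrary: I rule: less_induct)
  case less
  show ?case
  proof (cases "\<exists>K\<in>II. K \<subset> I")
    case True
    then obtain K where K: "covers II K I" using ex_covers_below finite_I less.prems by metis
    then have "card K < card I" "K \<in> II" "K \<subset> I"
      using finite_I[OF less.prems] by (auto simp: covers_def psubset_card_mono)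
    with less.hyps obtain L where L: "L \<subseteq> II" "K \<in> L" "\<forall>J\<in>L. J \<subseteq> K"
       "\<forall>J\<in>L. \<forall>K\<in>L. J \<subseteq> K \<or> K \<subseteq> J" "K \<subseteq> \<Union>(ul II ` L)" by meson
    have le: "\<forall>J\<in>insert I L. J \<subseteq> I" using L(3) \<open>K \<subset> I\<close> by blast
    have tot: "\<forall>J\<in>insert I L. \<forall>K\<in>insert I L. J \<subseteq> K \<or> K \<subseteq> J" using L(4) le by blast
    have "I \<subseteq> \<Union>(ul II ` insert I L)" using L(5) covers_diff_ul[OF K] by auto
    then show ?thesis using less.prems L(1) le tot by (intro exI[of _ "insert I L"]) simp
  next
    case False
    then have "ul II I = I" by (auto simp: ul_def)
    then show ?thesis using less.prems by (intro exI[of _ "{I}"]) auto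
  qed
qed

text \<open>Nonemptiness matters: an empty intersection would consist of all functions, not of
  \<open>W\<close>.\<close>

lemma fixer_UN: "\<C> \<noteq> {} \<Longrightarrow> fixer lam (\<Union>(f ` \<C>)) = (\<Inter>J\<in>\<C>. fixer lam (f J))"
proof (rule set_eqI)
  fix w assume "\<C> \<noteq> {}"
  then obtain J where "J \<in> \<C>" by blast
  then show "w \<in> fixer lam (\<Union>(f ` \<C>)) \<longleftrightarrow> w \<in> (\<Inter>J\<in>\<C>. fixer lam (f J))"
    by (auto simp: fixer_def)
qed

lemma QI_fixer:
  assumes "I \<in> II" shows "QI I = fixer lam I"
proof -
  define \<C> where "\<C> = {J \<in> II. J \<subseteq> I}"
  obtain L where L: "L \<subseteq> II" "\<forall>J\<in>L. J \<subseteq> I" "I \<subseteq> \<Union>(ul II ` L)"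
    using saturated_chain_below[OF assms] by (elim exE conjE) (rule that)
  have "L \<subseteq> \<C>" using L(1,2) unfolding \<C>_def by blast
  then have "I \<subseteq> \<Union>(ul II ` \<C>)" using L(3) by blast
  moreover have "\<Union>(ul II ` \<C>) \<subseteq> I"
  proof (rule UN_least)
    fix J assume "J \<in> \<C>"
    then show "ul II J \<subseteq> I" using ul_subset[of II J] unfolding \<C>_def by auto
  qed
  ultimately have eq: "\<Union>(ul II ` \<C>) = I" by (rule subset_antisym[rotated])
  have "QI I = (\<Inter>J\<in>\<C>. P J)" unfolding WQI_def \<C>_def setcompr_eq_image ..
  also have "\<dots> = (\<Inter>J\<in>\<C>. fixer lam (ul II J))"
    by (rule INF_cong) (simp_all add: \<C>_def P_fixer)
  also have "\<dots> = fixer lam (\<Union>(ul II ` \<C>))"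
    using assms by (intro fixer_UN[symmetric]) (auto simp: \<C>_def)
  finally show ?thesis using eq by simp
qed

lemma QR_fixer:
  assumes "set Is \<subseteq> II" "Is \<noteq> []" shows "QR Is = fixer lam (\<Union>(ul II ` set Is))"
proof -
  have "QR Is = (\<Inter>J\<in>set Is. fixer lam (ul II J))"
    unfolding WQr_def by (rule INF_cong) (use assms P_fixer in auto)
  also have "\<dots> = fixer lam (\<Union>(ul II ` set Is))" using assms(2) by (intro fixer_UN[symmetric]) simp
  finally show ?thesis .
qed

lemma cover_chain_props:
  assumes "I \<in> II" "cover_chain II m I Is"
  shows "set Is \<subseteq> II" "Is \<noteq> []" "I \<in> set Is" "\<forall>J\<in>set Is. I \<subseteq> J"
    "\<forall>J\<in>set Is. \<forall>K\<in>set Is. J \<subseteq> K \<or> K \<subseteq> J" "{1..m} \<subseteq> I \<union> \<Union>(ul II ` set Is)"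
proof -
  have c: "Is \<noteq> []" "hd Is = I" "last Is = {1..m}" "successively (covers II) Is"
    using assms(2) unfolding cover_chain_iff by blast+
  note sc = successively_covers[OF c(4,1), unfolded c(2,3), OF assms(1)]
  show "set Is \<subseteq> II" "\<forall>J\<in>set Is. I \<subseteq> J" "\<forall>J\<in>set Is. \<forall>K\<in>set Is. J \<subseteq> K \<or> K \<subseteq> J"
    "{1..m} \<subseteq> I \<union> \<Union>(ul II ` set Is)" using sc by simp_all
  show "Is \<noteq> []" "I \<in> set Is" using c(1,2) hd_in_set by auto
qed

lemma ex_cover_chain:
  assumes "J \<in> II" "I \<in> II" "J \<subseteq> I"
  shows "\<exists>Is. cover_chain II m J Is \<and> I \<in> set Is"
proof -
  obtain Is where Is: "Is \<noteq> []" "hd Is = J" "last Is = I" "successively (covers II) Is"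
    using ex_cover_list[OF finite_I[OF assms(2)] assms] by blast
  obtain Ks where Ks: "Ks \<noteq> []" "hd Ks = I" "last Ks = {1..m}" "successively (covers II) Ks"
    using ex_cover_list[OF finite_atLeastAtMost assms(2) top_II II_subset[OF assms(2)]] by blast
  obtain Ls where Ls: "Ks = I # Ls" using Ks(1,2) by (cases Ks) auto
  have I: "I \<in> set Is" using Is(1,3) last_in_set by blast
  have "cover_chain II m J (Is @ Ls)"
    unfolding cover_chain_iff
  proof (intro conjI)
    show "successively (covers II) (Is @ Ls)"
      using Is Ks(4) unfolding Ls successively_append_iff successively_Cons by auto
    show "last (Is @ Ls) = {1..m}" using Is(3) Ks(3) unfolding Ls by (cases "Ls = []") auto
  qed (use Is in auto)
  with I show ?thesis by (intro exI[of _ "Is @ Ls"]) simp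
qed

lemma parQ: "std_parabolic Q" unfolding Q_fixer by (rule fixer_par) simp
lemma parP: "I \<in> II \<Longrightarrow> std_parabolic (P I)" using P_fixer fixer_par ul_m by simp
lemma parQI: "I \<in> II \<Longrightarrow> std_parabolic (QI I)" using QI_fixer fixer_par II_subset by simp

lemma Q_QI: "I \<in> II \<Longrightarrow> Q \<subseteq> QI I" using QI_fixer Q_fixer fixer_mono II_subset by simp
lemma QI_P: "I \<in> II \<Longrightarrow> QI I \<subseteq> P I" using QI_fixer P_fixer fixer_mono ul_subset by simp
lemma Q_P: "I \<in> II \<Longrightarrow> Q \<subseteq> P I" using Q_QI QI_P by blast
lemma QI_antimono: "J \<in> II \<Longrightarrow> I \<in> II \<Longrightarrow> J \<subseteq> I \<Longrightarrow> QI I \<subseteq> QI J" using QI_fixer fixer_mono by simp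
lemma QI_minimal: "I \<in> II \<Longrightarrow> \<not> (\<exists>K\<in>II. K \<subset> I) \<Longrightarrow> QI I = P I"
  using QI_fixer P_fixer by (simp add: ul_def)

context
  fixes I Is assumes I: "I \<in> II" and Is: "cover_chain II m I Is"
begin

lemma QR_eq_fixer: "QR Is = fixer lam (\<Union>(ul II ` set Is))" "\<Union>(ul II ` set Is) \<subseteq> {1..m}"
proof -
  show "QR Is = fixer lam (\<Union>(ul II ` set Is))"
    using QR_fixer cover_chain_props(1,2)[OF I Is] by blast
  show "\<Union>(ul II ` set Is) \<subseteq> {1..m}"
    by (rule UN_least, rule ul_m) (use cover_chain_props(1)[OF I Is] in blast)
qed

lemma parQR: "std_parabolic (QR Is)"
  using QR_eq_fixer fixer_par by simp

lemma Q_QR: "Q \<subseteq> QR Is"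
  using QR_eq_fixer Q_fixer fixer_mono by simp

lemma QR_P: "J \<in> set Is \<Longrightarrow> QR Is \<subseteq> P J" by (auto simp: WQr_def)

lemma QR_P_self: "QR Is \<subseteq> P I" using QR_P cover_chain_props[OF I Is] by blast

lemma fixer_Un_subset_Q: "{1..m} \<subseteq> A \<union> B \<Longrightarrow> fixer lam A \<inter> fixer lam B \<subseteq> Q"
  unfolding Q_fixer fixer_def by blast

lemma QI_QR: "QI I \<inter> QR Is = Q"
  using fixer_Un_subset_Q[OF cover_chain_props(6)[OF I Is]] QI_fixer[OF I] QR_eq_fixer(1) Q_QI[OF I] Q_QR
  by auto

text \<open>Stronger than the inclusion in \<open>QI_QR\<close>, since \<open>QI J\<close> contains
  \<open>QI I\<close>. The indices lost from \<open>I\<close> to \<open>J\<close> lie in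
  \<open>ul II I\<close>, and \<open>I\<close> itself belongs to the chain
  \<open>Is\<close>.\<close>

lemma QI_QR_covers: "covers II J I \<Longrightarrow> QI J \<inter> QR Is \<subseteq> Q"
proof -
  assume c: "covers II J I"
  then have J: "J \<in> II" by (simp add: covers_def)
  have "I - J \<subseteq> \<Union>(ul II ` set Is)" using covers_diff_ul[OF c] cover_chain_props(3)[OF I Is] by blast
  then have "{1..m} \<subseteq> J \<union> \<Union>(ul II ` set Is)" using cover_chain_props(6)[OF I Is] by blast
  then show ?thesis using fixer_Un_subset_Q QI_fixer[OF J] QR_eq_fixer(1) by simp
qed

end

text \<open>Under (ii), the coset of \<open>star I w\<close> is the only possible lift of \<open>(w W_{P_I}, I)\<close> in a defining
  chain of a maximal standard chain. The predicates \<open>cond_ii\<close> and \<open>cond_iii\<close> are (ii) and (iii) for one index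
  \<open>I\<close> and one covering chain.\<close>

definition star :: "nat set \<Rightarrow> ('a \<Rightarrow> 'a) \<Rightarrow> 'a \<Rightarrow> 'a" where
  "star I w = mn (QI I) (mx (P I) w)"

definition cond_ii :: "nat set \<Rightarrow> nat set list \<Rightarrow> bool" where
  "cond_ii I Is \<longleftrightarrow> ceq Q (star I id) (mx (QR Is) id)"

definition cond_iii :: "nat set \<Rightarrow> nat set list \<Rightarrow> bool" where
  "cond_iii I Is \<longleftrightarrow> (\<forall>b\<in>P I. is_min (QI I) b \<longrightarrow> b \<in> QR Is)"

text \<open>With \<open>v\<close> minimal in its \<open>P I\<close>-coset, the construction is the
  left translate by \<open>v\<close> of that for the identity coset; lengths therefore shift by a
  constant depending on \<open>I\<close> alone.\<close>

lemma star_props: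
  assumes "I \<in> II" "w \<in> W"
  shows "star I w \<in> W" "ceq (P I) w (star I w)" "is_min (QI I) (star I w)" "is_min Q (star I w)"
    "star I w = mn (P I) w \<circ> star I id" "len (star I w) = len (mn (P I) w) + len (star I id)"
proof -
  note P = parP[OF assms(1)] and QI = parQI[OF assms(1)] and QIP = QI_P[OF assms(1)]
  have xW: "mx (P I) w \<in> W" using mx_W[OF P assms(2)] .
  show sW: "star I w \<in> W" unfolding star_def using mn_W[OF QI xW] .
  show "ceq (P I) w (star I w)"
    using ceq_trans[OF P ceq_mx[OF P assms(2)] ceq_mono[OF QIP ceq_mn[OF QI xW]]] by (simp add: star_def)
  show "is_min (QI I) (star I w)" unfolding star_def using mn_is_min[OF QI xW] .
  then show "is_min Q (star I w)" using is_min_mono[OF Q_QI[OF assms(1)]] by blast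
  define v where "v = mn (P I) w"
  have v: "is_min (P I) v" unfolding v_def using mn_is_min[OF P assms(2)] .
  have "mx (P I) w = mx (P I) v"
    unfolding v_def using mx_cong[OF P ceq_mn[OF P assms(2)]] .
  also have "\<dots> = v \<circ> mx (P I) id"
    using mx_comp[OF P P order_refl v par_id[OF P]] by simp
  finally have "star I w = v \<circ> star I id"
    unfolding star_def using mn_comp[OF P QI QIP v mx_in[OF P]] by simp
  then show eq: "star I w = mn (P I) w \<circ> star I id" unfolding v_def .
  have "ceq (P I) id (star I id)"
    using ceq_trans[OF P ceq_mx[OF P weyl_id] ceq_mono[OF QIP ceq_mn[OF QI mx_W[OF P weyl_id]]]]
    by (simp add: star_def)
  then have "star I id \<in> P I" using ceq_par[OF P] par_id[OF P] by blast
  then show "len (star I w) = len (mn (P I) w) + len (star I id)"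
    using eq len_min_comp[OF P v] v_def by simp
qed

lemma star_in_P: "I \<in> II \<Longrightarrow> star I id \<in> P I"
  using star_props(2)[OF _ weyl_id] ceq_par[OF parP] par_id[OF parP] by blast

lemma star_cong: "I \<in> II \<Longrightarrow> ceq (P I) u w \<Longrightarrow> star I u = star I w"
  unfolding star_def using mx_cong[OF parP] by metis

text \<open>Translates (ii) from the identity coset to an arbitrary one by the minimal
  representative, which respects extremal representatives.\<close>

lemma star_top:
  assumes "I \<in> II" "cover_chain II m I Is" "cond_ii I Is" "w \<in> W"
  shows "ceq Q (star I w) (mx (QR Is) (mn (P I) w))"
proof -
  note P = parP[OF assms(1)] and QR = parQR[OF assms(1,2)] and QRP = QR_P_self[OF assms(1,2)]
  have v: "is_min (P I) (mn (P I) w)" using mn_is_min[OF P assms(4)] .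
  have "mx (QR Is) (mn (P I) w) = mn (P I) w \<circ> mx (QR Is) id"
    using mx_comp[OF P QR QRP v par_id[OF P]] by simp
  moreover have "ceq Q (mn (P I) w \<circ> star I id) (mn (P I) w \<circ> mx (QR Is) id)"
    using ceq_comp_left[OF P parQ Q_P[OF assms(1)] v star_in_P[OF assms(1)]] assms(3)
    by (simp add: cond_ii_def)
  ultimately show ?thesis using star_props(5)[OF assms(1,4)] by simp
qed

text \<open>Makes \<open>star I id\<close> the largest \<open>QI I\<close>-minimal element of
  \<open>P I\<close>. As parabolics are closed downwards, (iii) need only be tested on it.\<close>

lemma le_star:
  assumes "I \<in> II" "b \<in> P I" shows "mn (QI I) b \<preceq> star I id"
proof -
  have "ceq (P I) id b" using ceq_iff[OF parP[OF assms(1)] weyl_id] assms(2) by simp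
  then have "b \<preceq> mx (P I) id" by (rule ble_mx[OF parP[OF assms(1)]])
  then show ?thesis unfolding star_def
    by (rule mn_mono[OF parQI[OF assms(1)]]) (rule mx_W[OF parP[OF assms(1)] weyl_id])
qed

lemma cond_ii_iff_cond_iii:
  assumes "I \<in> II" "cover_chain II m I Is"
  shows "cond_ii I Is \<longleftrightarrow> cond_iii I Is" and "star I id \<in> QR Is \<Longrightarrow> cond_iii I Is"
proof -
  note P = parP[OF assms(1)] and QR = parQR[OF assms] and QRP = QR_P_self[OF assms]
    and QI = parQI[OF assms(1)] and x = star_props[OF assms(1) weyl_id]
  show 3: "cond_iii I Is" if "star I id \<in> QR Is"
    unfolding cond_iii_def
  proof (intro ballI impI)
    fix b assume b: "b \<in> P I" "is_min (QI I) b"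
    then have "b \<preceq> star I id" using le_star[OF assms(1) b(1)] is_min_mn[OF QI b(2)] by simp
    then show "b \<in> QR Is" using par_ble[OF QR] that by blast
  qed
  show "cond_ii I Is \<longleftrightarrow> cond_iii I Is"
  proof
    assume "cond_ii I Is"
    then have "ceq (QR Is) (star I id) (mx (QR Is) id)"
      unfolding cond_ii_def by (rule ceq_mono[OF Q_QR[OF assms]])
    then have "star I id \<in> QR Is" using ceq_par[OF QR] mx_in[OF QR] by blast
    then show "cond_iii I Is" using 3 by blast
  next
    assume c3: "cond_iii I Is"
    define y where "y = mn Q (mx (QR Is) id)"
    have mW: "mx (QR Is) id \<in> W" using mx_W[OF QR weyl_id] .
    have cy: "ceq Q (mx (QR Is) id) y" unfolding y_def using ceq_mn[OF parQ mW] .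
    then have yW: "y \<in> W" using ceq_W by blast
    have yR: "y \<in> QR Is" using ceq_par[OF QR ceq_mono[OF Q_QR[OF assms] cy]] mx_in[OF QR] by blast
    have ymin: "is_min Q y" unfolding y_def using mn_is_min[OF parQ mW] .
    have xR: "star I id \<in> QR Is" using c3 x(3) star_in_P[OF assms(1)] by (simp add: cond_iii_def)
    then have "ceq (QR Is) id (star I id)" using ceq_iff[OF QR weyl_id] by (metis id_comp)
    then have "star I id \<preceq> mx (QR Is) id" using ble_mx[OF QR] by blast
    then have xy: "star I id \<preceq> y"
      unfolding y_def using mn_mono[OF parQ _ mW] is_min_mn[OF parQ x(4)] by metis
    \<comment> \<open>Reducing \<open>y\<close> modulo \<open>QI I\<close> does not change it: by
      (iii) the result stays in \<open>QR Is\<close>, so the difference lies in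
      \<open>QI I \<inter> QR Is = Q\<close>, and both elements are \<open>Q\<close>-minimal. Then
      \<open>le_star\<close> bounds \<open>y\<close> from above.\<close>
    define a where "a = mn (QI I) y"
    have ca: "ceq (QI I) y a" unfolding a_def using ceq_mn[OF QI yW] .
    have amin: "is_min (QI I) a" unfolding a_def using mn_is_min[OF QI yW] .
    have "a \<in> P I" using ceq_par[OF P ceq_mono[OF QI_P[OF assms(1)] ca]] yR QRP by blast
    then have aR: "a \<in> QR Is" using c3 amin by (simp add: cond_iii_def)
    have "inv y \<circ> a \<in> QI I \<inter> QR Is"
      using ca par_comp[OF QR par_inv[OF QR yR] aR] by (simp add: ceq_def)
    then have "ceq Q y a" using QI_QR[OF assms] ca by (simp add: ceq_def)
    then have "y = a"
      using is_min_mn[OF parQ ymin] is_min_mn[OF parQ is_min_mono[OF Q_QI[OF assms(1)] amin]] mn_cong[OF parQ] by metis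
    then have "y \<preceq> star I id" using le_star[OF assms(1), of y] yR QRP a_def by auto
    then have "y = star I id" using xy ble_antisym by blast
    then show "cond_ii I Is" using cy ceq_sym[OF parQ] unfolding cond_ii_def by metis
  qed
qed

text \<open>By \<open>star_top\<close> the left side is maximal in its \<open>Q^r\<close>-coset, where \<open>r\<close> belongs to \<open>J\<close>, which gives
  the inequality in \<open>W/W_{P_I}\<close>; minimality modulo \<open>Q_I\<close> then lifts it.\<close>

lemma star_embedding:
  assumes c2: "\<And>I Is. I \<in> II \<Longrightarrow> cover_chain II m I Is \<Longrightarrow> cond_ii I Is"
    and "J \<in> II" "I \<in> II" "J \<subseteq> I" "u \<in> W" "w \<in> W" "mn Q u \<preceq> mn Q w"
  shows "star J u \<preceq> star I w"
proof -
  obtain Is where Is: "cover_chain II m J Is" "I \<in> set Is" using ex_cover_chain assms(2-4) by blast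
  note QR = parQR[OF assms(2) Is(1)]
  have PQ: "ceq (P J) u (mn Q u)" using ceq_mono[OF Q_P[OF assms(2)] ceq_mn[OF parQ assms(5)]] .
  have RQ: "ceq (QR Is) w (mn Q w)" using ceq_mono[OF Q_QR[OF assms(2) Is(1)] ceq_mn[OF parQ assms(6)]] .
  have "mn (P J) u \<preceq> mn Q w" using mn_ble[OF parP[OF assms(2)] PQ] assms(7) ble_trans by blast
  then have "mx (QR Is) (mn (P J) u) \<preceq> mx (QR Is) w"
    using mx_mono[OF QR] mn_W[OF parQ assms(6)] mx_cong[OF QR RQ] by metis
  moreover have "star J u \<preceq> mx (QR Is) (mn (P J) u)"
    using star_top[OF assms(2) Is(1) c2[OF assms(2) Is(1)] assms(5)] is_min_mn[OF parQ star_props(4)[OF assms(2,5)]]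
      mn_ble[OF parQ] by metis
  moreover have "mx (QR Is) w \<preceq> mx (P I) w"
    using ble_mx[OF parP[OF assms(3)] ceq_mono[OF QR_P[OF assms(2) Is] ceq_mx[OF QR assms(6)]]] .
  ultimately have "star J u \<preceq> mx (P I) w" using ble_trans by blast
  then have "mn (QI I) (star J u) \<preceq> star I w"
    unfolding star_def[of I] using mn_mono[OF parQI[OF assms(3)]] mx_W[OF parP[OF assms(3)] assms(6)] by blast
  moreover have "mn (QI I) (star J u) = star J u"
    using is_min_mn[OF parQI[OF assms(3)]] is_min_mono[OF QI_antimono[OF assms(2-4)]]
      star_props(3)[OF assms(2,5)] by blast
  ultimately show ?thesis by simp
qed

subsection \<open>Standard chains\<close>

abbreviation "\<tau> \<equiv> coset (longest R S) Q"
abbreviation "Wb \<equiv> Wbig R S lam m II \<tau>"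
abbreviation "Wu \<equiv> Wund R S lam II \<tau>"
abbreviation "bgle \<equiv> bigle R S lam m"
abbreviation "unle \<equiv> undle R S lam m II \<tau>"
abbreviation "\<rho> \<equiv> rho R lam II"
abbreviation "D \<equiv> Dset R S lam m II \<tau>"
abbreviation "deff \<equiv> defining R S lam m II \<tau>"
abbreviation "maxstd \<equiv> max_tau_std_chain R S lam m II \<tau>"
abbreviation "std \<equiv> tau_std_chain R S lam m II \<tau>"

definition big :: "('a \<Rightarrow> 'a) \<Rightarrow> nat set \<Rightarrow> 'a elt" where "big w I = (coset w Q, I)"
definition und :: "('a \<Rightarrow> 'a) \<Rightarrow> nat set \<Rightarrow> 'a elt" where "und w I = (coset w (P I), I)"

lemma snd_big [simp]: "snd (big w I) = I" and snd_und [simp]: "snd (und w I) = I"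
  by (simp_all add: big_def und_def)

text \<open>The choice of \<open>\<tau>\<close> as the class of the longest element enters here:
  every coset occurs in both posets.\<close>

lemma cle_longest:
  assumes "std_parabolic H" "w \<in> W" shows "cle R S H (coset w H) (coset (longest R S) H)"
  using assms longest_W ble_longest mn_mono by (simp add: cle_iff)

lemma Wb_iff: "x \<in> Wb \<longleftrightarrow> (\<exists>w\<in>W. \<exists>I\<in>II. x = big w I)"
proof
  assume "x \<in> Wb"
  then have "fst x \<in> cosets R Q" "snd x \<in> II" by (auto simp: Wbig_def)
  then show "\<exists>w\<in>W. \<exists>I\<in>II. x = big w I"
    unfolding big_def by (metis cosets_cases parQ prod.collapse)
next
  assume "\<exists>w\<in>W. \<exists>I\<in>II. x = big w I"
  then show "x \<in> Wb"
    using cle_longest[OF parQ] coset_in_cosets[OF parQ] by (auto simp: Wbig_def big_def)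
qed

lemma proj_tau: "I \<in> II \<Longrightarrow> proj (P I) \<tau> = coset (longest R S) (P I)"
  by (rule proj_coset[OF parQ parP Q_P])

lemma Wu_iff: "x \<in> Wu \<longleftrightarrow> (\<exists>w\<in>W. \<exists>I\<in>II. x = und w I)"
proof
  assume "x \<in> Wu"
  then have "fst x \<in> cosets R (P (snd x))" "snd x \<in> II" by (auto simp: Wund_def)
  then show "\<exists>w\<in>W. \<exists>I\<in>II. x = und w I"
    unfolding und_def by (metis cosets_cases parP prod.collapse)
next
  assume "\<exists>w\<in>W. \<exists>I\<in>II. x = und w I"
  then show "x \<in> Wu"
    using cle_longest[OF parP] coset_in_cosets[OF parP] proj_tau by (auto simp: Wund_def und_def)
qed

lemma big_Wb: "w \<in> W \<Longrightarrow> I \<in> II \<Longrightarrow> big w I \<in> Wb" using Wb_iff by blast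
lemma und_Wu: "w \<in> W \<Longrightarrow> I \<in> II \<Longrightarrow> und w I \<in> Wu" using Wu_iff by blast

lemma rho_big: "I \<in> II \<Longrightarrow> \<rho> (big w I) = und w I"
  unfolding rho_def big_def und_def by (simp add: proj_coset[OF parQ parP Q_P])

lemma big_eq_iff: "u \<in> W \<Longrightarrow> w \<in> W \<Longrightarrow> big u J = big w I \<longleftrightarrow> J = I \<and> ceq Q u w"
  unfolding big_def using coset_eq_iff[OF parQ] by auto

lemma und_eq_iff: "u \<in> W \<Longrightarrow> w \<in> W \<Longrightarrow> I \<in> II \<Longrightarrow> und u J = und w I \<longleftrightarrow> J = I \<and> ceq (P I) u w"
  unfolding und_def using coset_eq_iff[OF parP] by auto

lemma bgle_iff: "u \<in> W \<Longrightarrow> w \<in> W \<Longrightarrow> bgle (big u J) (big w I) \<longleftrightarrow> mn Q u \<preceq> mn Q w \<and> J \<subseteq> I"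
  unfolding bigle_def big_def using cle_iff[OF parQ] by auto

lemma base_ge_iff:
  "u \<in> W \<Longrightarrow> w \<in> W \<Longrightarrow> J \<in> II \<Longrightarrow> I \<in> II \<Longrightarrow>
    und_base_ge R S lam m II (und w I) (und u J) \<longleftrightarrow> J \<subseteq> I \<and> mn Q (mn (P J) u) \<preceq> mn Q (mx (P I) w)"
  unfolding und_base_ge_def und_def
  by (simp add: minpre_coset[OF parQ parP Q_P] maxpre_coset[OF parQ parP Q_P]
      cle_iff[OF parQ] mn_W[OF parP] mx_W[OF parP])

lemma bgle_refl: "x \<in> Wb \<Longrightarrow> bgle x x"
  using Wb_iff bgle_iff by auto

lemma bgle_trans: "x \<in> Wb \<Longrightarrow> y \<in> Wb \<Longrightarrow> z \<in> Wb \<Longrightarrow> bgle x y \<Longrightarrow> bgle y z \<Longrightarrow> bgle x z"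
proof -
  assume "x \<in> Wb" "y \<in> Wb" "z \<in> Wb" "bgle x y" "bgle y z"
  then obtain u v w I J K where "u \<in> W" "v \<in> W" "w \<in> W" "x = big u I" "y = big v J" "z = big w K"
    using Wb_iff by metis
  with \<open>bgle x y\<close> \<open>bgle y z\<close> show ?thesis
    using ble_trans[of "mn Q u" "mn Q v" "mn Q w"] by (auto simp: bgle_iff)
qed

lemma bgle_antisym: "x \<in> Wb \<Longrightarrow> y \<in> Wb \<Longrightarrow> bgle x y \<Longrightarrow> bgle y x \<Longrightarrow> x = y"
proof -
  assume "x \<in> Wb" "y \<in> Wb" "bgle x y" "bgle y x"
  then obtain u v I J where e: "u \<in> W" "v \<in> W" "x = big u I" "y = big v J"
    using Wb_iff by metis
  with \<open>bgle x y\<close> \<open>bgle y x\<close> have "mn Q u = mn Q v" "I = J" using bgle_iff ble_antisym by auto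
  with e show ?thesis using big_eq_iff mn_eq_iff[OF parQ] by blast
qed

lemma rho_mono:
  assumes "x \<in> Wb" "y \<in> Wb" "bgle x y" shows "unle (\<rho> x) (\<rho> y)"
proof -
  obtain u w I J where e: "u \<in> W" "w \<in> W" "I \<in> II" "J \<in> II" "x = big u J" "y = big w I"
    using assms Wb_iff by metis
  then have le: "mn Q u \<preceq> mn Q w" "J \<subseteq> I" using assms bgle_iff by auto
  have "mn (P J) u \<preceq> u" using mn_le[OF parP] e by blast
  then have "mn Q (mn (P J) u) \<preceq> mn Q u" using mn_mono[OF parQ] e by blast
  moreover have "mn Q w \<preceq> mn Q (mx (P I) w)"
    using mn_mono[OF parQ] le_mx[OF parP] mx_W[OF parP] e by blast
  ultimately have "und_base_ge R S lam m II (und w I) (und u J)"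
    using ble_trans[OF ble_trans[OF _ le(1)]] le(2) e(1-4) by (simp add: base_ge_iff)
  then show ?thesis using e rho_big und_Wu unfolding undle_def by auto
qed

lemma rho_Wu: "x \<in> Wb \<Longrightarrow> \<rho> x \<in> Wu"
  using Wb_iff rho_big und_Wu by metis

lemma unle_refl: "x \<in> Wu \<Longrightarrow> unle x x"
  using Wu_iff big_Wb rho_big rho_mono bgle_refl by metis

lemma unle_trans: "unle x y \<Longrightarrow> unle y z \<Longrightarrow> unle x z"
  unfolding undle_def by (rule tranclp_trans)

lemma big_le_und:
  "u \<in> W \<Longrightarrow> w \<in> W \<Longrightarrow> J \<in> II \<Longrightarrow> I \<in> II \<Longrightarrow> mn Q u \<preceq> mn Q w \<Longrightarrow> J \<subseteq> I \<Longrightarrow> unle (und u J) (und w I)"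
  using rho_mono[OF big_Wb big_Wb] bgle_iff rho_big by metis

lemma chain_image_std:
  assumes "C \<subseteq> Wb" "\<And>x y. x \<in> C \<Longrightarrow> y \<in> C \<Longrightarrow> bgle x y \<or> bgle y x" "inj_on \<rho> C"
  shows "deff C (\<rho> ` C)" "std (\<rho> ` C)"
proof -
  show d: "deff C (\<rho> ` C)"
    unfolding defining_def using assms by (simp add: inj_on_imp_bij_betw)
  have "und_chain R S lam m II \<tau> (\<rho> ` C)"
    unfolding und_chain_def
  proof (intro conjI ballI)
    show "\<rho> ` C \<subseteq> Wu" using assms(1) rho_Wu by blast
    fix a b assume "a \<in> \<rho> ` C" "b \<in> \<rho> ` C"
    then obtain x y where "x \<in> C" "y \<in> C" "a = \<rho> x" "b = \<rho> y" by blast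
    then show "unle a b \<or> unle b a" using assms(1,2) rho_mono by blast
  qed
  then show "std (\<rho> ` C)" unfolding tau_std_chain_def using d by blast
qed

lemma finite_Wu: "finite Wu"
proof -
  have "Wu \<subseteq> (\<lambda>p. und (fst p) (snd p)) ` (W \<times> II)"
  proof
    fix x assume "x \<in> Wu"
    then obtain w I where "w \<in> W" "I \<in> II" "x = und w I" using Wu_iff by blast
    then show "x \<in> (\<lambda>p. und (fst p) (snd p)) ` (W \<times> II)" by (intro image_eqI[of _ _ "(w, I)"]) auto
  qed
  then show ?thesis by (rule finite_subset) (simp add: finite_weyl finite_II)
qed

lemma std_Wu: "std Cu \<Longrightarrow> Cu \<subseteq> Wu"
  by (simp add: tau_std_chain_def und_chain_def)

lemma extend_std:
  assumes "std Cu" shows "\<exists>Cu'. Cu \<subseteq> Cu' \<and> maxstd Cu'"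
proof -
  have fin: "finite {C. std C}"
    using finite_subset[of "{C. std C}" "Pow Wu"] std_Wu finite_Wu by auto
  obtain M where M: "M \<in> {C. std C}" "Cu \<subseteq> M" "\<forall>C\<in>{C. std C}. M \<subseteq> C \<longrightarrow> M = C"
    using finite_has_maximal2[OF fin, of Cu] assms by auto
  then show ?thesis unfolding max_tau_std_chain_def by auto
qed

lemma deff_props:
  assumes "deff C Cu"
  shows "C \<subseteq> Wb" "\<And>x y. x \<in> C \<Longrightarrow> y \<in> C \<Longrightarrow> bgle x y \<or> bgle y x" "inj_on \<rho> C" "\<rho> ` C = Cu"
  using assms by (auto simp: defining_def bij_betw_def)

text \<open>The constant lift of \<open>u\<close> over \<open>L\<close> makes its image standard.
  That image extends to a maximal standard chain, whose defining chain may use other lifts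
  \<open>\<phi>\<close>, known only modulo \<open>P J\<close>.\<close>

lemma lift_chain:
  assumes L: "L \<subseteq> II" "\<And>J K. J \<in> L \<Longrightarrow> K \<in> L \<Longrightarrow> J \<subseteq> K \<or> K \<subseteq> J" and u: "u \<in> W"
  shows "\<exists>Cu C. maxstd Cu \<and> deff C Cu \<and> (\<forall>J\<in>L. \<exists>\<phi>\<in>W. big \<phi> J \<in> C \<and> ceq (P J) \<phi> u)"
proof -
  define C0 where "C0 = big u ` L"
  have "C0 \<subseteq> Wb" using L u big_Wb unfolding C0_def by auto
  moreover have "bgle x y \<or> bgle y x" if xy: "x \<in> C0" "y \<in> C0" for x y
  proof -
    obtain J K where "J \<in> L" "K \<in> L" "x = big u J" "y = big u K" using xy unfolding C0_def by blast
    then show ?thesis using L(2)[of J K] u by (simp add: bgle_iff)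
  qed
  moreover have "inj_on \<rho> C0"
  proof (rule inj_onI)
    fix x y assume "x \<in> C0" "y \<in> C0" and eq: "\<rho> x = \<rho> y"
    then obtain J K where "x = big u J" "y = big u K" unfolding C0_def by blast
    moreover have "snd x = snd y" using eq by (simp add: rho_def)
    ultimately show "x = y" by simp
  qed
  ultimately have "std (\<rho> ` C0)" by (rule chain_image_std)
  then obtain Cu where Cu: "\<rho> ` C0 \<subseteq> Cu" "maxstd Cu" using extend_std by blast
  then obtain C where C: "deff C Cu" unfolding max_tau_std_chain_def tau_std_chain_def by blast
  have "\<exists>\<phi>\<in>W. big \<phi> J \<in> C \<and> ceq (P J) \<phi> u" if J: "J \<in> L" for J
  proof -
    have "\<rho> (big u J) \<in> \<rho> ` C0" using J unfolding C0_def by blast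
    then have "und u J \<in> \<rho> ` C"
      using Cu(1) rho_big[OF subsetD[OF L(1) J]] deff_props(4)[OF C] by auto
    then obtain x where x: "x \<in> C" "\<rho> x = und u J" by auto
    then obtain \<phi> K where "\<phi> \<in> W" "K \<in> II" "x = big \<phi> K" using deff_props(1)[OF C] Wb_iff by blast
    then show ?thesis using x rho_big und_eq_iff u J L(1) by (metis subsetD)
  qed
  with Cu C show ?thesis by blast
qed

lemma maxstd_D: "maxstd Cu \<Longrightarrow> deff C Cu \<Longrightarrow> x \<in> C \<Longrightarrow> x \<in> D"
  unfolding Dset_def by blast

lemma rho_D: "x \<in> D \<Longrightarrow> \<rho> x \<in> Wu"
  unfolding Dset_def using deff_props(1) rho_Wu by blast

section \<open>Unique lifts of the identity cosets force (iii)\<close>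

lemma unique_identity_lift_imp_cond_iii:
  assumes uniq: "\<exists>!x. x \<in> D \<and> \<rho> x = (coset id (P I), I)"
    and I: "I \<in> II" and Is: "cover_chain II m I Is"
  shows "cond_iii I Is"
proof (rule cond_ii_iff_cond_iii(2)[OF I Is])
  note PI = parP[OF I] and QR = parQR[OF I Is] and x = star_props[OF I weyl_id]
  have order: "mn Q \<phi> \<preceq> mn Q \<psi>"
    if "deff C Cu" "big \<phi> J \<in> C" "big \<psi> K \<in> C" "\<phi> \<in> W" "\<psi> \<in> W" "J \<subset> K" for C Cu \<phi> \<psi> J K
    using deff_props(2)[OF that(1-3)] bgle_iff that(4-6) by auto
  have same: "ceq Q \<phi> \<psi>" if "deff C Cu" "big \<phi> I \<in> C" "big \<psi> I \<in> C" "ceq (P I) \<phi> \<psi>" for C Cu \<phi> \<psi>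
    using deff_props(3)[OF that(1)] that rho_big[OF I] und_eq_iff[OF _ _ I] big_eq_iff ceq_W
    unfolding inj_on_def by metis
  obtain L where L: "L \<subseteq> II" "I \<in> L" "\<forall>J\<in>L. J \<subseteq> I" "\<forall>J\<in>L. \<forall>K\<in>L. J \<subseteq> K \<or> K \<subseteq> J" "I \<subseteq> \<Union>(ul II ` L)"
    using saturated_chain_below[OF I] by (elim exE conjE) (rule that)
  obtain Cu C where C: "maxstd Cu" "deff C Cu" "\<forall>J\<in>L. \<exists>\<phi>\<in>W. big \<phi> J \<in> C \<and> ceq (P J) \<phi> (star I id)"
    using lift_chain[OF L(1) _ x(1)] L(4) by blast
  then obtain \<phi> where \<phi>: "\<phi> \<in> W" "big \<phi> I \<in> C" "ceq (P I) \<phi> (star I id)" using L(2) by blast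
  have \<phi>P: "ceq (P I) id \<phi>" using ceq_trans[OF PI x(2)] ceq_sym[OF PI \<phi>(3)] by blast
  have \<phi>J: "ceq (P J) (star I id) \<phi>" if J: "J \<in> L" for J
  proof (cases "J = I")
    case True
    then show ?thesis using ceq_sym[OF PI \<phi>(3)] by simp
  next
    case False
    have JI: "J \<in> II" "J \<subset> I" using J L False by auto
    note PJ = parP[OF JI(1)]
    obtain \<psi> where \<psi>: "\<psi> \<in> W" "big \<psi> J \<in> C" "ceq (P J) \<psi> (star I id)" using C(3) J by blast
    \<comment> \<open>Modulo \<open>P J\<close>, the element \<open>star I id\<close> represents the
      top of \<open>P I\<close>, which bounds \<open>\<phi>\<close> from above; the lift
      \<open>\<psi>\<close> at the smaller index \<open>J\<close> bounds it from below by the same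
      coset.\<close>
    have "QI I \<subseteq> P J" using QI_antimono[OF JI(1) I] QI_P[OF JI(1)] JI(2) by blast
    then have top: "ceq (P J) (mx (P I) id) (star I id)"
      unfolding star_def using ceq_mono ceq_mn[OF parQI[OF I] mx_W[OF PI weyl_id]] by blast
    have "\<phi> \<preceq> mx (P I) id" using ble_mx[OF PI \<phi>P] .
    then have "mn (P J) \<phi> \<preceq> mn (P J) (star I id)"
      using mn_mono[OF PJ _ mx_W[OF PI weyl_id]] mn_cong[OF PJ top] by metis
    moreover have "mn (P J) (mn Q \<psi>) \<preceq> mn (P J) (mn Q \<phi>)"
      using order[OF C(2) \<psi>(2) \<phi>(2) \<psi>(1) \<phi>(1) JI(2)] mn_mono[OF PJ] mn_W[OF parQ \<phi>(1)] by blast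
    then have "mn (P J) (star I id) \<preceq> mn (P J) \<phi>"
      using mn_cong[OF PJ ceq_mono[OF Q_P[OF JI(1)] ceq_mn[OF parQ]]] \<psi>(1) \<phi>(1) mn_cong[OF PJ \<psi>(3)] by metis
    ultimately have "mn (P J) (star I id) = mn (P J) \<phi>" using ble_antisym by blast
    then show ?thesis using mn_eq_iff[OF PJ x(1) \<phi>(1)] by blast
  qed
  \<comment> \<open>Agreement modulo \<open>P J\<close> along the whole saturated chain adds up to
    agreement modulo \<open>QI I\<close>.\<close>
  have "inv (star I id) \<circ> \<phi> \<in> fixer lam (ul II J)" if "J \<in> L" for J
    using \<phi>J[OF that] P_fixer[of J] that L(1) by (auto simp: ceq_def)
  then have "inv (star I id) \<circ> \<phi> \<in> (\<Inter>J\<in>L. fixer lam (ul II J))" by blast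
  then have "inv (star I id) \<circ> \<phi> \<in> fixer lam (\<Union>(ul II ` L))" using fixer_UN[of L "ul II"] L(2) by blast
  then have "inv (star I id) \<circ> \<phi> \<in> QI I" using fixer_mono[OF L(5)] QI_fixer[OF I] by blast
  then have \<phi>QI: "ceq (QI I) (star I id) \<phi>" using x(1) \<phi>(1) by (simp add: ceq_def)
  have d1: "big \<phi> I \<in> D \<and> \<rho> (big \<phi> I) = (coset id (P I), I)"
    using maxstd_D[OF C(1,2) \<phi>(2)] rho_big[OF I] \<phi>P coset_eq_iff[OF PI weyl_id \<phi>(1)] by (simp add: und_def)
  note cc = cover_chain_props[OF I Is]
  obtain Cu' C' where C': "maxstd Cu'" "deff C' Cu'" "\<forall>J\<in>set Is. \<exists>\<phi>\<in>W. big \<phi> J \<in> C' \<and> ceq (P J) \<phi> id"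
    using lift_chain[OF cc(1) _ weyl_id] cc(5) by blast
  then obtain \<psi> where \<psi>: "\<psi> \<in> W" "big \<psi> I \<in> C'" "ceq (P I) \<psi> id" using cc(3) by blast
  have d2: "big \<psi> I \<in> D \<and> \<rho> (big \<psi> I) = (coset id (P I), I)"
    using maxstd_D[OF C'(1,2) \<psi>(2)] rho_big[OF I] ceq_sym[OF PI \<psi>(3)] coset_eq_iff[OF PI weyl_id \<psi>(1)]
    by (simp add: und_def)
  have "\<psi> \<in> P J" if J: "J \<in> set Is" for J
  proof (cases "J = I")
    case True
    then show ?thesis using ceq_par[OF PI \<psi>(3)] par_id[OF PI] by blast
  next
    case False
    have JI: "J \<in> II" "I \<subset> J" using J cc(1,4) False by auto
    note PJ = parP[OF JI(1)]
    obtain \<xi> where \<xi>: "\<xi> \<in> W" "big \<xi> J \<in> C'" "ceq (P J) \<xi> id" using C'(3) J by blast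
    \<comment> \<open>The lift at the larger index lies in \<open>P J\<close> and dominates
      \<open>\<psi>\<close> modulo \<open>Q\<close>; downward closure puts \<open>\<psi>\<close>
      into \<open>P J\<close>.\<close>
    have "\<xi> \<in> P J" using ceq_par[OF PJ \<xi>(3)] par_id[OF PJ] by blast
    then have "mn Q \<xi> \<in> P J" using ceq_par[OF PJ ceq_mono[OF Q_P[OF JI(1)] ceq_mn[OF parQ \<xi>(1)]]] by blast
    then have "mn Q \<psi> \<in> P J" using order[OF C'(2) \<psi>(2) \<xi>(2) \<psi>(1) \<xi>(1) JI(2)] par_ble[OF PJ] by blast
    then show ?thesis using ceq_par[OF PJ ceq_mono[OF Q_P[OF JI(1)] ceq_mn[OF parQ \<psi>(1)]]] by blast
  qed
  then have \<psi>R: "\<psi> \<in> QR Is" by (simp add: WQr_def)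
  \<comment> \<open>Uniqueness merges the lift forced up by smaller indices with the one forced down
    by larger indices.\<close>
  have "big \<phi> I = big \<psi> I" using uniq d1 d2 by blast
  then have "ceq Q \<psi> \<phi>" using big_eq_iff[OF \<phi>(1) \<psi>(1)] ceq_sym[OF parQ] by blast
  then have "\<phi> \<in> QR Is" using ceq_par[OF QR ceq_mono[OF Q_QR[OF I Is]]] \<psi>R by blast
  moreover have "star I id \<preceq> \<phi>"
    using mn_ble[OF parQI[OF I] \<phi>QI] is_min_mn[OF parQI[OF I] x(3)] by simp
  ultimately show "star I id \<in> QR Is" using par_ble[OF QR] by blast
qed

section \<open>The canonical lift and standardness under (ii)\<close>

definition canonical_lift :: "'a elt \<Rightarrow> 'a elt" where
  "canonical_lift x = big (star (snd x) (SOME w. w \<in> fst x)) (snd x)"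

text \<open>The arbitrary choice of a representative is harmless because \<open>star\<close> is
  constant on \<open>P I\<close>-cosets.\<close>

lemma canonical_lift_und:
  assumes "w \<in> W" "I \<in> II" shows "canonical_lift (und w I) = big (star I w) I"
proof -
  have "w \<in> coset w (P I)" using coset_mem_iff[OF parP] ceq_refl[OF parP] assms by blast
  then have "(SOME v. v \<in> coset w (P I)) \<in> coset w (P I)" by (rule someI[of "\<lambda>v. v \<in> coset w (P I)"])
  then have "ceq (P I) w (SOME v. v \<in> coset w (P I))" using coset_mem_iff[OF parP] assms by blast
  then show ?thesis using star_cong[OF assms(2)] by (simp add: canonical_lift_def und_def)
qed

lemma canonical_lift_Wb: "x \<in> Wu \<Longrightarrow> canonical_lift x \<in> Wb"
  using Wu_iff canonical_lift_und star_props(1) big_Wb by metis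

lemma rho_canonical_lift: "x \<in> Wu \<Longrightarrow> \<rho> (canonical_lift x) = x"
proof -
  assume "x \<in> Wu"
  then obtain w I where e: "w \<in> W" "I \<in> II" "x = und w I" using Wu_iff by blast
  then show ?thesis
    using canonical_lift_und rho_big und_eq_iff[OF star_props(1)] star_props(2) ceq_sym[OF parP] by metis
qed

lemma mn_star: "I \<in> II \<Longrightarrow> w \<in> W \<Longrightarrow> mn Q (star I w) = star I w"
  using is_min_mn[OF parQ] star_props(4) by blast

context
  assumes c2: "\<And>I Is. I \<in> II \<Longrightarrow> cover_chain II m I Is \<Longrightarrow> cond_ii I Is"
begin

text \<open>The generating relation compares the lowest representative of one coset with the highest
  of the other. Since \<open>star\<close> sees only cosets, \<open>star_embedding\<close> may be
  applied to exactly these representatives.\<close>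

lemma canonical_lift_base:
  assumes "x \<in> Wu" "y \<in> Wu" "und_base_ge R S lam m II y x"
  shows "bgle (canonical_lift x) (canonical_lift y)"
proof -
  obtain u J w I where e: "u \<in> W" "J \<in> II" "x = und u J" "w \<in> W" "I \<in> II" "y = und w I"
    using assms Wu_iff by metis
  then have le: "J \<subseteq> I" "mn Q (mn (P J) u) \<preceq> mn Q (mx (P I) w)" using assms base_ge_iff by auto
  have "star J (mn (P J) u) \<preceq> star I (mx (P I) w)"
    using star_embedding[OF c2 e(2,5) le(1) mn_W[OF parP] mx_W[OF parP] le(2)] e by blast
  then have "star J u \<preceq> star I w"
    using star_cong[OF e(2) ceq_mn[OF parP]] star_cong[OF e(5) ceq_mx[OF parP]] e by metis
  then show ?thesis using e canonical_lift_und bgle_iff star_props(1) mn_star le(1) by auto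
qed

lemma canonical_lift_mono_Wu: "unle x y \<Longrightarrow> x \<in> Wu \<and> y \<in> Wu \<and> bgle (canonical_lift x) (canonical_lift y)"
  unfolding undle_def
proof (induction rule: tranclp_induct)
  case (base y)
  then show ?case using canonical_lift_base by blast
next
  case (step y z)
  then show ?case using canonical_lift_base bgle_trans canonical_lift_Wb by meson
qed

lemma canonical_lift_mono: "unle x y \<Longrightarrow> bgle (canonical_lift x) (canonical_lift y)" using canonical_lift_mono_Wu by blast

lemma unle_antisym: "unle x y \<Longrightarrow> unle y x \<Longrightarrow> x = y"
  using canonical_lift_mono_Wu bgle_antisym canonical_lift_Wb rho_canonical_lift by metis

lemma unle_snd: "unle x y \<Longrightarrow> snd x \<subseteq> snd y"
  using canonical_lift_mono by (fastforce simp: bigle_def canonical_lift_def big_def)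

lemma inj_on_canonical_lift_image: "Cu \<subseteq> Wu \<Longrightarrow> \<rho> ` canonical_lift ` Cu = Cu" "Cu \<subseteq> Wu \<Longrightarrow> inj_on \<rho> (canonical_lift ` Cu)"
  using rho_canonical_lift by (force simp: image_iff subset_iff, auto simp: inj_on_def subset_iff)

lemma chain_canonical_lift:
  assumes "und_chain R S lam m II \<tau> Cu"
  shows "deff (canonical_lift ` Cu) Cu" "std Cu"
proof -
  have Cu: "Cu \<subseteq> Wu" "\<And>x y. x \<in> Cu \<Longrightarrow> y \<in> Cu \<Longrightarrow> unle x y \<or> unle y x"
    using assms by (auto simp: und_chain_def)
  have "canonical_lift ` Cu \<subseteq> Wb" using Cu(1) canonical_lift_Wb by blast
  moreover have "bgle a b \<or> bgle b a" if "a \<in> canonical_lift ` Cu" "b \<in> canonical_lift ` Cu" for a b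
    using that Cu(2) canonical_lift_mono by blast
  ultimately show "deff (canonical_lift ` Cu) Cu" "std Cu"
    using chain_image_std[of "canonical_lift ` Cu"] inj_on_canonical_lift_image[OF Cu(1)] by auto
qed

lemma maxstd_chain: "maxstd Cu \<Longrightarrow> und_chain R S lam m II \<tau> Cu"
  by (simp add: max_tau_std_chain_def tau_std_chain_def)

text \<open>As all chains are standard under (ii), maximality can be exploited by inserting a single
  comparable element.\<close>

lemma maxstd_insert:
  assumes "maxstd Cu" "z \<in> Wu" "\<And>t. t \<in> Cu \<Longrightarrow> unle t z \<or> unle z t" shows "z \<in> Cu"
proof (rule ccontr)
  assume "z \<notin> Cu"
  have "und_chain R S lam m II \<tau> (insert z Cu)"
    using maxstd_chain[OF assms(1)] assms(2,3) unle_refl[OF assms(2)] unfolding und_chain_def by blast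
  then have "std (insert z Cu)" by (rule chain_canonical_lift)
  then show False using assms(1) \<open>z \<notin> Cu\<close> unfolding max_tau_std_chain_def by blast
qed

text \<open>By (ii) \<open>star I w\<close> lies in the \<open>QR Is\<close>-coset of the minimal
  representative modulo \<open>P I\<close>, which is also minimal modulo the smaller
  \<open>QR Is\<close>.\<close>

lemma mn_QR_star:
  assumes "I \<in> II" "cover_chain II m I Is" "w \<in> W"
  shows "mn (QR Is) (star I w) = mn (P I) w"
proof -
  note QR = parQR[OF assms(1,2)] and PI = parP[OF assms(1)]
  have "ceq (QR Is) (star I w) (mx (QR Is) (mn (P I) w))"
    using ceq_mono[OF Q_QR[OF assms(1,2)] star_top[OF assms(1,2) c2[OF assms(1,2)] assms(3)]] .
  then have "mn (QR Is) (star I w) = mn (QR Is) (mx (QR Is) (mn (P I) w))" by (rule mn_cong[OF QR])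
  also have "\<dots> = mn (QR Is) (mn (P I) w)" using mn_mx[OF QR mn_W[OF PI assms(3)]] .
  also have "\<dots> = mn (P I) w"
    using is_min_mn[OF QR is_min_mono[OF QR_P_self[OF assms(1,2)] mn_is_min[OF PI assms(3)]]] .
  finally show ?thesis .
qed

text \<open>Maximality leaves nothing strictly between \<open>x\<close> and \<open>y\<close>. With
  equal indices the chain property then forces length difference one. With different indices, moving
  each lift to the other index gives elements in between, so the two lifts must agree modulo both
  parabolics.\<close>

lemma consecutive:
  assumes Cu: "maxstd Cu" and xy: "x \<in> Cu" "y \<in> Cu" "x \<noteq> y" "unle x y"
    and between: "\<And>t. t \<in> Cu \<Longrightarrow> unle t x \<or> unle y t"
    and e: "u \<in> W" "J \<in> II" "x = und u J" "w \<in> W" "I \<in> II" "y = und w I"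
  shows "J = I \<and> len (mn (P I) w) = Suc (len (mn (P I) u)) \<or> star J u = star I w"
proof -
  have interval: "z = x \<or> z = y" if z: "z \<in> Wu" "unle x z" "unle z y" for z
  proof -
    have "z \<in> Cu" using maxstd_insert[OF Cu z(1)] between z unle_trans by blast
    then show ?thesis using between z unle_antisym by blast
  qed
  note PJ = parP[OF e(2)] and PI = parP[OF e(5)] and QJ = parQI[OF e(2)]
  note su = star_props[OF e(2,1)] and sw = star_props[OF e(5,4)]
  have "bgle (big (star J u) J) (big (star I w) I)"
    using canonical_lift_mono[OF xy(4)] canonical_lift_und e by simp
  then have le: "star J u \<preceq> star I w" "J \<subseteq> I" using bgle_iff su(1) sw(1) mn_star e by auto
  have und_su: "x = und (star J u) J" "y = und (star I w) I"
    using e und_eq_iff su(1,2) sw(1,2) by auto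
  show ?thesis
  proof (cases "J = I")
    case True
    have "mn (P I) (star I u) = mn (P I) u" "mn (P I) (star I w) = mn (P I) w"
      using mn_cong[OF PI] su(2) sw(2) True by metis+
    then have mle: "mn (P I) u \<preceq> mn (P I) w" using mn_mono[OF PI le(1) sw(1)] True by simp
    have "mn (P I) u \<noteq> mn (P I) w"
      using xy(3) e True und_eq_iff mn_eq_iff[OF PI] by blast
    then obtain z where z: "is_min (P I) z" "mn (P I) u \<preceq> z" "z \<preceq> mn (P I) w" "Suc (len z) = len (mn (P I) w)"
      using chain_property[OF PI mn_is_min[OF PI e(1)] mn_is_min[OF PI e(4)] mle] by blast
    have zW: "z \<in> W" using z(1) by (simp add: is_min_def)
    have xe: "x = und (mn (P I) u) I" "y = und (mn (P I) w) I"
      using e True und_eq_iff ceq_mn[OF PI] mn_W[OF PI] by auto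
    have "unle x (und z I)" "unle (und z I) y"
      unfolding xe using z zW mn_mono[OF parQ] mn_W[OF PI] e by (auto intro!: big_le_und)
    then have "und z I = x \<or> und z I = y" using interval[OF und_Wu[OF zW e(5)]] by blast
    moreover have "und z I \<noteq> y"
    proof
      assume "und z I = y"
      then have "mn (P I) z = mn (P I) w" using e zW und_eq_iff mn_cong[OF PI] by metis
      then show False using z(4) is_min_mn[OF PI z(1)] by simp
    qed
    ultimately have "mn (P I) z = mn (P I) u" using e zW True und_eq_iff mn_cong[OF PI] by metis
    then show ?thesis using z(4) is_min_mn[OF PI z(1)] True by simp
  next
    case False
    have cov: "covers II J I"
      unfolding covers_def
    proof (intro conjI notI)
      assume "\<exists>K\<in>II. J \<subset> K \<and> K \<subset> I"
      then obtain K where K: "K \<in> II" "J \<subset> K" "K \<subset> I" by blast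
      have "unle x (und (star J u) K)" "unle (und (star J u) K) y"
        unfolding und_su using K e su(1) sw(1) le mn_star by (auto intro!: big_le_und)
      then have "und (star J u) K = x \<or> und (star J u) K = y" using interval und_Wu su(1) K(1) by blast
      then have "K = J \<or> K = I" using e snd_und by metis
      then show False using K by blast
    qed (use e le False in auto)
    \<comment> \<open>The lower lift placed at index \<open>I\<close> lies in the interval and, by
      its index, must be \<open>y\<close>; dually, the upper lift placed at index \<open>J\<close>
      must be \<open>x\<close>.\<close>
    have "unle x (und (star J u) I)" "unle (und (star J u) I) y"
      unfolding und_su using e su(1) sw(1) le mn_star by (auto intro!: big_le_und)
    then have "und (star J u) I = x \<or> und (star J u) I = y" using interval und_Wu su(1) e(5) by blast
    then have "und (star J u) I = und w I" using e False snd_und by metis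
    then have cI: "ceq (P I) (star J u) w" using und_eq_iff su(1) e by blast
    have "unle x (und (star I w) J)" "unle (und (star I w) J) y"
      unfolding und_su using e su(1) sw(1) le mn_star by (auto intro!: big_le_und)
    then have "und (star I w) J = x \<or> und (star I w) J = y" using interval und_Wu sw(1) e(2) by blast
    then have "und (star I w) J = und u J" using e False snd_und by metis
    then have cJ: "ceq (P J) (star I w) u" using und_eq_iff sw(1) e by blast
    \<comment> \<open>Both lifts are compared modulo \<open>QI J\<close> and then modulo
      \<open>QR Is\<close>; by \<open>QI_QR_covers\<close> agreement in both gives agreement modulo
      \<open>Q\<close>.\<close>
    have "mn (QI J) (star I w) \<preceq> mn (QI J) (mx (P J) (star I w))"
      using mn_mono[OF QJ le_mx[OF PJ sw(1)] mx_W[OF PJ sw(1)]] .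
    also have "mn (QI J) (mx (P J) (star I w)) = star J u"
      using star_cong[OF e(2) cJ] by (simp add: star_def)
    finally have "mn (QI J) (star I w) \<preceq> star J u" .
    moreover have "star J u \<preceq> mn (QI J) (star I w)"
      using mn_mono[OF QJ le(1) sw(1)] is_min_mn[OF QJ su(3)] by simp
    ultimately have "mn (QI J) (star J u) = mn (QI J) (star I w)"
      using ble_antisym is_min_mn[OF QJ su(3)] by metis
    then have qJ: "ceq (QI J) (star J u) (star I w)" using mn_eq_iff[OF QJ su(1) sw(1)] by blast
    obtain Is where Is: "cover_chain II m I Is" using ex_cover_chain[OF e(5) e(5)] by blast
    note QR = parQR[OF e(5) Is]
    have "mn (QR Is) (star J u) \<preceq> mn (P I) w"
      using mn_mono[OF QR le(1) sw(1)] mn_QR_star[OF e(5) Is e(4)] by simp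
    moreover have "mn (P I) w \<preceq> mn (QR Is) (star J u)"
      using mn_ble[OF PI ceq_trans[OF PI ceq_sym[OF PI cI] ceq_mono[OF QR_P_self[OF e(5) Is] ceq_mn[OF QR su(1)]]]] .
    ultimately have "mn (QR Is) (star J u) = mn (QR Is) (star I w)"
      using ble_antisym mn_QR_star[OF e(5) Is e(4)] by metis
    then have "ceq (QR Is) (star J u) (star I w)" using mn_eq_iff[OF QR su(1) sw(1)] by blast
    then have "ceq Q (star J u) (star I w)"
      using qJ QI_QR_covers[OF e(5) Is cov] by (auto simp: ceq_def)
    then have "star J u = star I w" using mn_cong[OF parQ] mn_star e by metis
    then show ?thesis by blast
  qed
qed

context
  fixes Cu C assumes Cu: "maxstd Cu" and C: "deff C Cu"
begin

lemma Cu_Wu: "Cu \<subseteq> Wu" using maxstd_chain[OF Cu] by (simp add: und_chain_def)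

lemma Cu_total: "x \<in> Cu \<Longrightarrow> y \<in> Cu \<Longrightarrow> unle x y \<or> unle y x"
  using maxstd_chain[OF Cu] by (simp add: und_chain_def)

lemma finite_Cu: "finite Cu" using Cu_Wu finite_Wu finite_subset by blast

lemma rho_in_Cu: "big \<phi> J \<in> C \<Longrightarrow> J \<in> II \<Longrightarrow> und \<phi> J \<in> Cu"
  using deff_props(4)[OF C] rho_big by (metis imageI)

lemma in_C:
  assumes "z \<in> Cu" obtains \<phi> J where "\<phi> \<in> W" "J \<in> II" "big \<phi> J \<in> C" "z = und \<phi> J"
proof -
  obtain x where "x \<in> C" "\<rho> x = z" using assms deff_props(4)[OF C] by blast
  moreover then obtain \<phi> J where "\<phi> \<in> W" "J \<in> II" "x = big \<phi> J"
    using deff_props(1)[OF C] Wb_iff by blast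
  ultimately show ?thesis using that rho_big by blast
qed

text \<open>The opposite order in the defining chain would descend along \<open>\<rho>\<close> and
  contradict antisymmetry below.\<close>

lemma C_mono:
  assumes "big \<phi> J \<in> C" "big \<theta> I \<in> C" "\<phi> \<in> W" "\<theta> \<in> W" "J \<in> II" "I \<in> II"
    and "unle (und \<phi> J) (und \<theta> I)" "und \<phi> J \<noteq> und \<theta> I"
  shows "mn Q \<phi> \<preceq> mn Q \<theta>"
proof -
  have "\<not> bgle (big \<theta> I) (big \<phi> J)"
    using rho_mono[OF big_Wb[OF assms(4,6)] big_Wb[OF assms(3,5)]] rho_big assms(5-8) unle_antisym by metis
  then have "bgle (big \<phi> J) (big \<theta> I)" using deff_props(2)[OF C assms(1,2)] by blast
  then show ?thesis using bgle_iff assms by blast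
qed

lemma star_le_defining:
  assumes "z \<in> Cu"
  shows "\<forall>\<theta>\<in>W. \<forall>I\<in>II. big \<theta> I \<in> C \<and> z = und \<theta> I \<longrightarrow> star I \<theta> \<preceq> mn Q \<theta>"
  using finite_Cu assms
proof (induction z rule: finite_chain_induct[where r = unle, consumes 2, case_names refl trans antisym total first step])
  case (first z)
  show ?case
  proof (intro ballI impI)
    fix \<theta> I assume a: "\<theta> \<in> W" "I \<in> II" "big \<theta> I \<in> C \<and> z = und \<theta> I"
    note PI = parP[OF a(2)]
    have z: "z = und (star I \<theta>) I" using a und_eq_iff star_props(1,2) by auto
    \<comment> \<open>The bottom of a maximal chain has a minimal index: the same lift at a smaller
      index could otherwise be inserted. There \<open>star\<close> is just the minimal
      representative modulo \<open>P I\<close>.\<close>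
    have "\<not> (\<exists>K\<in>II. K \<subset> I)"
    proof
      assume "\<exists>K\<in>II. K \<subset> I"
      then obtain K where K: "K \<in> II" "K \<subset> I" by blast
      have "unle (und (star I \<theta>) K) z"
        unfolding z using K a star_props(1) by (auto intro!: big_le_und)
      then have "und (star I \<theta>) K \<in> Cu"
        using maxstd_insert[OF Cu und_Wu] star_props(1) a K(1) first(2) unle_trans by meson
      then have "I \<subseteq> K" using first(2) unle_snd a(3) by fastforce
      then show False using K by blast
    qed
    then have "QI I = P I" using QI_minimal a(2) by blast
    then have "star I \<theta> = mn (P I) \<theta>" using mn_mx[OF PI a(1)] by (simp add: star_def)
    then show "star I \<theta> \<preceq> mn Q \<theta>"
      using mn_ble[OF PI ceq_mono[OF Q_P[OF a(2)] ceq_mn[OF parQ a(1)]]] by simp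
  qed
next
  case (step x y)
  show ?case
  proof (intro ballI impI)
    fix \<theta> I assume a: "\<theta> \<in> W" "I \<in> II" "big \<theta> I \<in> C \<and> y = und \<theta> I"
    obtain \<phi> J where b: "\<phi> \<in> W" "J \<in> II" "big \<phi> J \<in> C" "x = und \<phi> J" using in_C step(1) by blast
    note PI = parP[OF a(2)] and QI = parQI[OF a(2)]
    have IH: "star J \<phi> \<preceq> mn Q \<phi>" using step(6) b by blast
    have "mn Q \<phi> \<preceq> mn Q \<theta>" using C_mono a b step(3,4) by blast
    then have le: "star J \<phi> \<preceq> mn Q \<theta>" using IH ble_trans by blast
    from consecutive[OF Cu step(1-5) b(1,2,4) a(1,2)] a(3)
    consider "J = I" "len (mn (P I) \<theta>) = Suc (len (mn (P I) \<phi>))" | "star J \<phi> = star I \<theta>" by blast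
    then show "star I \<theta> \<preceq> mn Q \<theta>"
    proof cases
      case 1
      \<comment> \<open>Squeeze: \<open>t\<close> lies between \<open>star I \<phi>\<close> and
        \<open>star I \<theta>\<close>, whose lengths differ by one, and it cannot be the former,
        which lies in another \<open>P I\<close>-coset.\<close>
      define t where "t = mn (QI I) \<theta>"
      have tW: "t \<in> W" unfolding t_def using mn_W[OF QI a(1)] .
      have cQ: "ceq (QI I) \<theta> (mn Q \<theta>)" using ceq_mono[OF Q_QI[OF a(2)] ceq_mn[OF parQ a(1)]] .
      have "star I \<phi> \<preceq> mn (QI I) (mn Q \<theta>)"
        using mn_mono[OF QI le mn_W[OF parQ a(1)]] is_min_mn[OF QI star_props(3)[OF a(2) b(1)]] 1(1) by simp
      then have t1: "star I \<phi> \<preceq> t" using mn_cong[OF QI cQ] by (simp add: t_def)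
      have t2: "t \<preceq> star I \<theta>"
        unfolding t_def star_def using mn_mono[OF QI le_mx[OF PI a(1)] mx_W[OF PI a(1)]] .
      have "t = star I \<theta>"
      proof (rule ccontr)
        assume "t \<noteq> star I \<theta>"
        then have "len t < len (star I \<theta>)" using ble_len[OF t2] by blast
        then have "len t \<le> len (star I \<phi>)"
          using star_props(6)[OF a(2,1)] star_props(6)[OF a(2) b(1)] 1(2) by simp
        then have "t = star I \<phi>" using ble_len[OF t1] by auto
        then have "ceq (P I) \<theta> (star I \<phi>)" using ceq_mono[OF QI_P[OF a(2)] ceq_mn[OF QI a(1)]] t_def by simp
        then have "ceq (P I) \<phi> \<theta>" using star_props(2)[OF a(2) b(1)] ceq_sym[OF PI] ceq_trans[OF PI] by blast
        then have "und \<phi> I = und \<theta> I" using und_eq_iff[OF b(1) a(1,2)] by simp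
        then show False using step(3) a(3) b(4) 1(1) by simp
      qed
      then show ?thesis using mn_ble[OF QI cQ] t_def by simp
    next
      case 2
      then show ?thesis using le by simp
    qed
  qed
qed (use Cu_Wu unle_refl unle_trans unle_antisym Cu_total in blast)+

lemma defining_le_star:
  assumes "z \<in> Cu"
  shows "\<forall>\<theta>\<in>W. \<forall>I\<in>II. big \<theta> I \<in> C \<and> z = und \<theta> I \<longrightarrow> mn Q \<theta> \<preceq> star I \<theta>"
  using finite_Cu assms
proof (induction z rule: finite_chain_induct[where r = "\<lambda>x y. unle y x", consumes 2,
      case_names refl trans antisym total first step])
  case (first z)
  show ?case
  proof (intro ballI impI)
    fix \<theta> I assume a: "\<theta> \<in> W" "I \<in> II" "big \<theta> I \<in> C \<and> z = und \<theta> I"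
    note PI = parP[OF a(2)]
    have z: "z = und (star I \<theta>) I" using a und_eq_iff star_props(1,2) by auto
    have "unle z (und (star I \<theta>) {1..m})"
      unfolding z using a star_props(1) top_II II_subset[OF a(2)] by (intro big_le_und) auto
    then have "und (star I \<theta>) {1..m} \<in> Cu"
      using maxstd_insert[OF Cu und_Wu[OF star_props(1)[OF a(2,1)] top_II]] first(2) unle_trans by meson
    then have "{1..m} \<subseteq> I" using first(2) unle_snd a(3) by fastforce
    then have "I = {1..m}" using II_subset[OF a(2)] by blast
    \<comment> \<open>At the top index the one-element chain has \<open>QR [I] = P I\<close>, so
      (ii) puts \<open>star I \<theta>\<close> in the top \<open>Q\<close>-coset of its
      \<open>P I\<close>-coset.\<close>
    then have cc: "cover_chain II m I [I]" by (simp add: cover_chain_iff)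
    have "QR [I] = P I" by (simp add: WQr_def)
    then have ceq: "ceq Q (star I \<theta>) (mx (P I) (mn (P I) \<theta>))"
      using star_top[OF a(2) cc c2[OF a(2) cc] a(1)] by simp
    have m: "mx (P I) (mn (P I) \<theta>) = mx (P I) \<theta>" using mx_cong[OF PI ceq_mn[OF PI a(1)]] by simp
    have "mn Q \<theta> \<preceq> mn Q (mx (P I) \<theta>)" using mn_mono[OF parQ le_mx[OF PI a(1)] mx_W[OF PI a(1)]] .
    also have "mn Q (mx (P I) \<theta>) = star I \<theta>" using mn_cong[OF parQ ceq] mn_star[OF a(2,1)] m by simp
    finally show "mn Q \<theta> \<preceq> star I \<theta>" .
  qed
next
  case (step y x)
  show ?case
  proof (intro ballI impI)
    fix \<phi> J assume b: "\<phi> \<in> W" "J \<in> II" "big \<phi> J \<in> C \<and> x = und \<phi> J"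
    obtain \<theta> I where a: "\<theta> \<in> W" "I \<in> II" "big \<theta> I \<in> C" "y = und \<theta> I" using in_C step(1) by blast
    note PI = parP[OF a(2)]
    have IH: "mn Q \<theta> \<preceq> star I \<theta>" using step(6) a by blast
    have "mn Q \<phi> \<preceq> mn Q \<theta>" using C_mono[of \<phi> J \<theta> I] a b step(3,4) by auto
    then have le: "mn Q \<phi> \<preceq> star I \<theta>" using IH ble_trans by blast
    have "unle t x \<or> unle y t" if "t \<in> Cu" for t using step(5)[OF that] by blast
    from consecutive[OF Cu step(2,1) step(3)[symmetric] step(4) this b(1,2) _ a(1,2,4)] b(3)
    consider "J = I" "len (mn (P I) \<theta>) = Suc (len (mn (P I) \<phi>))" | "star J \<phi> = star I \<theta>" by blast
    then show "mn Q \<phi> \<preceq> star J \<phi>"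
    proof cases
      case 1
      obtain Is where Is: "cover_chain II m I Is" using ex_cover_chain[OF a(2) a(2)] by blast
      note QR = parQR[OF a(2) Is]
      \<comment> \<open>The squeeze is now modulo \<open>QR Is\<close>: \<open>t\<close> lies
        between the minimal representatives of the two \<open>P I\<close>-cosets, of lengths
        differing by one, and must be the lower. So \<open>\<phi>\<close> lies in the
        \<open>QR Is\<close>-coset whose top, modulo \<open>Q\<close>, is
        \<open>star I \<phi>\<close>.\<close>
      define t where "t = mn (QR Is) \<phi>"
      have cP: "ceq (P I) \<phi> t" unfolding t_def using ceq_mono[OF QR_P_self[OF a(2) Is] ceq_mn[OF QR b(1)]] .
      have cR: "ceq (QR Is) \<phi> (mn Q \<phi>)" using ceq_mono[OF Q_QR[OF a(2) Is] ceq_mn[OF parQ b(1)]] .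
      have "mn (QR Is) (mn Q \<phi>) \<preceq> mn (P I) \<theta>"
        using mn_mono[OF QR le star_props(1)[OF a(2,1)]] mn_QR_star[OF a(2) Is a(1)] by simp
      then have t1: "t \<preceq> mn (P I) \<theta>" using mn_cong[OF QR cR] t_def by simp
      have t2: "mn (P I) \<phi> \<preceq> t" using mn_ble[OF PI cP] .
      have "t = mn (P I) \<phi>"
      proof (rule ccontr)
        assume "t \<noteq> mn (P I) \<phi>"
        then have "len (mn (P I) \<phi>) < len t" using ble_len[OF t2] by auto
        then have "t = mn (P I) \<theta>" using ble_len[OF t1] 1(2) by auto
        then have "ceq (P I) \<phi> \<theta>" using cP ceq_mn[OF PI a(1)] ceq_sym[OF PI] ceq_trans[OF PI] by metis
        then have "und \<phi> I = und \<theta> I" using und_eq_iff[OF b(1) a(1,2)] by simp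
        then show False using step(3) a(4) b(3) 1(1) by simp
      qed
      then have "mx (QR Is) (mn (P I) \<phi>) = mx (QR Is) \<phi>"
        using mx_cong[OF QR ceq_mn[OF QR b(1)]] t_def by simp
      then have ceq: "ceq Q (star I \<phi>) (mx (QR Is) \<phi>)"
        using star_top[OF a(2) Is c2[OF a(2) Is] b(1)] by simp
      have "mn Q \<phi> \<preceq> mn Q (mx (QR Is) \<phi>)" using mn_mono[OF parQ le_mx[OF QR b(1)] mx_W[OF QR b(1)]] .
      also have "mn Q (mx (QR Is) \<phi>) = star I \<phi>" using mn_cong[OF parQ ceq] mn_star[OF a(2) b(1)] by simp
      finally show ?thesis using 1(1) by simp
    next
      case 2
      then show ?thesis using le by simp
    qed
  qed
qed (use Cu_Wu unle_refl unle_trans unle_antisym Cu_total in blast)+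

lemma defining_unique:
  assumes "x \<in> C" shows "x = canonical_lift (\<rho> x)"
proof -
  obtain \<theta> I where e: "\<theta> \<in> W" "I \<in> II" "x = big \<theta> I"
    using assms deff_props(1)[OF C] Wb_iff by blast
  have z: "und \<theta> I \<in> Cu" using rho_in_Cu e assms by blast
  have "star I \<theta> \<preceq> mn Q \<theta>" using star_le_defining[OF z] e assms by blast
  moreover have "mn Q \<theta> \<preceq> star I \<theta>" using defining_le_star[OF z] e assms by blast
  ultimately have "mn Q (star I \<theta>) = mn Q \<theta>" using ble_antisym mn_star[OF e(2,1)] by metis
  then have "ceq Q \<theta> (star I \<theta>)" using mn_eq_iff[OF parQ e(1) star_props(1)[OF e(2,1)]] by metis
  then show ?thesis using e canonical_lift_und rho_big big_eq_iff star_props(1) by auto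
qed

end

lemma tau_standard_of_cond_ii: "tau_standard R S lam m II \<tau>"
proof -
  have D_canonical_lift: "x = canonical_lift (\<rho> x)" if "x \<in> D" for x
    using that defining_unique unfolding Dset_def by blast
  \<comment> \<open>The order on \<open>D\<close> asks for one common defining chain; a comparable
    pair is itself a chain and extends to a maximal one.\<close>
  have ext: "\<exists>Cu. maxstd Cu \<and> deff (canonical_lift ` Cu) Cu \<and> x \<in> Cu \<and> y \<in> Cu" if "unle x y" for x y
  proof -
    have "und_chain R S lam m II \<tau> {x, y}"
      using that canonical_lift_mono_Wu[OF that] unle_refl by (auto simp: und_chain_def)
    then obtain Cu where Cu: "{x, y} \<subseteq> Cu" "maxstd Cu" using chain_canonical_lift(2) extend_std by blast
    then show ?thesis using chain_canonical_lift(1)[OF maxstd_chain[OF Cu(2)]] by blast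
  qed
  have canonical_lift_D: "canonical_lift x \<in> D" if "x \<in> Wu" for x
    using ext[OF unle_refl[OF that]] maxstd_D by blast
  have "bij_betw \<rho> D Wu"
    using D_canonical_lift canonical_lift_D rho_D rho_canonical_lift by (intro bij_betw_byWitness[where f' = canonical_lift]) auto
  moreover have "Dle R S lam m II \<tau> x y \<longleftrightarrow> unle (\<rho> x) (\<rho> y)" if xy: "x \<in> D" "y \<in> D" for x y
  proof
    assume "Dle R S lam m II \<tau> x y"
    then obtain C Cu where "bgle x y" "deff C Cu" "x \<in> C" "y \<in> C" unfolding Dle_def by blast
    then show "unle (\<rho> x) (\<rho> y)" using rho_mono deff_props(1) by blast
  next
    assume le: "unle (\<rho> x) (\<rho> y)"
    obtain Cu where Cu: "maxstd Cu" "deff (canonical_lift ` Cu) Cu" "\<rho> x \<in> Cu" "\<rho> y \<in> Cu" using ext[OF le] by blast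
    have "x \<in> canonical_lift ` Cu" "y \<in> canonical_lift ` Cu" using D_canonical_lift[OF xy(1)] D_canonical_lift[OF xy(2)] Cu(3,4) by (metis imageI)+
    moreover have "bgle x y" using canonical_lift_mono[OF le] D_canonical_lift[OF xy(1)] D_canonical_lift[OF xy(2)] by simp
    ultimately show "Dle R S lam m II \<tau> x y" unfolding Dle_def using Cu by blast
  qed
  ultimately show ?thesis unfolding tau_standard_def by blast
qed

end

end

subsection \<open>Paths in the Dynkin diagram\<close>

context based_root_system begin

text \<open>The last vertex of a path is the only right descent of the product of its reflections.\<close>

lemma path_word_Pos:
  assumes "p \<noteq> []" "distinct p" "set p \<subseteq> S" "successively (\<lambda>x y. x \<bullet> y \<noteq> 0) p" "\<alpha> \<in> S" "\<alpha> \<noteq> last p"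
  shows "word p \<alpha> \<in> Pos"
  using assms
proof (induction p)
  case (Cons a p)
  show ?case
  proof (cases "p = []")
    case True
    then show ?thesis using Cons.prems by (simp add: simple_sref_Pos S_Pos)
  next
    case False
    then obtain b q where p: "p = b # q" by (cases p) auto
    have IH: "word p \<alpha> \<in> Pos" using Cons False by (simp add: successively_Cons)
    have S: "a \<in> S" "b \<in> S" "set q \<subseteq> S" "a \<notin> set p" "b \<notin> set q" "a \<noteq> b" "a \<bullet> b \<noteq> 0"
      using Cons.prems p by auto
    \<comment> \<open>If equality held, the coefficient at \<open>a\<close>, untouched by the
      letters of \<open>p\<close>, would force \<open>\<alpha> = a\<close>; then the coefficient at
      \<open>b\<close>, untouched by \<open>q\<close>, would make the neighbours \<open>a\<close>
      and \<open>b\<close> orthogonal.\<close>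
    have "word p \<alpha> \<noteq> a"
    proof
      assume eq: "word p \<alpha> = a"
      have "cf (word p \<alpha>) a = cf \<alpha> a" using cf_word[of p a \<alpha>] Cons.prems by simp
      then have "\<alpha> = a" using eq cf_S[OF S(1), of a] cf_S[OF Cons.prems(5), of a] by (simp split: if_splits)
      then have "sref b (word q a) = a" using eq p by simp
      then have "word q a = sref b a" by (metis sref_sref)
      then have "cf (sref b a) b = cf a b" using cf_word[OF S(3,5), of a] by simp
      then have "a \<bullet> b = 0" using S_nonzero[OF S(2)] S by (simp add: sref_def cf_simps cf_S)
      then show False using S by simp
    qed
    then show ?thesis using simple_sref_Pos[OF S(1) IH] by simp
  qed
qed simp

lemma foldr_comp_in_par:
  assumes "std_parabolic H" "set ws \<subseteq> H" shows "foldr (\<circ>) ws id \<in> H"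
  using assms(2)
proof (induction ws)
  case Nil
  show ?case using par_id[OF assms(1)] by (metis foldr.simps(1) id_apply)
next
  case (Cons v ws)
  have v: "v \<in> H" "set ws \<subseteq> H" using Cons.prems by simp_all
  have "foldr (\<circ>) (v # ws) id = v \<circ> foldr (\<circ>) ws id" by simp
  moreover have "v \<circ> foldr (\<circ>) ws id \<in> H" by (rule par_comp[OF assms(1) v(1) Cons.IH[OF v(2)]])
  ultimately show ?case by metis
qed

text \<open>Each element of \<open>P\<close> factors as its \<open>H\<close>-minimal representative,
  which lies in \<open>K\<close>, times an element of \<open>H\<close>.\<close>

lemma gen_by_par_union:
  assumes P: "std_parabolic P" and H: "std_parabolic H" "H \<subseteq> P" and K: "K \<subseteq> P"
    and min: "\<And>b. b \<in> P \<Longrightarrow> is_min H b \<Longrightarrow> b \<in> K"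
  shows "gen_by (H \<union> K) = P"
proof
  show "gen_by (H \<union> K) \<subseteq> P"
  proof
    fix w assume "w \<in> gen_by (H \<union> K)"
    then obtain ws where ws: "w = foldr (\<circ>) ws id" "set ws \<subseteq> H \<union> K" unfolding gen_by_def by blast
    then have "set ws \<subseteq> P" using H(2) K by blast
    then show "w \<in> P" unfolding ws(1) by (rule foldr_comp_in_par[OF P])
  qed
  show "P \<subseteq> gen_by (H \<union> K)"
  proof
    fix w assume w: "w \<in> P"
    then have W: "w \<in> W" using par_W[OF P] by blast
    have "mn H w \<in> P" using ceq_par[OF P ceq_mono[OF H(2) ceq_mn[OF H(1) W]]] w by blast
    then have k: "mn H w \<in> K" using min mn_is_min[OF H(1) W] by blast
    obtain h where h: "h \<in> H" "w = mn H w \<circ> h"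
      using ceq_sym[OF H(1) ceq_mn[OF H(1) W]] ceq_iff[OF H(1) mn_W[OF H(1) W]] by blast
    have "w = foldr (\<circ>) [mn H w, h] id" using h(2) by simp
    moreover have "set [mn H w, h] \<subseteq> H \<union> K" using h(1) k by simp
    ultimately show "w \<in> gen_by (H \<union> K)" unfolding gen_by_def by blast
  qed
qed

lemma cf_par:
  assumes "std_parabolic H" "u \<in> H" "\<gamma> \<in> S" "sref \<gamma> \<notin> H"
  shows "cf (u x) \<gamma> = cf x \<gamma>"
  using assms(1,2)
proof (induction arbitrary: x rule: par_induct)
  case (step u \<alpha>)
  then show ?case using assms(3,4) cf_sref[of \<gamma> \<alpha> x] by auto
qed simp

text \<open>If \<open>sref \<gamma>\<close> lay in neither subgroup, no product of their elements
  could change the coefficient at \<open>\<gamma>\<close>, whereas \<open>sref \<gamma>\<close> maps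
  \<open>\<gamma>\<close> to its negative.\<close>

lemma simple_of_gen_by:
  assumes H: "std_parabolic H" and K: "std_parabolic K" and "sref \<gamma> \<in> gen_by (H \<union> K)" "\<gamma> \<in> S"
  shows "\<gamma> \<in> simple_of S H \<or> \<gamma> \<in> simple_of S K"
proof (rule ccontr)
  assume n: "\<not> ?thesis"
  obtain ws where ws: "sref \<gamma> = foldr (\<circ>) ws id" "set ws \<subseteq> H \<union> K"
    using assms(3) unfolding gen_by_def by blast
  have "cf (foldr (\<circ>) ws id x) \<gamma> = cf x \<gamma>" for x
    using ws(2)
  proof (induction ws arbitrary: x)
    case (Cons v ws)
    then show ?case using cf_par[OF H, of v \<gamma>] cf_par[OF K, of v \<gamma>] n assms(4) by (auto simp: simple_of_def)
  qed simp
  from this[of \<gamma>] have "cf (- \<gamma>) \<gamma> = cf \<gamma> \<gamma>" using ws(1) by (metis sref_self)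
  then show False using assms(4) by (simp add: cf_simps cf_S)
qed

lemma rtrancl_distinct_path:
  assumes "(a, b) \<in> {(x, y). x \<in> A \<and> y \<in> A \<and> r x y}\<^sup>*" "a \<in> A"
  shows "\<exists>p. p \<noteq> [] \<and> distinct p \<and> set p \<subseteq> A \<and> successively r p \<and> hd p = a \<and> last p = b"
  using assms(1)
proof (induction rule: rtrancl_induct)
  case base
  then show ?case using assms(2) by (intro exI[of _ "[a]"]) simp
next
  case (step b c)
  then obtain p where p: "p \<noteq> []" "distinct p" "set p \<subseteq> A" "successively r p" "hd p = a" "last p = b" by blast
  show ?case
  proof (cases "c \<in> set p")
    case True
    \<comment> \<open>A walk returning to a visited vertex is cut back to its earlier visit.\<close>
    then obtain q s where "p = q @ c # s" by (meson split_list)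
    then show ?thesis using p
      by (intro exI[of _ "q @ [c]"]) (auto simp: successively_append_iff hd_append)
  next
    case False
    then show ?thesis using p step
      by (intro exI[of _ "p @ [c]"]) (auto simp: successively_append_iff)
  qed
qed

text \<open>The components of the diagram of \<open>P\<close> that meet \<open>H\<close> outside \<open>K\<close> form a set \<open>C\<close> inside \<open>H\<close>. No left
  descent of an \<open>H\<close>-minimal element lies in \<open>C\<close>, as it could be commuted to the right.\<close>

lemma path_condition_imp_min_in:
  assumes P: "std_parabolic P" and H: "std_parabolic H" "H \<subseteq> P" and K: "std_parabolic K" "K \<subseteq> P"
    and gen: "gen_by (H \<union> K) = P"
    and path: "\<And>p. dynkin_path S p \<Longrightarrow> hd p \<in> simple_of S H - simple_of S K \<Longrightarrow>
       last p \<in> simple_of S K - simple_of S H \<Longrightarrow> \<exists>v\<in>set p. v \<notin> simple_of S P"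
    and w: "w \<in> P" "is_min H w"
  shows "w \<in> K"
proof -
  define E where "E = {(x, y). x \<in> simple_of S P \<and> y \<in> simple_of S P \<and> x \<bullet> y \<noteq> 0}"
  define C where "C = {y \<in> simple_of S P. \<exists>x \<in> simple_of S H - simple_of S K. (x, y) \<in> E\<^sup>*}"
  have un: "y \<in> simple_of S H \<or> y \<in> simple_of S K" if "y \<in> simple_of S P" for y
    using simple_of_gen_by[OF H(1) K(1), of y] that gen by (auto simp: simple_of_def)
  have CH: "y \<in> simple_of S H" if y: "y \<in> C" for y
  proof (rule ccontr)
    assume n: "y \<notin> simple_of S H"
    obtain x where x: "x \<in> simple_of S H - simple_of S K" "(x, y) \<in> E\<^sup>*" using y unfolding C_def by blast
    have "x \<in> simple_of S P" using x simple_of_mono[OF H(2)] by blast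
    then obtain p where p: "p \<noteq> []" "distinct p" "set p \<subseteq> simple_of S P"
       "successively (\<lambda>x y. x \<bullet> y \<noteq> 0) p" "hd p = x" "last p = y"
      using rtrancl_distinct_path[OF x(2)[unfolded E_def]] by blast
    have "dynkin_path S p"
      using p simple_of_S by (auto simp: dynkin_path_def successively_conv_nth)
    moreover have "y \<in> simple_of S K - simple_of S H" using n un y unfolding C_def by blast
    ultimately have "\<exists>v\<in>set p. v \<notin> simple_of S P" using path p x by blast
    then show False using p by blast
  qed
  have CK: "y \<in> simple_of S K" if "y \<in> simple_of S P" "y \<notin> C" for y
    using that un[OF that(1)] unfolding C_def by blast
  have orth: "x \<bullet> y = 0" if "x \<in> C" "y \<in> simple_of S P" "y \<notin> C" for x y
  proof (rule ccontr)
    assume "x \<bullet> y \<noteq> 0"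
    then have "(x, y) \<in> E" using that unfolding E_def C_def by blast
    then have "y \<in> C" using that unfolding C_def by (blast intro: rtrancl_into_rtrancl)
    then show False using that by blast
  qed
  \<comment> \<open>Fixing \<open>C\<close> pointwise is carried along to exclude a left descent in
    \<open>C\<close>: as the shorter element fixes it, \<open>w\<close> would send this simple root
    of \<open>H\<close> to its negative, against minimality.\<close>
  have "w \<in> K \<and> (\<forall>x\<in>C. w x = x)"
    using w
  proof (induction "len w" arbitrary: w rule: less_induct)
    case less
    show ?case
    proof (cases "w = id")
      case True
      then show ?thesis using par_id[OF K(1)] by simp
    next
      case False
      have W: "w \<in> W" using less.prems(2) by (simp add: is_min_def)
      obtain \<alpha> where a: "\<alpha> \<in> S" "inv w \<alpha> \<notin> Pos" using ex_left_descent[OF W False] by blast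
      have aP: "sref \<alpha> \<in> P" using par_descent[OF P par_inv[OF P less.prems(1)] a] .
      then have aS: "\<alpha> \<in> simple_of S P" using a by (simp add: simple_of_def)
      define v where "v = sref \<alpha> \<circ> w"
      have lv: "len v < len w" using len_left_neg[OF W a] unfolding v_def by simp
      have "is_min H v" using left_descent_is_min[OF less.prems(2) a(1)] lv unfolding v_def by blast
      moreover have "v \<in> P" unfolding v_def using par_comp[OF P aP less.prems(1)] .
      ultimately have v: "v \<in> K" "\<forall>x\<in>C. v x = x" using less.hyps[OF lv] by blast+
      have wv: "w = sref \<alpha> \<circ> v" unfolding v_def by simp
      have "\<alpha> \<notin> C"
      proof
        assume c: "\<alpha> \<in> C"
        then have "w \<alpha> = - \<alpha>" using v(2) wv by simp
        moreover have "w \<alpha> \<in> Pos" using less.prems(2) CH[OF c] by (simp add: is_min_def)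
        ultimately show False using Pos_uminus[OF S_R[OF a(1)]] S_Pos[OF a(1)] by simp
      qed
      then have "sref \<alpha> \<in> K" using CK[OF aS] by (simp add: simple_of_def)
      moreover have "w x = x" if "x \<in> C" for x
        using v(2) wv that orth[OF that aS \<open>\<alpha> \<notin> C\<close>] sref_fixes_iff[OF S_nonzero[OF a(1)]] by simp
      ultimately show ?thesis using wv par_comp[OF K(1)] v(1) by blast
    qed
  qed
  then show ?thesis by blast
qed

text \<open>A path inside \<open>P\<close> gives the element \<open>word p\<close> of
  \<open>P\<close>. Its last vertex is its only possible right descent and lies outside
  \<open>H\<close>, so the element is \<open>H\<close>-minimal and hence in \<open>K\<close>. But
  the first vertex, occurring just once, is a left descent and would have to belong to
  \<open>K\<close>.\<close>

lemma min_in_imp_path_condition: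
  assumes P: "std_parabolic P" and K: "std_parabolic K"
    and min: "\<And>b. b \<in> P \<Longrightarrow> is_min H b \<Longrightarrow> b \<in> K"
    and p: "dynkin_path S p" "hd p \<in> simple_of S H - simple_of S K" "last p \<in> simple_of S K - simple_of S H"
  shows "\<exists>v\<in>set p. v \<notin> simple_of S P"
proof (rule ccontr)
  assume "\<not> ?thesis"
  then have sub: "\<forall>v\<in>set p. sref v \<in> P" by (auto simp: simple_of_def)
  have pp: "p \<noteq> []" "distinct p" "set p \<subseteq> S" "successively (\<lambda>x y. x \<bullet> y \<noteq> 0) p"
    using p(1) by (auto simp: dynkin_path_def successively_conv_nth)
  have wP: "word p \<in> P" unfolding word_def by (rule foldr_comp_in_par[OF P]) (use sub in auto)
  have W: "word p \<in> W" using word_weyl pp by blast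
  have "is_min H (word p)"
    unfolding is_min_def using W path_word_Pos[OF pp] p(3) simple_of_S by blast
  then have wK: "word p \<in> K" using min wP by blast
  obtain a q where q: "p = a # q" using pp by (cases p) auto
  have "inv (word p) = word (rev p)" using word_rev[of p] by (intro inv_unique_comp) auto
  then have "inv (word p) a = word (rev q) (- a)" by (simp add: q word_append)
  also have "\<dots> = - word (rev q) a" using weyl_uminus[OF word_weyl[of "rev q"]] pp q by simp
  finally have "cf (inv (word p) a) a = - 1"
    using cf_word[of "rev q" a a] pp q by (simp add: cf_simps cf_S)
  moreover have aS: "a \<in> S" using pp q by simp
  ultimately have "inv (word p) a \<notin> Pos" unfolding Pos_iff by force
  then have "sref a \<in> K" using par_descent[OF K par_inv[OF K wK]] pp q by simp
  then show False using p(2) q aS by (auto simp: simple_of_def)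
qed

end

section \<open>Translation of the conditions of the theorem\<close>

context standard_data begin

lemma cond_ii_statement:
  assumes "I \<in> II" "cover_chain II m I Is"
  shows "minpre R S Q (QI I) (maxpre R S (QI I) (P I) (coset id (P I)))
       = maxpre R S Q (QR Is) (minpre R S (QR Is) (P I) (coset id (P I))) \<longleftrightarrow> cond_ii I Is"
proof -
  note PI = parP[OF assms(1)] and QI = parQI[OF assms(1)] and QR = parQR[OF assms]
  have xW: "mx (P I) id \<in> W" using mx_W[OF PI weyl_id] .
  have "mn (P I) id = id" using is_min_mn[OF PI is_min_id] .
  then show ?thesis
    using maxpre_coset[OF QI PI QI_P[OF assms(1)] weyl_id] minpre_coset[OF parQ QI Q_QI[OF assms(1)] xW]
      minpre_coset[OF QR PI QR_P_self[OF assms] weyl_id] maxpre_coset[OF parQ QR Q_QR[OF assms] weyl_id]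
      coset_eq_iff[OF parQ mn_W[OF QI xW] mx_W[OF QR weyl_id]]
    by (simp add: cond_ii_def star_def)
qed

text \<open>Minimality modulo \<open>Q\<close> follows from minimality modulo the larger
  \<open>QI I\<close>, so the inclusion is about membership in \<open>QR Is\<close>.\<close>

lemma cond_iii_statement:
  assumes "I \<in> II" "cover_chain II m I Is"
  shows "P I \<inter> minreps R S (QI I) \<subseteq> QR Is \<inter> minreps R S Q \<longleftrightarrow> cond_iii I Is"
  using minreps_iff[OF parQI[OF assms(1)]] minreps_iff[OF parQ] is_min_mono[OF Q_QI[OF assms(1)]]
  by (auto simp: cond_iii_def)

lemma cond_iv_statement:
  assumes "I \<in> II" "cover_chain II m I Is"
  shows "(gen_by (QI I \<union> QR Is) = P I \<and>
             (\<forall>p. dynkin_path S p \<and>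
                  hd p \<in> simple_of S (QI I) - simple_of S (QR Is) \<and>
                  last p \<in> simple_of S (QR Is) - simple_of S (QI I)
                \<longrightarrow> (\<exists>v\<in>set p. v \<notin> simple_of S (P I)))) \<longleftrightarrow> cond_iii I Is" (is "?l \<longleftrightarrow> _")
proof -
  note PI = parP[OF assms(1)] and QI = parQI[OF assms(1)] and QR = parQR[OF assms]
    and sub = QI_P[OF assms(1)] QR_P_self[OF assms]
  show ?thesis
  proof
    assume l: ?l
    show "cond_iii I Is"
      unfolding cond_iii_def
    proof (intro ballI impI)
      fix b assume "b \<in> P I" "is_min (QI I) b"
      then show "b \<in> QR Is"
        using l by (intro path_condition_imp_min_in[OF PI QI sub(1) QR sub(2)]) auto
    qed
  next
    assume "cond_iii I Is"
    then have min: "b \<in> QR Is" if "b \<in> P I" "is_min (QI I) b" for b using that by (simp add: cond_iii_def)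
    show ?l
    proof (intro conjI allI impI)
      show "gen_by (QI I \<union> QR Is) = P I" using gen_by_par_union[OF PI QI sub min] .
    qed (use min_in_imp_path_condition[OF PI QR min] in blast)
  qed
qed

lemma tau_standard_imp_unique:
  assumes "tau_standard R S lam m II \<tau>" "I \<in> II"
  shows "\<exists>!x. x \<in> D \<and> \<rho> x = (coset id (P I), I)"
proof -
  have "(coset id (P I), I) \<in> Wu" using und_Wu[OF weyl_id assms(2)] by (simp add: und_def)
  moreover have "bij_betw \<rho> D Wu" using assms(1) by (simp add: tau_standard_def)
  ultimately obtain x where x: "x \<in> D" "\<rho> x = (coset id (P I), I)" and inj: "inj_on \<rho> D"
    unfolding bij_betw_def by (metis imageE)
  then show ?thesis using inj_onD[OF inj] by (intro ex1I[of _ x]) auto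
qed

end

theorem mainTheorem8:
  fixes R S :: "'a::euclidean_space set" and lam :: "nat \<Rightarrow> 'a" and m :: nat
    and II :: "nat set set" and \<tau> :: "('a \<Rightarrow> 'a) set"
  assumes "root_system R" and "irreducible_rs R" and "is_base R S"
    and "\<forall>i\<in>{1..m}. dominant S (lam i)"
    and "index_sys II m"
    and "\<tau> = coset (longest R S) (WQ R lam m)"
  shows "(tau_standard R S lam m II \<tau> \<longleftrightarrow>
           (\<forall>I\<in>II. \<exists>!x. x \<in> Dset R S lam m II \<tau> \<and>
                rho R lam II x = (coset id (WP R lam II I), I)))
       \<and> ((\<forall>I\<in>II. \<exists>!x. x \<in> Dset R S lam m II \<tau> \<and>
                rho R lam II x = (coset id (WP R lam II I), I)) \<longleftrightarrow>
          (\<forall>I\<in>II. \<forall>Is. cover_chain II m I Is \<longrightarrow>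
             minpre R S (WQ R lam m) (WQI R lam II I)
                (maxpre R S (WQI R lam II I) (WP R lam II I) (coset id (WP R lam II I)))
             = maxpre R S (WQ R lam m) (WQr R lam II Is)
                (minpre R S (WQr R lam II Is) (WP R lam II I) (coset id (WP R lam II I)))))
       \<and> ((\<forall>I\<in>II. \<forall>Is. cover_chain II m I Is \<longrightarrow>
             minpre R S (WQ R lam m) (WQI R lam II I)
                (maxpre R S (WQI R lam II I) (WP R lam II I) (coset id (WP R lam II I)))
             = maxpre R S (WQ R lam m) (WQr R lam II Is)
                (minpre R S (WQr R lam II Is) (WP R lam II I) (coset id (WP R lam II I)))) \<longleftrightarrow>
          (\<forall>I\<in>II. \<forall>Is. cover_chain II m I Is \<longrightarrow>
             WP R lam II I \<inter> minreps R S (WQI R lam II I)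
               \<subseteq> WQr R lam II Is \<inter> minreps R S (WQ R lam m)))
       \<and> ((\<forall>I\<in>II. \<forall>Is. cover_chain II m I Is \<longrightarrow>
             WP R lam II I \<inter> minreps R S (WQI R lam II I)
               \<subseteq> WQr R lam II Is \<inter> minreps R S (WQ R lam m)) \<longleftrightarrow>
          (\<forall>I\<in>II. \<forall>Is. cover_chain II m I Is \<longrightarrow>
             gen_by (WQI R lam II I \<union> WQr R lam II Is) = WP R lam II I \<and>
             (\<forall>p. dynkin_path S p \<and>
                  hd p \<in> simple_of S (WQI R lam II I) - simple_of S (WQr R lam II Is) \<and>
                  last p \<in> simple_of S (WQr R lam II Is) - simple_of S (WQI R lam II I)
                \<longrightarrow> (\<exists>v\<in>set p. v \<notin> simple_of S (WP R lam II I)))))"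
  (is "(?c0 \<longleftrightarrow> ?c1) \<and> (_ \<longleftrightarrow> ?c2) \<and> (_ \<longleftrightarrow> ?c3) \<and> (_ \<longleftrightarrow> ?c4)")
proof -
  interpret standard_data R S lam m II
    by (intro standard_data.intro standard_data_axioms.intro based_root_system.intro) (fact assms)+
  \<comment> \<open>Conditions (ii), (iii) and (iv) are each matched with \<open>c3\<close>; the
    implications from (0) to (i), from (i) to \<open>c3\<close> and from \<open>c3\<close> to (0)
    close the cycle.\<close>
  define c3 where "c3 \<longleftrightarrow> (\<forall>I\<in>II. \<forall>Is. cover_chain II m I Is \<longrightarrow> cond_iii I Is)"
  have c2: "?c2 \<longleftrightarrow> c3"
    unfolding c3_def using cond_ii_statement cond_ii_iff_cond_iii(1) by (metis (no_types, lifting))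
  have c3: "?c3 \<longleftrightarrow> c3"
    unfolding c3_def using cond_iii_statement by (metis (no_types, lifting))
  have c4: "?c4 \<longleftrightarrow> c3"
    unfolding c3_def using cond_iv_statement by (metis (no_types, lifting))
  have c01: "?c0 \<Longrightarrow> ?c1"
    using tau_standard_imp_unique unfolding assms(6) by blast
  have c13: "?c1 \<Longrightarrow> c3"
    unfolding c3_def assms(6) using unique_identity_lift_imp_cond_iii by blast
  have c30: "c3 \<Longrightarrow> ?c0"
    unfolding assms(6) c3_def using tau_standard_of_cond_ii cond_ii_iff_cond_iii(1) by blast
  show ?thesis using c2 c3 c4 c01 c13 c30 by argo
qed

end
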